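(* Let $q \geq 3$ be an odd integer, and let $E:\{\pm1\}^k \to \{\pm1\}^n$ be a linear $(q,\delta,\varepsilon)$-locally decodable code (so it corrects up to a $\delta$ fraction of errors). Then \[ k \leq O(1/\delta)\cdot n^{1-2/q}\log^2 n. \]
   Context: A code $E:\{\pm1\}^k\to\{\pm1\}^n$ is $(q,\delta,\varepsilon)$-locally decodable if there is a randomized algorithm $\mathsf{Dec}$ which, given an index $i\in[k]$ and oracle access to a string $y\in\{\pm1\}^n$, makes at most $q$ queries to $y$ and satisfies: for every $b\in\{\pm1\}^k$ and every $y\in\{\pm1\}^n$ differing from $E(b)$ in at most $\delta n$ coordinates, $\Pr[\mathsf{Dec}^y(i)=b_i]\geq \tfrac12+\varepsilon$. The code is linear if it is linear over $\mathbb{F}_2$ under the identification $\{\pm1\}\cong\mathbb{F}_2$, i.e. for each $v\in[n]$ there is a set $S_v\subseteq[k]$ with $E(b)_v=\prod_{j\in S_v} b_j$ for all $b$. The $O(\cdot)$ hides a constant independent of $n$, $k$ and $\delta$ (it may depend on $q$ and $\varepsilon$). *)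

theory Defs
  imports "HOL-Probability.Probability_Mass_Function"
begin

definition sign_strings :: "nat \<Rightarrow> (nat \<Rightarrow> int) set" where
  "sign_strings n = {..<n} \<rightarrow>\<^sub>E {- 1, 1}"

definition hamming_dist :: "nat \<Rightarrow> (nat \<Rightarrow> int) \<Rightarrow> (nat \<Rightarrow> int) \<Rightarrow> nat" where
  "hamming_dist n x y = card {v \<in> {..<n}. x v \<noteq> y v}"

text \<open>
  A deterministic, adaptive algorithm with oracle access: \<open>Query v f\<close> asks for coordinate
  \<open>v\<close> of the oracle and continues with \<open>f a\<close>, where \<open>a\<close> is the answer.
  A randomized algorithm is a probability distribution over such algorithms.
\<close>

datatype oracle_alg = Output int | Query nat "int \<Rightarrow> oracle_alg"

primrec run :: "oracle_alg \<Rightarrow> (nat \<Rightarrow> int) \<Rightarrow> int" where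
  "run (Output a) y = a"
| "run (Query v f) y = run (f (y v)) y"

primrec queries :: "oracle_alg \<Rightarrow> (nat \<Rightarrow> int) \<Rightarrow> nat list" where
  "queries (Output a) y = []"
| "queries (Query v f) y = v # queries (f (y v)) y"

definition local_decoder ::
  "nat \<Rightarrow> real \<Rightarrow> real \<Rightarrow> nat \<Rightarrow> nat \<Rightarrow> ((nat \<Rightarrow> int) \<Rightarrow> nat \<Rightarrow> int) \<Rightarrow>
    (nat \<Rightarrow> oracle_alg pmf) \<Rightarrow> bool" where
  "local_decoder q \<delta> \<epsilon> k n E Dec \<longleftrightarrow>
    (\<forall>i<k. \<forall>t \<in> set_pmf (Dec i). \<forall>y \<in> sign_strings n.
       length (queries t y) \<le> q \<and> set (queries t y) \<subseteq> {..<n}) \<and>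
    (\<forall>i<k. \<forall>b \<in> sign_strings k. \<forall>y \<in> sign_strings n.
       real (hamming_dist n y (E b)) \<le> \<delta> * real n \<longrightarrow>
       measure_pmf.prob (Dec i) {t. run t y = b i} \<ge> 1 / 2 + \<epsilon>)"

definition locally_decodable ::
  "nat \<Rightarrow> real \<Rightarrow> real \<Rightarrow> nat \<Rightarrow> nat \<Rightarrow> ((nat \<Rightarrow> int) \<Rightarrow> nat \<Rightarrow> int) \<Rightarrow> bool" where
  "locally_decodable q \<delta> \<epsilon> k n E \<longleftrightarrow> (\<exists>Dec. local_decoder q \<delta> \<epsilon> k n E Dec)"

definition linear_code :: "nat \<Rightarrow> nat \<Rightarrow> ((nat \<Rightarrow> int) \<Rightarrow> nat \<Rightarrow> int) \<Rightarrow> bool" where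
  "linear_code k n E \<longleftrightarrow>
    (\<forall>v<n. \<exists>S \<subseteq> {..<k}. \<forall>b \<in> sign_strings k. E b v = (\<Prod>j\<in>S. b j))"

end

theory Submission
  imports Defs
begin

text \<open>
  For each message index \<open>i\<close>, decodability from a codeword erased on any \<open>\<delta> n\<close> coordinates yields a large
  matching \<open>H\<^sub>i\<close> of sets of at most \<open>q\<close> coordinates whose product is \<open>b\<^sub>i\<close>; write \<open>m\<close> for its size and pad its
  sets to size exactly \<open>q\<close>. Cut the union of the matchings into groups sharing a nonempty core \<open>Q\<close>,
  extracted greedily at dyadic scales so that at each scale all degrees are controlled; this costs one
  logarithm. What is left has small vertex degrees and hence few sets.

  For one scale and one core size, two sets \<open>C, C'\<close> of a group give the relation that the product over
  \<open>C - Q\<close> and \<open>C' - Q\<close> equals \<open>b\<^sub>i b\<^sub>j\<close>. The Kikuchi graph lives on the \<open>l\<close>-subsets \<open>X\<close> of two disjoint copies of the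
  coordinates; \<open>(C, C')\<close> joins \<open>X\<close> to its symmetric difference with the set \<open>D\<close> formed by \<open>C - Q\<close> in the first
  copy and \<open>C' - Q\<close> in the second, provided \<open>X\<close> splits \<open>D\<close> evenly. Keeping only \<open>b\<^sub>i\<close> with \<open>i\<close> in a random half of
  the indices, each edge toggles exactly one \<open>b\<^sub>i\<close> in the \<open>F\<^sub>2\<close>-label of \<open>X\<close>. A second moment bound allows us to
  delete few edges so that every vertex has few edges of each colour. A trace argument shows that such a
  graph on \<open>N\<close> vertices has average degree \<open>O(log N)\<close> times the colour degree; as \<open>log N\<close> is about
  \<open>l log n\<close> with \<open>l\<close> about \<open>n m\<^bsup>-2/q\<^esup>\<close>, this is the theorem.
\<close>

section \<open>Graphs whose edges toggle a single label\<close>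

text \<open>
  Normalise \<open>A\<close> by \<open>\<Gamma> = deg + d\<close>, \<open>d\<close> the average degree: the vector \<open>x = sqrt \<Gamma>\<close> shows that the norm of
  \<open>M = \<Gamma>\<^bsup>-1/2\<^esup> A \<Gamma>\<^bsup>-1/2\<^esup>\<close> is at least \<open>1/2\<close>. Starting from \<open>x\<close> restricted to one label class \<open>T\<close>, a walk that
  returns to \<open>T\<close> must undo every toggle, and an undoing step has only \<open>B\<close> edges for each of the at most
  \<open>2 R\<close> outstanding colours. Comparing \<open>M\<^bsup>2R\<^esup>\<close> with this bound, summed over the at most \<open>|V|\<close> classes, gives \<open>d = O(R B)\<close>.
\<close>

lemma toggle_density:
  fixes A :: "'v \<Rightarrow> 'v \<Rightarrow> real" and \<Psi> :: "'v \<Rightarrow> 'c set" and B :: real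
  assumes finV: "finite V"
    and sym: "\<And>X Y. X \<in> V \<Longrightarrow> Y \<in> V \<Longrightarrow> A X Y = A Y X"
    and nn: "\<And>X Y. X \<in> V \<Longrightarrow> Y \<in> V \<Longrightarrow> A X Y \<ge> 0"
    and fin: "\<And>X. X \<in> V \<Longrightarrow> finite (\<Psi> X)"
    and tog: "\<And>X Y. X \<in> V \<Longrightarrow> Y \<in> V \<Longrightarrow> A X Y \<noteq> 0 \<Longrightarrow> \<exists>i. sym_diff (\<Psi> X) (\<Psi> Y) = {i}"
    and row: "\<And>X i. X \<in> V \<Longrightarrow> (\<Sum>Y | Y \<in> V \<and> sym_diff (\<Psi> X) (\<Psi> Y) = {i}. A X Y) \<le> B"
    and R: "R = 2 ^ s" "real (card V) \<le> exp (real R)"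
  shows "(\<Sum>X\<in>V. \<Sum>Y\<in>V. A X Y) \<le> 96 * real R * B * real (card V)"
proof (cases "V = {}")
  case False
  define N where "N = real (card V)"
  have Npos: "N > 0" using False finV by (simp add: N_def card_gt_0_iff)
  have Rpos: "real R \<ge> 1" using R(1) by simp
  obtain X0 where X0: "X0 \<in> V" using False by auto
  have B0: "B \<ge> 0"
  proof -
    have "0 \<le> (\<Sum>Y | Y \<in> V \<and> sym_diff (\<Psi> X0) (\<Psi> Y) = {undefined}. A X0 Y)"
      using nn X0 by (intro sum_nonneg) auto
    thus ?thesis using row[OF X0, of undefined] by linarith
  qed
  define d where "d = (\<Sum>X\<in>V. \<Sum>Y\<in>V. A X Y) / N"
  show ?thesis
  proof (rule ccontr)
    assume neg: "\<not> ?thesis"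
    hence dbig: "96 * real R * B < d" using Npos by (simp add: d_def N_def field_simps)
    have dpos: "d > 0" using dbig B0 Rpos by (smt (verit) mult_nonneg_nonneg)
    define deg where "deg X = (\<Sum>Y\<in>V. A X Y)" for X
    have deg0: "deg X \<ge> 0" if "X \<in> V" for X using nn that by (auto simp: deg_def intro: sum_nonneg)
    define \<Gamma> where "\<Gamma> X = deg X + d" for X
    have \<Gamma>pos: "\<Gamma> X > 0" if "X \<in> V" for X using deg0[OF that] dpos by (simp add: \<Gamma>_def)
    define x where "x X = sqrt (\<Gamma> X)" for X
    have xpos: "x X > 0" if "X \<in> V" for X using \<Gamma>pos[OF that] by (simp add: x_def)
    have xx: "x X * x X = \<Gamma> X" if "X \<in> V" for X using \<Gamma>pos[OF that] by (simp add: x_def)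
    define M where "M X Y = A X Y / (x X * x Y)" for X Y
    have Msym: "M X Y = M Y X" if "X \<in> V" "Y \<in> V" for X Y
      using sym[OF that] by (simp add: M_def mult.commute)
    have Mnn: "M X Y \<ge> 0" if "X \<in> V" "Y \<in> V" for X Y
      using nn[OF that] xpos that by (simp add: M_def less_imp_le)
    define ap where "ap f X = (\<Sum>Y\<in>V. M X Y * f Y)" for f X
    define ip where "ip f g = (\<Sum>X\<in>V. f X * g X)" for f g :: "'v \<Rightarrow> real"
    have ip_ap: "ip f (ap g) = ip (ap f) g" for f g
    proof -
      have "ip f (ap g) = (\<Sum>X\<in>V. \<Sum>Y\<in>V. f X * (M X Y * g Y))" by (simp add: ip_def ap_def sum_distrib_left)
      also have "\<dots> = (\<Sum>Y\<in>V. \<Sum>X\<in>V. f X * (M X Y * g Y))" by (rule sum.swap)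
      also have "\<dots> = (\<Sum>Y\<in>V. \<Sum>X\<in>V. (M Y X * f X) * g Y)"
        by (intro sum.cong refl) (simp add: Msym mult_ac)
      also have "\<dots> = ip (ap f) g" by (simp add: ip_def ap_def sum_distrib_right)
      finally show ?thesis .
    qed
    have ip_pow: "ip ((ap ^^ i) f) ((ap ^^ j) g) = ip f ((ap ^^ (i + j)) g)" for i j f g
    proof (induction i arbitrary: j)
      case (Suc i)
      have "ip ((ap ^^ Suc i) f) ((ap ^^ j) g) = ip ((ap ^^ i) f) ((ap ^^ Suc j) g)"
        by (simp add: ip_ap)
      thus ?case using Suc[of "Suc j"] by simp
    qed simp
    have CS: "(ip f g)\<^sup>2 \<le> ip f f * ip g g" for f g
      using Cauchy_Schwarz_ineq_sum[of f g V] by (simp add: ip_def power2_eq_square)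
    define a where "a j = ip x ((ap ^^ j) x)" for j
    have a_double: "(a j)\<^sup>2 \<le> a 0 * a (2 * j)" for j
      using CS[of x "(ap ^^ j) x"] ip_pow[of j x j x] by (simp add: a_def mult_2)
    have a0: "a 0 = 2 * d * N"
    proof -
      have "a 0 = (\<Sum>X\<in>V. \<Gamma> X)" by (simp add: a_def ip_def xx)
      also have "\<dots> = (\<Sum>X\<in>V. \<Sum>Y\<in>V. A X Y) + d * N" by (simp add: \<Gamma>_def deg_def sum.distrib N_def)
      finally show ?thesis using Npos by (simp add: d_def)
    qed
    have a1: "a 1 = d * N"
    proof -
      have "a 1 = (\<Sum>X\<in>V. \<Sum>Y\<in>V. x X * (M X Y * x Y))" by (simp add: a_def ip_def ap_def sum_distrib_left)
      also have "\<dots> = (\<Sum>X\<in>V. \<Sum>Y\<in>V. A X Y)"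
      proof (intro sum.cong refl)
        fix X Y assume "X \<in> V" "Y \<in> V"
        with xpos[of X] xpos[of Y] show "x X * (M X Y * x Y) = A X Y" by (simp add: M_def)
      qed
      finally show ?thesis using Npos by (simp add: d_def)
    qed
    have a0pos: "a 0 > 0" using a0 dpos Npos by simp
    \<comment> \<open>The quotient \<open>a 1 / a 0\<close> is \<open>1/2\<close>, and by
      \<open>a_double\<close> each doubling of the index at worst squares it. This is why
      \<open>R\<close> is a power of two.\<close>
    have low: "a (2 ^ r) \<ge> (1/2) ^ (2 ^ r) * a 0" for r
    proof (induction r)
      case 0 thus ?case using a0 a1 by simp
    next
      case (Suc r)
      have "((1/2) ^ (2 ^ r) * a 0)\<^sup>2 \<le> (a (2 ^ r))\<^sup>2"
        using Suc a0pos by (intro power_mono) auto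
      also have "\<dots> \<le> a 0 * a (2 * 2 ^ r)" by (rule a_double)
      finally have "a 0 * ((1/2) ^ (2 * 2 ^ r) * a 0) \<le> a 0 * a (2 * 2 ^ r)"
        by (simp add: power_mult_distrib power_even_eq power2_eq_square mult_ac)
      thus ?case using a0pos by simp
    qed
    \<comment> \<open>\<open>\<theta>\<close> is the weight of one outstanding toggle. It is chosen
      so that at most \<open>2 * R\<close> undoing colours, of weight \<open>B\<close> each, cost
      \<open>\<theta> * \<theta> * d\<close> together, in balance with the \<open>d\<close> that was
      added to the degrees.\<close>
    define \<theta> where "\<theta> = sqrt (2 * real R * B / d)"
    have \<theta>0: "\<theta> \<ge> 0" using B0 dpos by (simp add: \<theta>_def)
    have \<theta>sq: "\<theta> * \<theta> * d = 2 * real R * B" using B0 dpos by (simp add: \<theta>_def)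
    \<comment> \<open>\<open>u T j\<close> is the part of the walk vector that started in the label
      class \<open>T\<close>; \<open>s' X T\<close> counts the toggles still outstanding at
      \<open>X\<close>.\<close>
    define u where "u T j = (ap ^^ j) (\<lambda>X. if \<Psi> X = T then x X else 0)" for T j
    define s' where "s' X T = card (sym_diff (\<Psi> X) T)" for X T
    \<comment> \<open>Each step contributes \<open>2 * \<theta>\<close> and each outstanding toggle
      a further \<open>\<theta>\<close>. The support clause settles the points with more than
      \<open>j\<close> outstanding toggles, so elsewhere there are at most \<open>2 * R\<close> of
      them.\<close>
    have ub: "\<forall>X\<in>V. u T j X \<ge> 0 \<and> u T j X \<le> x X * (2 * \<theta>) ^ j * \<theta> ^ s' X T \<and> (j < s' X T \<longrightarrow> u T j X = 0)"
      if finT: "finite T" and "j \<le> 2 * R" for T j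
      using that(2)
    proof (induction j)
      case 0
      thus ?case using xpos \<theta>0 by (auto simp: u_def s'_def less_imp_le)
    next
      case (Suc j)
      have IH0: "u T j Y \<ge> 0" and IH1: "u T j Y \<le> x Y * (2 * \<theta>) ^ j * \<theta> ^ s' Y T"
        and IH2: "j < s' Y T \<Longrightarrow> u T j Y = 0" if "Y \<in> V" for Y
        using Suc that by auto
      show ?case
      proof
        fix X assume X: "X \<in> V"
        let ?W = "sym_diff (\<Psi> X) T"
        have finW: "finite ?W" using fin[OF X] finT by simp
        have uSuc: "u T (Suc j) X = (\<Sum>Y\<in>V. M X Y * u T j Y)" by (simp add: u_def ap_def)
        have nonneg: "u T (Suc j) X \<ge> 0" unfolding uSuc
          using Mnn X IH0 by (intro sum_nonneg) auto
        \<comment> \<open>Along an edge the label changes by one element, so the distance to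
          \<open>T\<close> changes by exactly one: down if that element is outstanding, up
          otherwise.\<close>
        have nb: "(i \<in> ?W \<longrightarrow> Suc (s' Y T) = s' X T) \<and> (i \<notin> ?W \<longrightarrow> s' Y T = Suc (s' X T))"
          if "Y \<in> V" "sym_diff (\<Psi> X) (\<Psi> Y) = {i}" for Y i
        proof -
          have *: "sym_diff (\<Psi> Y) T = (if i \<in> ?W then ?W - {i} else insert i ?W)"
          proof -
            have "z \<in> \<Psi> Y \<longleftrightarrow> (z \<in> \<Psi> X) \<noteq> (z = i)" for z using that(2) by blast
            thus ?thesis by auto
          qed
          have c1: "Suc (card (?W - {i})) = card ?W" if "i \<in> ?W" using card_Suc_Diff1[OF finW that] .
          have c2: "card (insert i ?W) = Suc (card ?W)" if "i \<notin> ?W" using card_insert_disjoint[OF finW that] .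
          show ?thesis unfolding s'_def * using c1 c2 by presburger
        qed
        have zero: "u T (Suc j) X = 0" if lt: "Suc j < s' X T"
          unfolding uSuc
        proof (intro sum.neutral ballI)
          fix Y assume Y: "Y \<in> V"
          show "M X Y * u T j Y = 0"
          proof (cases "A X Y = 0")
            case False
            then obtain i where i: "sym_diff (\<Psi> X) (\<Psi> Y) = {i}" using tog X Y by blast
            have "j < s' Y T"
            proof (cases "i \<in> ?W")
              case True
              hence "Suc (s' Y T) = s' X T" using nb[OF Y i] by (rule_tac mp[OF conjunct1])
              thus ?thesis using lt by linarith
            next
              case False
              hence "s' Y T = Suc (s' X T)" using nb[OF Y i] by (rule_tac mp[OF conjunct2])
              thus ?thesis using lt by linarith
            qed
            thus ?thesis using IH2[OF Y] by simp
          qed (simp add: M_def)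
        qed
        have bound: "u T (Suc j) X \<le> x X * (2 * \<theta>) ^ Suc j * \<theta> ^ s' X T"
        proof (cases "Suc j < s' X T")
          case True
          thus ?thesis using zero \<theta>0 xpos[OF X] by simp
        next
          case False
          define I where "I Y = (\<exists>i\<in>?W. sym_diff (\<Psi> X) (\<Psi> Y) = {i})" for Y
          have "u T (Suc j) X \<le> (\<Sum>Y\<in>V. M X Y * (x Y * (2 * \<theta>) ^ j * \<theta> ^ s' Y T))"
            unfolding uSuc using Mnn X IH1 by (intro sum_mono mult_left_mono) auto
          also have "\<dots> = (2 * \<theta>) ^ j / x X * (\<Sum>Y\<in>V. A X Y * \<theta> ^ s' Y T)"
            unfolding sum_distrib_left
          proof (intro sum.cong refl)
            fix Y assume "Y \<in> V"
            with xpos[of Y] xpos[OF X] show "M X Y * (x Y * (2 * \<theta>) ^ j * \<theta> ^ s' Y T) = (2 * \<theta>) ^ j / x X * (A X Y * \<theta> ^ s' Y T)"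
              by (simp add: M_def)
          qed
          \<comment> \<open>Every neighbour is charged as if it moved away from \<open>T\<close>;
            the neighbours that undo a toggle, recognised by \<open>I\<close>, get a second
            term.\<close>
          also have "(\<Sum>Y\<in>V. A X Y * \<theta> ^ s' Y T) \<le>
              (\<Sum>Y\<in>V. A X Y * \<theta> ^ Suc (s' X T) + (if I Y then A X Y * \<theta> ^ (s' X T - 1) else 0))"
          proof (intro sum_mono)
            fix Y assume Y: "Y \<in> V"
            show "A X Y * \<theta> ^ s' Y T \<le> A X Y * \<theta> ^ Suc (s' X T) + (if I Y then A X Y * \<theta> ^ (s' X T - 1) else 0)"
            proof (cases "A X Y = 0")
              case False
              then obtain i where i: "sym_diff (\<Psi> X) (\<Psi> Y) = {i}" using tog X Y by blast
              have A0: "A X Y \<ge> 0" using nn X Y by simp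
              show ?thesis
              proof (cases "i \<in> ?W")
                case True
                hence "I Y" using i by (auto simp: I_def)
                moreover have "Suc (s' Y T) = s' X T" using True nb[OF Y i] by (rule_tac mp[OF conjunct1])
                hence "s' Y T = s' X T - 1" by linarith
                moreover have "A X Y * \<theta> ^ Suc (s' X T) \<ge> 0" using A0 \<theta>0 by simp
                ultimately show ?thesis by simp
              next
                case iW: False
                hence "s' Y T = Suc (s' X T)" using nb[OF Y i] by (rule_tac mp[OF conjunct2])
                thus ?thesis using A0 \<theta>0 by simp
              qed
            qed simp
          qed
          also have "\<dots> = deg X * \<theta> ^ Suc (s' X T) + \<theta> ^ (s' X T - 1) * (\<Sum>Y | Y \<in> V \<and> I Y. A X Y)"
            using finV by (simp add: sum.distrib deg_def sum_distrib_left sum_distrib_right sum.If_cases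
                Int_def mult_ac)
          also have "(\<Sum>Y | Y \<in> V \<and> I Y. A X Y) = (\<Sum>i\<in>?W. \<Sum>Y | Y \<in> V \<and> sym_diff (\<Psi> X) (\<Psi> Y) = {i}. A X Y)"
          proof -
            have "{Y. Y \<in> V \<and> I Y} = (\<Union>i\<in>?W. {Y. Y \<in> V \<and> sym_diff (\<Psi> X) (\<Psi> Y) = {i}})"
              by (auto simp: I_def)
            thus ?thesis using finW finV by (simp only:) (subst sum.UNION_disjoint, auto)
          qed
          \<comment> \<open>With nothing outstanding no neighbour undoes a toggle; this case is
            separate because of the truncated subtraction in the exponent.\<close>
          also have "\<theta> ^ (s' X T - 1) * (\<Sum>i\<in>?W. \<Sum>Y | Y \<in> V \<and> sym_diff (\<Psi> X) (\<Psi> Y) = {i}. A X Y)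
              \<le> d * \<theta> ^ Suc (s' X T)"
          proof (cases "s' X T = 0")
            case True
            hence "?W = {}" using finW by (simp add: s'_def)
            hence "(\<Sum>i\<in>?W. \<Sum>Y | Y \<in> V \<and> sym_diff (\<Psi> X) (\<Psi> Y) = {i}. A X Y) = 0" by (simp only: sum.empty)
            thus ?thesis using dpos \<theta>0 by simp
          next
            case F: False
            have "(\<Sum>i\<in>?W. \<Sum>Y | Y \<in> V \<and> sym_diff (\<Psi> X) (\<Psi> Y) = {i}. A X Y) \<le> (\<Sum>i\<in>?W. B)"
              by (intro sum_mono row X)
            also have "\<dots> = real (s' X T) * B" by (simp add: s'_def)
            also have "\<dots> \<le> real (2 * R) * B" using False Suc.prems B0 by (intro mult_right_mono) auto
            also have "\<dots> = \<theta> * \<theta> * d" using \<theta>sq by simp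
            finally have "\<theta> ^ (s' X T - 1) * (\<Sum>i\<in>?W. \<Sum>Y | Y \<in> V \<and> sym_diff (\<Psi> X) (\<Psi> Y) = {i}. A X Y)
                \<le> \<theta> ^ (s' X T - 1) * (\<theta> * \<theta> * d)" using \<theta>0 by (intro mult_left_mono) auto
            also have "\<theta> ^ (s' X T - 1) * (\<theta> * \<theta> * d) = d * \<theta> ^ Suc (s' X T)"
              using F by (cases "s' X T") (auto simp: mult_ac)
            finally show ?thesis .
          qed
          finally have "u T (Suc j) X \<le> (2 * \<theta>) ^ j / x X * (deg X * \<theta> ^ Suc (s' X T) + d * \<theta> ^ Suc (s' X T))"
            using \<theta>0 xpos[OF X] by (simp add: mult_left_mono divide_right_mono)
          \<comment> \<open>The two terms combine to \<open>\<Gamma> X = deg X + d\<close>, the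
            square of \<open>x X\<close>, and one factor cancels.\<close>
          also have "\<dots> = (2 * \<theta>) ^ j / x X * (x X * x X) * \<theta> ^ Suc (s' X T)"
            by (simp add: xx[OF X] \<Gamma>_def algebra_simps add_divide_distrib)
          also have "\<dots> = x X * (2 * \<theta>) ^ j * \<theta> ^ Suc (s' X T)" using xpos[OF X] by simp
          also have "\<dots> \<le> x X * (2 * \<theta>) ^ Suc j * \<theta> ^ s' X T" using xpos[OF X] \<theta>0
            by (simp add: mult_ac)
          finally show ?thesis .
        qed
        show "u T (Suc j) X \<ge> 0 \<and> u T (Suc j) X \<le> x X * (2 * \<theta>) ^ Suc j * \<theta> ^ s' X T \<and> (Suc j < s' X T \<longrightarrow> u T (Suc j) X = 0)"
          using nonneg bound zero by blast
      qed
    qed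
    let ?P = "\<Psi> ` V"
    have finP: "finite ?P" using finV by simp
    have lin: "(ap ^^ j) x X = (\<Sum>T\<in>?P. u T j X)" if "X \<in> V" for X j
      using that
    proof (induction j arbitrary: X)
      case 0
      have "(\<Sum>T\<in>?P. if \<Psi> X = T then x X else 0) = x X" using finP 0 by (subst sum.delta') auto
      thus ?case by (simp add: u_def)
    next
      case (Suc j)
      have "(ap ^^ Suc j) x X = (\<Sum>Y\<in>V. M X Y * (\<Sum>T\<in>?P. u T j Y))" by (simp add: ap_def Suc.IH)
      also have "\<dots> = (\<Sum>T\<in>?P. \<Sum>Y\<in>V. M X Y * u T j Y)" unfolding sum_distrib_left by (rule sum.swap)
      also have "\<dots> = (\<Sum>T\<in>?P. u T (Suc j) X)" by (simp add: u_def ap_def)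
      finally show ?case .
    qed
    \<comment> \<open>Splitting \<open>x\<close> by label classes costs the number of classes by
      Cauchy-Schwarz. Self-adjointness then turns each squared norm into a walk of length
      \<open>2 * R\<close> from \<open>T\<close> back to \<open>T\<close>, where
      \<open>s' X T = 0\<close>.\<close>
    have "a (2 * R) = ip ((ap ^^ R) x) ((ap ^^ R) x)" using ip_pow[of R x R x] by (simp add: a_def mult_2)
    also have "\<dots> = (\<Sum>X\<in>V. (\<Sum>T\<in>?P. 1 * u T R X)\<^sup>2)" by (simp add: ip_def lin power2_eq_square)
    also have "\<dots> \<le> (\<Sum>X\<in>V. (\<Sum>T\<in>?P. 1\<^sup>2) * (\<Sum>T\<in>?P. (u T R X)\<^sup>2))"
      by (intro sum_mono Cauchy_Schwarz_ineq_sum)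
    also have "\<dots> = real (card ?P) * (\<Sum>X\<in>V. \<Sum>T\<in>?P. (u T R X)\<^sup>2)" by (simp add: sum_distrib_left)
    also have "(\<Sum>X\<in>V. \<Sum>T\<in>?P. (u T R X)\<^sup>2) = (\<Sum>T\<in>?P. \<Sum>X\<in>V. (u T R X)\<^sup>2)" by (rule sum.swap)
    also have "\<dots> = (\<Sum>T\<in>?P. ip (u T 0) (u T (2 * R)))"
    proof (intro sum.cong refl)
      fix T
      have "(\<Sum>X\<in>V. (u T R X)\<^sup>2) = ip (u T R) (u T R)" by (simp add: ip_def power2_eq_square)
      also have "\<dots> = ip (u T 0) (u T (2 * R))" unfolding u_def by (simp add: ip_pow mult_2)
      finally show "(\<Sum>X\<in>V. (u T R X)\<^sup>2) = ip (u T 0) (u T (2 * R))" .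
    qed
    also have "\<dots> \<le> (\<Sum>T\<in>?P. \<Sum>X\<in>V. if \<Psi> X = T then \<Gamma> X * (2 * \<theta>) ^ (2 * R) else 0)"
      unfolding ip_def
    proof (intro sum_mono)
      fix T X assume T: "T \<in> ?P" and X: "X \<in> V"
      have "finite T" using T fin by auto
      from ub[OF this, of "2 * R"] X have *: "u T (2 * R) X \<le> x X * (2 * \<theta>) ^ (2 * R) * \<theta> ^ s' X T" by auto
      show "u T 0 X * u T (2 * R) X \<le> (if \<Psi> X = T then \<Gamma> X * (2 * \<theta>) ^ (2 * R) else 0)"
      proof (cases "\<Psi> X = T")
        case True
        hence "s' X T = 0" by (simp add: s'_def)
        hence "x X * u T (2 * R) X \<le> x X * (x X * (2 * \<theta>) ^ (2 * R))"
          using * xpos[OF X] by (intro mult_left_mono) auto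
        also have "\<dots> = \<Gamma> X * (2 * \<theta>) ^ (2 * R)" using xx[OF X] by (simp add: mult.assoc[symmetric])
        finally show ?thesis using True by (simp add: u_def)
      qed (simp add: u_def)
    qed
    also have "\<dots> = (\<Sum>X\<in>V. \<Sum>T\<in>?P. if \<Psi> X = T then \<Gamma> X * (2 * \<theta>) ^ (2 * R) else 0)" by (rule sum.swap)
    also have "\<dots> = (\<Sum>X\<in>V. \<Gamma> X * (2 * \<theta>) ^ (2 * R))"
    proof (intro sum.cong refl)
      fix X assume "X \<in> V"
      thus "(\<Sum>T\<in>?P. if \<Psi> X = T then \<Gamma> X * (2 * \<theta>) ^ (2 * R) else 0) = \<Gamma> X * (2 * \<theta>) ^ (2 * R)"
        using finP by (subst sum.delta') auto
    qed
    also have "\<dots> = a 0 * (2 * \<theta>) ^ (2 * R)" by (simp add: sum_distrib_right a_def ip_def xx)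
    finally have up: "a (2 * R) \<le> real (card ?P) * (a 0 * (2 * \<theta>) ^ (2 * R))"
      by (simp add: mult_left_mono)
    have cardP: "real (card ?P) \<le> N" using finV by (simp add: N_def card_image_le)
    have "(1/2) ^ (2 * R) * a 0 \<le> a (2 * R)" using low[of "Suc s"] R(1) by simp
    also note up
    also have "real (card ?P) * (a 0 * (2 * \<theta>) ^ (2 * R)) \<le> N * (a 0 * (2 * \<theta>) ^ (2 * R))"
      using cardP a0pos \<theta>0 by (intro mult_right_mono) auto
    finally have "(1/2) ^ (2 * R) \<le> N * (2 * \<theta>) ^ (2 * R)" using a0pos by simp
    hence "2 ^ (2 * R) * (1/2) ^ (2 * R) \<le> 2 ^ (2 * R) * (N * (2 * \<theta>) ^ (2 * R))" by (intro mult_left_mono) auto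
    moreover have "2 ^ (2 * R) * (1/2) ^ (2 * R) = (1::real)"
      by (subst power_mult_distrib[symmetric]) simp
    moreover have "(4 * \<theta>) ^ (2 * R) = 2 ^ (2 * R) * (2 * \<theta>) ^ (2 * R)"
      by (subst power_mult_distrib[symmetric]) simp
    ultimately have "1 \<le> N * (4 * \<theta>) ^ (2 * R)" by (simp only: mult.left_commute)
    also have "(4 * \<theta>) ^ (2 * R) = (16 * (\<theta> * \<theta>)) ^ R" by (simp add: power_mult power2_eq_square)
    also have "16 * (\<theta> * \<theta>) = 32 * real R * B / d" using \<theta>sq dpos by (simp add: field_simps)
    finally have ge1: "1 \<le> N * (32 * real R * B / d) ^ R" .
    \<comment> \<open>The constant 96 is \<open>3 * 32\<close>: the base falls below
      \<open>1/3\<close>, and the factor \<open>N \<le> exp R\<close> cannot make up for it because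
      \<open>exp 1 \<le> 3\<close>.\<close>
    have "32 * real R * B / d < 1 / 3" using dbig dpos by (simp add: field_simps)
    moreover have "0 \<le> 32 * real R * B / d" using B0 dpos by simp
    ultimately have "(32 * real R * B / d) ^ R < (1/3) ^ R" using Rpos by (intro power_strict_mono) auto
    hence "N * (32 * real R * B / d) ^ R < N * (1/3) ^ R" using Npos by simp
    also have "\<dots> \<le> exp (real R) * (1/3) ^ R" using R(2) by (intro mult_right_mono) (auto simp: N_def)
    also have "\<dots> = (exp 1 / 3) ^ R" by (simp add: power_divide exp_of_nat_mult[symmetric])
    also have "\<dots> \<le> 1" using exp_le by (intro power_le_one) auto
    finally show False using ge1 by simp
  qed
qed simp

section \<open>Matchings from local decoders\<close>

text \<open>The sum over F_2 of the indicator vectors of the sets \<open>S v\<close>, written as a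
  set.\<close>

definition xor_sum :: "('a \<Rightarrow> 'c set) \<Rightarrow> 'a set \<Rightarrow> 'c set" where
  "xor_sum S W = {j. odd (card {v \<in> W. j \<in> S v})}"

lemma xor_sum_empty [simp]: "xor_sum S {} = {}"
  by (simp add: xor_sum_def)

lemma xor_sum_Un_disjoint:
  assumes "finite X" "finite Y" "X \<inter> Y = {}"
  shows "xor_sum S (X \<union> Y) = sym_diff (xor_sum S X) (xor_sum S Y)"
proof -
  have "odd (card {v \<in> X \<union> Y. j \<in> S v}) \<longleftrightarrow> odd (card {v \<in> X. j \<in> S v}) \<noteq> odd (card {v \<in> Y. j \<in> S v})" for j
  proof -
    have "{v \<in> X \<union> Y. j \<in> S v} = {v \<in> X. j \<in> S v} \<union> {v \<in> Y. j \<in> S v}" by auto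
    hence "card {v \<in> X \<union> Y. j \<in> S v} = card {v \<in> X. j \<in> S v} + card {v \<in> Y. j \<in> S v}"
      using assms by (simp only:) (subst card_Un_disjoint, auto)
    thus ?thesis by auto
  qed
  thus ?thesis by (auto simp: xor_sum_def)
qed

lemma xor_sum_sym_diff:
  assumes "finite X" "finite Y"
  shows "xor_sum S (sym_diff X Y) = sym_diff (xor_sum S X) (xor_sum S Y)"
proof -
  have X: "xor_sum S X = sym_diff (xor_sum S (X - Y)) (xor_sum S (X \<inter> Y))"
    using assms by (subst xor_sum_Un_disjoint[symmetric]) (auto simp: Un_Diff_Int)
  have Y: "xor_sum S Y = sym_diff (xor_sum S (Y - X)) (xor_sum S (X \<inter> Y))"
    using assms by (subst xor_sum_Un_disjoint[symmetric]) (auto simp: Un_Diff_Int Int_commute[of X])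
  have "xor_sum S (sym_diff X Y) = sym_diff (xor_sum S (X - Y)) (xor_sum S (Y - X))"
    using assms by (intro xor_sum_Un_disjoint) auto
  thus ?thesis unfolding X Y by blast
qed

lemma xor_sum_insert:
  assumes "finite W" "v \<notin> W"
  shows "xor_sum S (insert v W) = sym_diff (S v) (xor_sum S W)"
proof -
  have "xor_sum S {v} = S v"
    by (auto simp: xor_sum_def Collect_conv_if)
  thus ?thesis using xor_sum_Un_disjoint[of "{v}" W S] assms by simp
qed

text \<open>The elements of \<open>I \<inter> J\<close> occur squared on the right.\<close>

lemma prod_sign_sym_diff:
  fixes b :: "'c \<Rightarrow> real"
  assumes "finite I" "finite J" "\<And>j. j \<in> I \<union> J \<Longrightarrow> b j * b j = 1"
  shows "prod b (sym_diff I J) = prod b I * prod b J"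
proof -
  have sq: "prod b (I \<inter> J) * prod b (I \<inter> J) = 1"
    using assms(3) by (simp add: prod.distrib[symmetric])
  have "prod b I = prod b (I - J) * prod b (I \<inter> J)"
    using assms(1) by (subst prod.union_disjoint[symmetric]) (auto intro: arg_cong[of _ _ "prod b"])
  moreover have "prod b J = prod b (J - I) * prod b (I \<inter> J)"
    using assms(2) by (subst prod.union_disjoint[symmetric]) (auto intro: arg_cong[of _ _ "prod b"])
  moreover have "prod b (sym_diff I J) = prod b (I - J) * prod b (J - I)"
    using assms by (intro prod.union_disjoint) auto
  ultimately have "prod b I * prod b J = prod b (sym_diff I J) * (prod b (I \<inter> J) * prod b (I \<inter> J))"
    by (simp add: mult_ac)
  thus ?thesis using sq by simp
qed

lemma xor_sum_subset: "xor_sum S W \<subseteq> (\<Union>v\<in>W. S v)"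
proof
  fix j assume j: "j \<in> xor_sum S W"
  show "j \<in> (\<Union>v\<in>W. S v)"
  proof (rule ccontr)
    assume "j \<notin> (\<Union>v\<in>W. S v)"
    hence "{v \<in> W. j \<in> S v} = {}" by auto
    with j show False by (simp add: xor_sum_def)
  qed
qed

text \<open>For a linear code with supports \<open>S\<close>, this says that the product of the
  codeword over \<open>W\<close> is the character of \<open>xor_sum S W\<close>; so
  \<open>xor_sum S W = {i}\<close> means that \<open>W\<close> recovers the message bit
  \<open>b i\<close>.\<close>

lemma prod_prod_xor_sum:
  fixes b :: "'c \<Rightarrow> real"
  assumes "finite W" "\<And>v. v \<in> W \<Longrightarrow> finite (S v)" "\<And>v j. v \<in> W \<Longrightarrow> j \<in> S v \<Longrightarrow> b j * b j = 1"
  shows "(\<Prod>v\<in>W. prod b (S v)) = prod b (xor_sum S W)"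
  using assms
proof (induction W rule: finite_induct)
  case (insert v W)
  have fin: "finite (xor_sum S W)"
    using insert by (intro finite_subset[OF xor_sum_subset]) auto
  have "(\<Prod>v\<in>insert v W. prod b (S v)) = prod b (S v) * prod b (xor_sum S W)"
  proof -
    have "(\<Prod>v\<in>W. prod b (S v)) = prod b (xor_sum S W)"
      using insert.prems by (intro insert.IH) blast+
    thus ?thesis using insert.hyps by simp
  qed
  also have "\<dots> = prod b (sym_diff (S v) (xor_sum S W))"
  proof (intro prod_sign_sym_diff[symmetric])
    show "b j * b j = 1" if "j \<in> S v \<union> xor_sum S W" for j
      using that insert.prems(2) xor_sum_subset[of S W] by blast
  qed (use insert.prems fin in auto)
  also have "\<dots> = prod b (xor_sum S (insert v W))" using insert by (subst xor_sum_insert) auto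
  finally show ?case .
qed simp

section \<open>Characters and query algorithms\<close>

lemma finite_sign_strings [simp]: "finite (sign_strings n)"
  by (simp add: sign_strings_def finite_PiE)

lemma card_sign_strings: "card (sign_strings n) = 2 ^ n"
  by (simp add: sign_strings_def card_PiE numeral_2_eq_2)

lemma sign_stringsD: "b \<in> sign_strings n \<Longrightarrow> j < n \<Longrightarrow> b j = - 1 \<or> b j = 1"
  by (auto simp: sign_strings_def)

text \<open>Flipping one coordinate in \<open>J\<close> is a sign-reversing involution of the
  strings.\<close>

lemma sum_character_eq_0:
  assumes "J \<subseteq> {..<k}" "J \<noteq> {}"
  shows "(\<Sum>b\<in>sign_strings k. \<Prod>j\<in>J. real_of_int (b j)) = 0"
proof -
  obtain j where j: "j \<in> J" using assms by auto
  have fin: "finite J" using assms(1) finite_subset by blast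
  define fl where "fl b = b(j := - b j)" for b :: "nat \<Rightarrow> int"
  have "(\<Sum>b\<in>sign_strings k. \<Prod>i\<in>J. real_of_int (b i)) = (\<Sum>b\<in>sign_strings k. \<Prod>i\<in>J. real_of_int (fl b i))"
    by (rule sum.reindex_bij_witness[of _ fl fl]) 
      (use j assms in \<open>auto simp: fl_def sign_strings_def PiE_iff extensional_def\<close>)
  also have "\<dots> = (\<Sum>b\<in>sign_strings k. - (\<Prod>i\<in>J. real_of_int (b i)))"
  proof (intro sum.cong refl)
    fix b
    have "(\<Prod>i\<in>J - {j}. real_of_int (fl b i)) = (\<Prod>i\<in>J - {j}. real_of_int (b i))"
      by (intro prod.cong) (auto simp: fl_def)
    thus "(\<Prod>i\<in>J. real_of_int (fl b i)) = - (\<Prod>i\<in>J. real_of_int (b i))"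
      using prod.remove[OF fin j, of "\<lambda>i. real_of_int (b i)"] prod.remove[OF fin j, of "\<lambda>i. real_of_int (fl b i)"]
      by (simp add: fl_def)
  qed
  finally show ?thesis by (simp add: sum_negf)
qed

text \<open>
  \<open>P\<close> holds the coordinates queried so far and \<open>a\<close> their answers; up to scaling, the product over \<open>P\<close> is
  the indicator of the inputs that lead to the current node.
\<close>

lemma oracle_alg_uncorrelated:
  fixes y :: "'b \<Rightarrow> nat \<Rightarrow> int" and \<xi> :: "'b \<Rightarrow> real" and g :: "int \<Rightarrow> real"
  assumes finB: "finite B"
    and y: "\<And>b v. b \<in> B \<Longrightarrow> v < n \<Longrightarrow> y b v = - 1 \<or> y b v = 1"
    and unc: "\<And>W. W \<subseteq> {..<n} \<Longrightarrow> card W \<le> q \<Longrightarrow> (\<Sum>b\<in>B. \<xi> b * (\<Prod>v\<in>W. real_of_int (y b v))) = 0"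
    and "P \<subseteq> {..<n}" "\<And>v. v < n \<Longrightarrow> a v = - 1 \<or> a v = 1"
    and "\<And>z. z \<in> sign_strings n \<Longrightarrow> (\<forall>v\<in>P. z v = a v) \<Longrightarrow>
      length (queries t z) + card P \<le> q \<and> set (queries t z) \<subseteq> {..<n}"
  shows "(\<Sum>b\<in>B. (\<Prod>v\<in>P. 1 + real_of_int (a v) * real_of_int (y b v)) * \<xi> b * g (run t (y b))) = 0"
  using assms(4-6)
proof (induction t arbitrary: P a)
  case (Output c)
  have finP: "finite P" using Output(1) finite_subset by blast
  \<comment> \<open>The answers \<open>a\<close> extend to a full oracle string, for which the query
    bound at a leaf reads \<open>card P \<le> q\<close>.\<close>
  have "restrict a {..<n} \<in> sign_strings n" using Output(2) by (auto simp: sign_strings_def)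
  moreover have "\<forall>v\<in>P. restrict a {..<n} v = a v" using Output(1) by auto
  ultimately have cP: "card P \<le> q" using Output(3) by fastforce
  \<comment> \<open>Expanding the product gives one term for each subset of \<open>P\<close>, and
    all these subsets have at most \<open>q\<close> elements.\<close>
  have "(\<Sum>b\<in>B. (\<Prod>v\<in>P. 1 + real_of_int (a v) * real_of_int (y b v)) * \<xi> b * g c) =
      (\<Sum>b\<in>B. \<Sum>W\<in>Pow P. (\<Prod>v\<in>W. real_of_int (a v)) * (\<xi> b * (\<Prod>v\<in>W. real_of_int (y b v))) * g c)"
    using finP by (intro sum.cong refl)
      (simp add: prod_add[of P "\<lambda>v. real_of_int (a v) * real_of_int (y b v)" "\<lambda>_. 1" for b] add.commute[of 1]
        prod.distrib sum_distrib_right sum_distrib_left mult_ac)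
  also have "\<dots> = (\<Sum>W\<in>Pow P. (\<Prod>v\<in>W. real_of_int (a v)) * (\<Sum>b\<in>B. \<xi> b * (\<Prod>v\<in>W. real_of_int (y b v))) * g c)"
    by (subst sum.swap) (simp add: sum_distrib_left sum_distrib_right)
  also have "\<dots> = 0"
  proof (intro sum.neutral ballI)
    fix W assume "W \<in> Pow P"
    hence "W \<subseteq> {..<n}" "card W \<le> q" using Output(1) cP card_mono[OF finP, of W] by auto
    thus "(\<Prod>v\<in>W. real_of_int (a v)) * (\<Sum>b\<in>B. \<xi> b * (\<Prod>v\<in>W. real_of_int (y b v))) * g c = 0"
      using unc by simp
  qed
  finally show ?case by simp
next
  case (Query v f)
  have finP: "finite P" using Query.prems(1) finite_subset by blast
  have "restrict a {..<n} \<in> sign_strings n" using Query.prems(2) by (auto simp: sign_strings_def)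
  moreover have "\<forall>v\<in>P. restrict a {..<n} v = a v" using Query.prems(1) by auto
  ultimately have vn: "v < n" using Query.prems(3) by fastforce
  show ?case
  proof (cases "v \<in> P")
    \<comment> \<open>A repeated query: where the answer differs from \<open>a v\<close>, the factor
      at \<open>v\<close> vanishes, so only the branch \<open>f (a v)\<close> survives and
      \<open>P\<close> stays the same.\<close>
    case True
    have "(\<Sum>b\<in>B. (\<Prod>v\<in>P. 1 + real_of_int (a v) * real_of_int (y b v)) * \<xi> b * g (run (Query v f) (y b))) =
       (\<Sum>b\<in>B. (\<Prod>v\<in>P. 1 + real_of_int (a v) * real_of_int (y b v)) * \<xi> b * g (run (f (a v)) (y b)))"
    proof (intro sum.cong refl)
      fix b assume b: "b \<in> B"
      show "(\<Prod>v\<in>P. 1 + real_of_int (a v) * real_of_int (y b v)) * \<xi> b * g (run (Query v f) (y b)) =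
          (\<Prod>v\<in>P. 1 + real_of_int (a v) * real_of_int (y b v)) * \<xi> b * g (run (f (a v)) (y b))"
      proof (cases "y b v = a v")
        case False
        hence "1 + real_of_int (a v) * real_of_int (y b v) = 0" using y[OF b vn] Query.prems(2)[OF vn] by auto
        hence "(\<Prod>v\<in>P. 1 + real_of_int (a v) * real_of_int (y b v)) = 0" using finP True by (meson prod_zero)
        thus ?thesis by simp
      qed simp
    qed
    also have "\<dots> = 0"
    proof (rule Query.IH)
      fix z assume "z \<in> sign_strings n" "\<forall>v\<in>P. z v = a v"
      thus "length (queries (f (a v)) z) + card P \<le> q \<and> set (queries (f (a v)) z) \<subseteq> {..<n}"
        using Query.prems(3)[of z] True by auto
    qed (use Query.prems in auto)
    finally show ?thesis .
  next
    case False
    \<comment> \<open>A fresh query: both branches are entered with \<open>v\<close> added to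
      \<open>P\<close>. The new factor is 2 on the branch of the actual answer and 0 on the other,
      so the mean of the two is the original term.\<close>
    define h where "h c b = (\<Prod>u\<in>insert v P. 1 + real_of_int ((a(v := c)) u) * real_of_int (y b u)) * \<xi> b * g (run (f c) (y b))" for c b
    have z: "(\<Sum>b\<in>B. h c b) = 0" if c: "c = -1 \<or> c = 1" for c
      unfolding h_def
    proof (rule Query.IH)
      fix z assume z: "z \<in> sign_strings n" "\<forall>u\<in>insert v P. z u = (a(v := c)) u"
      hence "\<forall>u\<in>P. z u = a u" using False by (metis fun_upd_other insertI2)
      thus "length (queries (f c) z) + card (insert v P) \<le> q \<and> set (queries (f c) z) \<subseteq> {..<n}"
        using Query.prems(3)[of z] z False finP by auto
    qed (use Query.prems c vn in auto)
    have "(\<Sum>b\<in>B. (\<Prod>v\<in>P. 1 + real_of_int (a v) * real_of_int (y b v)) * \<xi> b * g (run (Query v f) (y b))) =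
       (\<Sum>b\<in>B. (h 1 b + h (-1) b) / 2)"
    proof (intro sum.cong refl)
      fix b assume b: "b \<in> B"
      have "(\<Prod>u\<in>P. 1 + real_of_int ((a(v := c)) u) * real_of_int (y b u)) = (\<Prod>v\<in>P. 1 + real_of_int (a v) * real_of_int (y b v))" for c
        using False by (intro prod.cong) auto
      hence h: "h c b = (1 + real_of_int c * real_of_int (y b v)) * (\<Prod>v\<in>P. 1 + real_of_int (a v) * real_of_int (y b v)) * \<xi> b * g (run (f c) (y b))" for c
        using False finP unfolding h_def by (subst prod.insert) auto
      show "(\<Prod>v\<in>P. 1 + real_of_int (a v) * real_of_int (y b v)) * \<xi> b * g (run (Query v f) (y b)) = (h 1 b + h (-1) b) / 2"
        using y[OF b vn] unfolding h by auto
    qed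
    also have "\<dots> = ((\<Sum>b\<in>B. h 1 b) + (\<Sum>b\<in>B. h (-1) b)) / 2" by (simp only: sum.distrib sum_divide_distrib[symmetric])
    also have "\<dots> = 0" using z[of 1] z[of "-1"] by simp
    finally show ?thesis .
  qed
qed

text \<open>Erase the coordinates in \<open>T\<close> to 1. If no small set outside \<open>T\<close>
  recovers \<open>b i\<close>, then \<open>b i\<close> is orthogonal to every product of at most
  \<open>q\<close> received coordinates, so each deterministic decoder is right on at most half of
  all messages. Averaging over messages and over the randomness of the decoder contradicts a success
  probability of \<open>1/2 + \<epsilon>\<close>.\<close>

lemma ldc_recovery_set:
  assumes dec: "local_decoder q \<delta> \<epsilon> k n E Dec" and \<epsilon>: "\<epsilon> > 0"
    and S: "\<And>v. v < n \<Longrightarrow> S v \<subseteq> {..<k}"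
    and lin: "\<And>v b. v < n \<Longrightarrow> b \<in> sign_strings k \<Longrightarrow> E b v = (\<Prod>j\<in>S v. b j)"
    and E: "E \<in> sign_strings k \<rightarrow> sign_strings n"
    and i: "i < k" and T: "T \<subseteq> {..<n}" "real (card T) \<le> \<delta> * real n"
  shows "\<exists>Q \<subseteq> {..<n} - T. card Q \<le> q \<and> xor_sum S Q = {i}"
proof (rule ccontr)
  assume neg: "\<not> ?thesis"
  let ?B = "sign_strings k"
  define y where "y b v = (if v \<in> T then 1 else E b v)" for b v
  have y: "y b \<in> sign_strings n" if "b \<in> ?B" for b
    using E that T(1) by (force simp: y_def sign_strings_def PiE_iff Pi_iff extensional_def)
  have finT: "finite T" using T(1) finite_subset by blast
  \<comment> \<open>Factors in \<open>T\<close> equal 1, so the product over \<open>W\<close> is the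
    character of \<open>xor_sum S (W - T)\<close>. As this set is not \<open>{i}\<close>,
    multiplying by \<open>b i\<close> leaves a nontrivial character.\<close>
  have unc: "(\<Sum>b\<in>?B. real_of_int (b i) * (\<Prod>v\<in>W. real_of_int (y b v))) = 0"
    if W: "W \<subseteq> {..<n}" "card W \<le> q" for W
  proof -
    let ?J = "xor_sum S (W - T)"
    have finW: "finite W" using W(1) finite_subset by blast
    have J: "?J \<subseteq> {..<k}" using xor_sum_subset[of S "W - T"] S W(1) by fastforce
    have "card (W - T) \<le> card W" using finW by (intro card_mono) auto
    hence "card (W - T) \<le> q" using W(2) by simp
    hence "?J \<noteq> {i}" using neg W(1) by blast
    hence ne: "sym_diff {i} ?J \<noteq> {}" by auto
    have "(\<Sum>b\<in>?B. real_of_int (b i) * (\<Prod>v\<in>W. real_of_int (y b v))) = (\<Sum>b\<in>?B. \<Prod>j\<in>sym_diff {i} ?J. real_of_int (b j))"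
    proof (intro sum.cong refl)
      fix b assume b: "b \<in> ?B"
      have sq: "real_of_int (b j) * real_of_int (b j) = 1" if "j < k" for j
        using sign_stringsD[OF b that] by auto
      have "(\<Prod>v\<in>W. real_of_int (y b v)) = (\<Prod>v\<in>W - T. real_of_int (y b v))"
        using finW by (intro prod.mono_neutral_right) (auto simp: y_def)
      also have "\<dots> = (\<Prod>v\<in>W - T. \<Prod>j\<in>S v. real_of_int (b j))"
        using W(1) b by (intro prod.cong refl) (auto simp: y_def lin)
      also have "\<dots> = (\<Prod>j\<in>?J. real_of_int (b j))"
      proof (intro prod_prod_xor_sum)
        show "finite (S v)" if "v \<in> W - T" for v
          using S[of v] that W(1) finite_subset[OF _ finite_lessThan] by blast
        show "real_of_int (b j) * real_of_int (b j) = 1" if "v \<in> W - T" "j \<in> S v" for v j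
          using S[of v] that W(1) by (intro sq) auto
      qed (use finW in auto)
      finally have "real_of_int (b i) * (\<Prod>v\<in>W. real_of_int (y b v)) = (\<Prod>j\<in>{i}. real_of_int (b j)) * (\<Prod>j\<in>?J. real_of_int (b j))"
        by simp
      also have "\<dots> = (\<Prod>j\<in>sym_diff {i} ?J. real_of_int (b j))"
        using i J sq by (intro prod_sign_sym_diff[symmetric]) (auto intro: finite_subset)
      finally show "real_of_int (b i) * (\<Prod>v\<in>W. real_of_int (y b v)) = (\<Prod>j\<in>sym_diff {i} ?J. real_of_int (b j))" .
    qed
    also have "\<dots> = 0" using ne i J by (intro sum_character_eq_0) auto
    finally show ?thesis .
  qed
  have half: "(\<Sum>b\<in>?B. indicator {t. run t (y b) = b i} t) \<le> (2 ^ k / 2 :: real)" if t: "t \<in> set_pmf (Dec i)" for t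
  proof -
    \<comment> \<open>Outputs other than a sign are sent to 0. They are never correct, so
      \<open>(1 + b i * g) / 2\<close> still dominates the indicator of success.\<close>
    define g :: "int \<Rightarrow> real" where "g c = of_bool (c = 1) - of_bool (c = - 1)" for c
    have "(\<Sum>b\<in>?B. (\<Prod>v\<in>{}. 1 + real_of_int 1 * real_of_int (y b v)) * real_of_int (b i) * g (run t (y b))) = 0"
    proof (rule oracle_alg_uncorrelated)
      show "y b v = - 1 \<or> y b v = 1" if "b \<in> ?B" "v < n" for b v using sign_stringsD[OF y[OF that(1)] that(2)] .
      show "length (queries t z) + card {} \<le> q \<and> set (queries t z) \<subseteq> {..<n}" if "z \<in> sign_strings n" for z
        using dec i t that by (auto simp: local_decoder_def)
    qed (use unc in auto)
    hence z: "(\<Sum>b\<in>?B. real_of_int (b i) * g (run t (y b))) = 0" by simp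
    have "(\<Sum>b\<in>?B. indicator {t. run t (y b) = b i} t) \<le> (\<Sum>b\<in>?B. (1 + real_of_int (b i) * g (run t (y b))) / 2 :: real)"
    proof (intro sum_mono)
      fix b assume "b \<in> ?B"
      from sign_stringsD[OF this i] show "indicator {t. run t (y b) = b i} t \<le> ((1 + real_of_int (b i) * g (run t (y b))) / 2 :: real)"
        by (auto simp: g_def indicator_def)
    qed
    also have "\<dots> = (2 ^ k + (\<Sum>b\<in>?B. real_of_int (b i) * g (run t (y b)))) / 2"
      by (simp add: sum.distrib sum_divide_distrib[symmetric] card_sign_strings)
    finally show ?thesis using z by simp
  qed
  have int: "integrable (measure_pmf (Dec i)) (indicator A :: _ \<Rightarrow> real)" for A
    by (rule measure_pmf.integrable_const_bound[where B = 1]) auto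
  have "(1/2 + \<epsilon>) * 2 ^ k = (\<Sum>b\<in>?B. 1/2 + \<epsilon>)" by (simp add: card_sign_strings)
  also have "\<dots> \<le> (\<Sum>b\<in>?B. measure_pmf.prob (Dec i) {t. run t (y b) = b i})"
  proof (intro sum_mono)
    fix b assume b: "b \<in> ?B"
    have "{v \<in> {..<n}. y b v \<noteq> E b v} \<subseteq> T" by (auto simp: y_def)
    hence "hamming_dist n (y b) (E b) \<le> card T" unfolding hamming_dist_def using finT by (intro card_mono)
    hence "real (hamming_dist n (y b) (E b)) \<le> \<delta> * real n" using T(2) by linarith
    thus "1/2 + \<epsilon> \<le> measure_pmf.prob (Dec i) {t. run t (y b) = b i}"
      using dec i b y[OF b] by (auto simp: local_decoder_def)
  qed
  also have "\<dots> = measure_pmf.expectation (Dec i) (\<lambda>t. \<Sum>b\<in>?B. indicator {t. run t (y b) = b i} t)"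
    by (subst Bochner_Integration.integral_sum) (auto simp: int)
  also have "\<dots> \<le> 2 ^ k / 2"
    by (intro measure_pmf.integral_le_const Bochner_Integration.integrable_sum int) (use half in \<open>simp add: AE_measure_pmf_iff\<close>)
  finally have "\<epsilon> * 2 ^ k \<le> 0" by (simp add: algebra_simps)
  moreover have "\<epsilon> * 2 ^ k > 0" using \<epsilon> by simp
  ultimately show False by linarith
qed


text \<open>Two messages with one codeword would give, at an index where they differ, two disjoint
  events of probability above \<open>1/2\<close>; so \<open>E\<close> is injective.\<close>

lemma ldc_message_length_le:
  assumes dec: "local_decoder q \<delta> \<epsilon> k n E Dec" and \<epsilon>: "\<epsilon> > 0" and \<delta>: "\<delta> > 0"
    and E: "E \<in> sign_strings k \<rightarrow> sign_strings n"
  shows "k \<le> n"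
proof -
  have "inj_on E (sign_strings k)"
  proof (rule inj_onI, rule ccontr)
    fix b b' assume b: "b \<in> sign_strings k" "b' \<in> sign_strings k" and eq: "E b = E b'" and ne: "b \<noteq> b'"
    then obtain i where i: "i < k" "b i \<noteq> b' i"
      unfolding sign_strings_def by (metis PiE_ext lessThan_iff)
    have "hamming_dist n (E b) (E b) = 0" by (simp add: hamming_dist_def)
    hence h: "real (hamming_dist n (E b) (E b)) \<le> \<delta> * real n" using \<delta> by simp
    have Eb: "E b \<in> sign_strings n" using E b by auto
    have "1/2 + \<epsilon> \<le> measure_pmf.prob (Dec i) {t. run t (E b) = b i}"
      using dec i(1) b(1) Eb h unfolding local_decoder_def by blast
    moreover have "1/2 + \<epsilon> \<le> measure_pmf.prob (Dec i) {t. run t (E b) = b' i}"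
      using dec i(1) b(2) Eb h unfolding local_decoder_def eq by metis
    moreover have "measure_pmf.prob (Dec i) {t. run t (E b) = b i} + measure_pmf.prob (Dec i) {t. run t (E b) = b' i}
      = measure_pmf.prob (Dec i) ({t. run t (E b) = b i} \<union> {t. run t (E b) = b' i})"
      using i(2) by (intro measure_pmf.finite_measure_Union[symmetric]) auto
    moreover have "\<dots> \<le> 1" by simp
    ultimately show False using \<epsilon> by linarith
  qed
  hence "card (sign_strings k) \<le> card (sign_strings n)" using E by (intro card_inj_on_le) auto
  thus ?thesis by (simp add: card_sign_strings)
qed

text \<open>Take a matching of maximum size. If its union had at most \<open>\<delta> * n\<close>
  coordinates, these could be erased, and a recovery set avoiding them would enlarge the
  matching.\<close>

lemma ldc_matching:
  assumes dec: "local_decoder q \<delta> \<epsilon> k n E Dec" and \<epsilon>: "\<epsilon> > 0"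
    and S: "\<And>v. v < n \<Longrightarrow> S v \<subseteq> {..<k}"
    and lin: "\<And>v b. v < n \<Longrightarrow> b \<in> sign_strings k \<Longrightarrow> E b v = (\<Prod>j\<in>S v. b j)"
    and E: "E \<in> sign_strings k \<rightarrow> sign_strings n"
    and i: "i < k"
  shows "\<exists>H. pairwise disjnt H \<and> (\<forall>C\<in>H. C \<subseteq> {..<n} \<and> card C \<le> q \<and> xor_sum S C = {i}) \<and>
    \<delta> * real n < real (q * card H)"
proof -
  define good where "good H \<longleftrightarrow> pairwise disjnt H \<and> (\<forall>C\<in>H. C \<subseteq> {..<n} \<and> card C \<le> q \<and> xor_sum S C = {i})" for H
  have "{H. good H} \<subseteq> Pow (Pow {..<n})" by (auto simp: good_def)
  hence fin: "finite {H. good H}" by (rule finite_subset) simp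
  have "good {}" by (simp add: good_def)
  with fin obtain H where H: "good H" "\<And>H'. good H' \<Longrightarrow> card H' \<le> card H"
    using finite_has_maximal[of "card ` {H. good H}"] by (fastforce)
  have HP: "H \<subseteq> Pow {..<n}" using H(1) by (auto simp: good_def)
  hence finH: "finite H" by (rule finite_subset) simp
  have "\<delta> * real n < real (q * card H)"
  proof (rule ccontr)
    assume neg: "\<not> ?thesis"
    have "card (\<Union>H) \<le> (\<Sum>C\<in>H. card C)" by (rule card_Union_le_sum_card)
    also have "\<dots> \<le> (\<Sum>C\<in>H. q)" using H(1) by (intro sum_mono) (auto simp: good_def)
    finally have "card (\<Union>H) \<le> q * card H" by (simp add: mult.commute)
    hence "real (card (\<Union>H)) \<le> real (q * card H)" by (simp only: of_nat_le_iff)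
    hence "real (card (\<Union>H)) \<le> \<delta> * real n" using neg by linarith
    from ldc_recovery_set[OF dec \<epsilon> S lin E i _ this] HP
    obtain Q where Q: "Q \<subseteq> {..<n} - \<Union>H" "card Q \<le> q" "xor_sum S Q = {i}" by auto
    have "Q \<noteq> {}" using Q(3) by auto
    hence "Q \<notin> H" using Q(1) by blast
    moreover have "good (insert Q H)" using H(1) Q
      by (auto simp: good_def pairwise_insert disjnt_def)
    ultimately show False using H(2)[of "insert Q H"] finH by simp
  qed
  thus ?thesis using H(1) unfolding good_def by blast
qed

section \<open>Layers, cuts and groups\<close>

text \<open>Divided by \<open>\<nu> choose l\<close>, the left side is the chance that a random
  \<open>l\<close>-set contains \<open>w\<close> given points: a product of ratios
  \<open>(l - i) / (\<nu> - i)\<close>, each at most \<open>l / \<nu>\<close>.\<close>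

lemma binomial_shift_le:
  assumes "w \<le> l" "l \<le> \<nu>"
  shows "real ((\<nu> - w) choose (l - w)) \<le> (real l / real \<nu>) ^ w * real (\<nu> choose l)"
  using assms(1)
proof (induction w)
  case (Suc w)
  define a c where "a = \<nu> - Suc w" and "c = l - Suc w"
  have ac: "\<nu> - w = Suc a" "l - w = Suc c" using Suc.prems assms(2) by (auto simp: a_def c_def)
  have "Suc c * (Suc a choose Suc c) = Suc a * (a choose c)" by (rule Suc_times_binomial)
  hence "real (Suc a) * real (a choose c) = real (Suc c) * real (Suc a choose Suc c)"
    by (metis of_nat_mult)
  hence eq: "real (a choose c) = real (Suc c) / real (Suc a) * real (Suc a choose Suc c)"
    by (simp add: field_simps del: binomial_Suc_Suc)
  have \<nu>pos: "\<nu> > 0" using Suc.prems assms(2) by linarith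
  have "real (Suc c) = real l - real w" "real (Suc a) = real \<nu> - real w"
    using Suc.prems assms(2) by (auto simp: a_def c_def of_nat_diff)
  moreover have "(real l - real w) * real \<nu> \<le> real l * (real \<nu> - real w)"
    using assms(2) by (simp add: algebra_simps mult_right_mono)
  ultimately have "real (Suc c) / real (Suc a) \<le> real l / real \<nu>"
    using \<nu>pos by (simp add: divide_simps del: of_nat_Suc)
  hence "real (a choose c) \<le> real l / real \<nu> * real (Suc a choose Suc c)"
    unfolding eq by (intro mult_right_mono) auto
  also have "\<dots> \<le> real l / real \<nu> * ((real l / real \<nu>) ^ w * real (\<nu> choose l))"
    using Suc ac by (intro mult_left_mono) auto
  finally show ?case by (simp add: a_def c_def mult_ac)
qed simp

text \<open>Prescribe \<open>p\<close> points inside and \<open>p\<close> points outside a random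
  \<open>l\<close>-set: each excluded point costs a factor of at least \<open>1/2\<close>, each
  included one a factor of at least \<open>l / (2 * \<nu>)\<close>.\<close>

lemma binomial_shift_double_ge:
  assumes "2 * p \<le> l" "2 * l \<le> \<nu>"
  shows "(real l / (4 * real \<nu>)) ^ p * real (\<nu> choose l) \<le> real ((\<nu> - 2 * p) choose (l - p))"
  using assms(1)
proof (induction p)
  case (Suc p)
  define a c where "a = \<nu> - 2 * Suc p" and "c = l - Suc p"
  have ac: "\<nu> - 2 * p = Suc (Suc a)" "l - p = Suc c" using Suc.prems assms(2) by (auto simp: a_def c_def)
  have ca: "2 * c \<le> a" using Suc.prems assms(2) by (auto simp: a_def c_def)
  have "Suc c * (Suc (Suc a) choose Suc c) = Suc (Suc a) * (Suc a choose c)" by (rule Suc_times_binomial)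
  hence 1: "real (Suc (Suc a)) * real (Suc a choose c) = real (Suc c) * real (Suc (Suc a) choose Suc c)"
    by (metis of_nat_mult)
  have "(Suc a - c) * (Suc a choose c) = Suc a * (a choose c)" using binomial_absorb_comp[of "Suc a" c] by simp
  hence "real (Suc a) * real (a choose c) = real (Suc a - c) * real (Suc a choose c)"
    by (metis of_nat_mult)
  hence "real (a choose c) = real (Suc a - c) / real (Suc a) * real (Suc a choose c)"
    by (simp add: field_simps del: binomial_Suc_Suc)
  also have "real (Suc a choose c) = real (Suc c) / real (Suc (Suc a)) * real (Suc (Suc a) choose Suc c)"
    using 1 by (simp add: field_simps del: binomial_Suc_Suc of_nat_Suc)
  finally have eq: "real (a choose c) = real (Suc a - c) / real (Suc a) * (real (Suc c) / real (Suc (Suc a))) * real (Suc (Suc a) choose Suc c)"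
    by (simp only: mult.assoc)
  have \<nu>pos: "\<nu> > 0" using Suc.prems assms(2) by simp
  have r1: "1/2 \<le> real (Suc a - c) / real (Suc a)" using ca by (simp add: field_simps of_nat_diff)
  have "real l / 2 \<le> real (Suc c)" "real (Suc (Suc a)) \<le> real \<nu>"
    using Suc.prems assms(2) by (auto simp: a_def c_def)
  hence r2: "real l / 2 / real \<nu> \<le> real (Suc c) / real (Suc (Suc a))" by (intro frac_le) auto
  have "real l / (4 * real \<nu>) * real (Suc (Suc a) choose Suc c) = (1/2) * (real l / 2 / real \<nu>) * real (Suc (Suc a) choose Suc c)"
    by simp
  also have "\<dots> \<le> real (a choose c)" unfolding eq
    using r1 r2 by (intro mult_right_mono mult_mono) auto
  finally have step: "real l / (4 * real \<nu>) * real (Suc (Suc a) choose Suc c) \<le> real (a choose c)" .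
  have "(real l / (4 * real \<nu>)) ^ Suc p * real (\<nu> choose l) = real l / (4 * real \<nu>) * ((real l / (4 * real \<nu>)) ^ p * real (\<nu> choose l))"
    by simp
  also have "\<dots> \<le> real l / (4 * real \<nu>) * real (Suc (Suc a) choose Suc c)"
    using Suc ac by (intro mult_left_mono) auto
  also note step
  finally show ?case unfolding a_def c_def .
qed simp

section \<open>Counting in the layer of \<open>l\<close>-subsets\<close>

lemma card_layer_inter_eq:
  assumes "finite U" "D \<subseteq> U" "P \<subseteq> D" "card P \<le> l"
  shows "card {X. X \<subseteq> U \<and> card X = l \<and> X \<inter> D = P} = (card U - card D) choose (l - card P)"
proof -
  have finD: "finite D" using assms(1,2) by (rule rev_finite_subset)
  have finP: "finite P" using finD assms(3) by (rule rev_finite_subset)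
  have "bij_betw (\<lambda>Y. Y \<union> P) {Y. Y \<subseteq> U - D \<and> card Y = l - card P} {X. X \<subseteq> U \<and> card X = l \<and> X \<inter> D = P}"
  proof (rule bij_betw_byWitness[where f' = "\<lambda>X. X - P"], goal_cases)
    case 1 thus ?case using assms by auto
  next
    case 2 thus ?case by auto
  next
    case 3
    {
      fix Y assume Y: "Y \<subseteq> U - D" "card Y = l - card P"
      have "finite Y" using Y assms(1) finite_subset by blast
      hence "card (Y \<union> P) = l" using Y assms finP by (subst card_Un_disjoint) auto
      moreover have "(Y \<union> P) \<inter> D = P" "Y \<union> P \<subseteq> U" using Y assms by auto
      ultimately have "Y \<union> P \<in> {X. X \<subseteq> U \<and> card X = l \<and> X \<inter> D = P}" by simp
    }
    thus ?case by auto
  next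
    case 4
    {
      fix X assume X: "X \<subseteq> U" "card X = l" "X \<inter> D = P"
      have "finite X" using X assms(1) finite_subset by blast
      hence "card (X - P) = l - card P" using X finP by (subst card_Diff_subset) auto
      moreover have "X - P \<subseteq> U - D" using X by auto
      ultimately have "X - P \<in> {Y. Y \<subseteq> U - D \<and> card Y = l - card P}" by simp
    }
    thus ?case by auto
  qed
  hence "card {X. X \<subseteq> U \<and> card X = l \<and> X \<inter> D = P} = card {Y. Y \<subseteq> U - D \<and> card Y = l - card P}"
    using bij_betw_same_card by fastforce
  also have "\<dots> = card (U - D) choose (l - card P)" using assms(1) by (intro n_subsets) auto
  also have "card (U - D) = card U - card D" using assms finD by (intro card_Diff_subset)
  finally show ?thesis .
qed

lemma card_layer_superset_le:
  assumes "finite U" "W \<subseteq> U" "l \<le> card U"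
  shows "real (card {X. X \<subseteq> U \<and> card X = l \<and> W \<subseteq> X}) \<le>
    (real l / real (card U)) ^ card W * real (card U choose l)"
proof (cases "card W \<le> l")
  case True
  have "{X. X \<subseteq> U \<and> card X = l \<and> W \<subseteq> X} = {X. X \<subseteq> U \<and> card X = l \<and> X \<inter> W = W}" by auto
  thus ?thesis using card_layer_inter_eq[OF assms(1,2) subset_refl True] binomial_shift_le[OF True assms(3)] by simp
next
  case False
  have "{X. X \<subseteq> U \<and> card X = l \<and> W \<subseteq> X} = {}"
    using False assms(1) card_mono finite_subset by blast
  thus ?thesis by (simp only: card.empty) simp
qed

text \<open>A uniformly random set \<open>K\<close> of colours contains \<open>f e\<close> and
  misses \<open>g e\<close> with probability at least \<open>1/4\<close>; some \<open>K\<close>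
  attains the average.\<close>

lemma exists_cut:
  fixes f g :: "'e \<Rightarrow> 'c"
  assumes "finite P" and ne: "\<And>e. e \<in> P \<Longrightarrow> f e \<noteq> g e"
  shows "\<exists>K. finite K \<and> K \<subseteq> f ` P \<and> card P \<le> 4 * card {e \<in> P. f e \<in> K \<and> g e \<notin> K}"
proof -
  let ?I = "f ` P"
  have fin: "finite ?I" using assms(1) by simp
  have cnt: "2 ^ card ?I \<le> 4 * card {K \<in> Pow ?I. f e \<in> K \<and> g e \<notin> K}" if e: "e \<in> P" for e
  proof -
    have "insert (f e) ` Pow (?I - {f e, g e}) \<subseteq> {K \<in> Pow ?I. f e \<in> K \<and> g e \<notin> K}"
      using e ne[OF e] by auto
    hence "card (insert (f e) ` Pow (?I - {f e, g e})) \<le> card {K \<in> Pow ?I. f e \<in> K \<and> g e \<notin> K}"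
      using fin by (intro card_mono) auto
    moreover have "card (insert (f e) ` Pow (?I - {f e, g e})) = card (Pow (?I - {f e, g e}))"
      by (intro card_image) (auto simp: inj_on_def)
    moreover have "card (Pow (?I - {f e, g e})) = 2 ^ card (?I - {f e, g e})" using fin by (simp add: card_Pow)
    moreover have "card ?I \<le> card (?I - {f e, g e}) + 2"
    proof -
      have "card ?I \<le> card ((?I - {f e, g e}) \<union> {f e, g e})" using fin by (intro card_mono) auto
      also have "\<dots> \<le> card (?I - {f e, g e}) + card {f e, g e}" by (rule card_Un_le)
      also have "card {f e, g e} \<le> 2" by (simp add: card_insert_if)
      finally show ?thesis by simp
    qed
    hence "(2::nat) ^ card ?I \<le> 2 ^ (card (?I - {f e, g e}) + 2)" by (intro power_increasing) auto
    ultimately show ?thesis by simp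
  qed
  show ?thesis
  proof (rule ccontr)
    assume neg: "\<not> ?thesis"
    have "2 ^ card ?I * card P = (\<Sum>e\<in>P. 2 ^ card ?I)" by simp
    also have "\<dots> \<le> (\<Sum>e\<in>P. 4 * card {K \<in> Pow ?I. f e \<in> K \<and> g e \<notin> K})" by (intro sum_mono cnt)
    also have "\<dots> = 4 * (\<Sum>e\<in>P. \<Sum>K\<in>Pow ?I. if f e \<in> K \<and> g e \<notin> K then 1 else 0)"
      using fin by (simp add: sum_distrib_left[symmetric] sum.If_cases Int_def)
    also have "\<dots> = 4 * (\<Sum>K\<in>Pow ?I. \<Sum>e\<in>P. if f e \<in> K \<and> g e \<notin> K then 1 else 0)"
      by (subst sum.swap) simp
    also have "\<dots> = (\<Sum>K\<in>Pow ?I. 4 * card {e \<in> P. f e \<in> K \<and> g e \<notin> K})"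
      using assms(1) by (simp add: sum_distrib_left sum.If_cases Int_def)
    also have "\<dots> < (\<Sum>K\<in>Pow ?I. card P)"
    proof (rule sum_strict_mono)
      fix K assume "K \<in> Pow ?I"
      hence "finite K" "K \<subseteq> ?I" using fin finite_subset by auto
      thus "4 * card {e \<in> P. f e \<in> K \<and> g e \<notin> K} < card P" using neg by (meson not_le)
    qed (use fin in auto)
    also have "\<dots> = 2 ^ card ?I * card P" using fin by (simp add: card_Pow)
    finally show False by simp
  qed
qed

text \<open>Greedy extraction: while some nonempty \<open>Z\<close> lies in too many sets, all of
  these leave as one group with core \<open>Z\<close>. When this stops, no degree exceeds its
  threshold.\<close>

lemma extract_groups:
  fixes F :: "'a set set" and \<tau> :: "nat \<Rightarrow> real"
  assumes "finite F" and \<tau>: "\<And>z. \<tau> z \<ge> 0"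
  shows "\<exists>G \<kappa>. G \<subseteq> F \<and>
    (\<forall>C\<in>G. \<kappa> C \<subseteq> C \<and> \<kappa> C \<noteq> {} \<and> \<tau> (card (\<kappa> C)) < real (card {C'\<in>G. \<kappa> C' = \<kappa> C})) \<and>
    (\<forall>Z. Z \<noteq> {} \<longrightarrow> real (card {C \<in> F - G. Z \<subseteq> C}) \<le> \<tau> (card Z))"
  using assms(1)
proof (induction F rule: finite_psubset_induct)
  case (psubset F)
  show ?case
  proof (cases "\<exists>Z. Z \<noteq> {} \<and> \<tau> (card Z) < real (card {C \<in> F. Z \<subseteq> C})")
    case False
    thus ?thesis by (intro exI[of _ "{}"]) (auto simp: not_less)
  next
    case True
    then obtain Z where Z: "Z \<noteq> {}" "\<tau> (card Z) < real (card {C \<in> F. Z \<subseteq> C})" by blast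
    define G0 where "G0 = {C \<in> F. Z \<subseteq> C}"
    have "G0 \<noteq> {}"
    proof
      assume "G0 = {}"
      hence "real (card {C \<in> F. Z \<subseteq> C}) = 0" unfolding G0_def by (simp only: card.empty of_nat_0)
      thus False using Z(2) \<tau>[of "card Z"] by linarith
    qed
    hence "F - G0 \<subset> F" by (auto simp: G0_def)
    from psubset.IH[OF this] obtain G \<kappa> where G: "G \<subseteq> F - G0"
      "\<And>C. C \<in> G \<Longrightarrow> \<kappa> C \<subseteq> C \<and> \<kappa> C \<noteq> {} \<and> \<tau> (card (\<kappa> C)) < real (card {C'\<in>G. \<kappa> C' = \<kappa> C})"
      "\<And>Z. Z \<noteq> {} \<Longrightarrow> real (card {C \<in> F - G0 - G. Z \<subseteq> C}) \<le> \<tau> (card Z)" by (elim exE conjE) blast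
    define \<kappa>' where "\<kappa>' C = (if C \<in> G0 then Z else \<kappa> C)" for C
    \<comment> \<open>No later core equals \<open>Z\<close>, since every set containing
      \<open>Z\<close> has already left. So the group of \<open>Z\<close> is exactly
      \<open>G0\<close>.\<close>
    have nZ: "\<kappa> C \<noteq> Z" if "C \<in> G" for C using G(1,2) that by (auto simp: G0_def)
    have f1: "{C' \<in> G0 \<union> G. \<kappa>' C' = Z} = G0" using nZ G(1) by (auto simp: \<kappa>'_def)
    have f2: "{C' \<in> G0 \<union> G. \<kappa>' C' = \<kappa> C} = {C' \<in> G. \<kappa> C' = \<kappa> C}" if "C \<in> G" for C
      using nZ[OF that] G(1) by (auto simp: \<kappa>'_def)
    have "\<kappa>' C \<subseteq> C \<and> \<kappa>' C \<noteq> {} \<and> \<tau> (card (\<kappa>' C)) < real (card {C'\<in>G0 \<union> G. \<kappa>' C' = \<kappa>' C})"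
      if C: "C \<in> G0 \<union> G" for C
    proof (cases "C \<in> G0")
      case True
      hence "\<kappa>' C = Z" by (simp add: \<kappa>'_def)
      thus ?thesis using f1 Z True by (simp add: G0_def)
    next
      case False
      hence "\<kappa>' C = \<kappa> C" "C \<in> G" using C by (auto simp: \<kappa>'_def)
      thus ?thesis using f2[of C] G(2)[of C] by simp
    qed
    moreover have "F - (G0 \<union> G) = F - G0 - G" by auto
    ultimately show ?thesis using G(1,3) by (intro exI[of _ "G0 \<union> G"] exI[of _ \<kappa>']) (auto simp: G0_def)
  qed
qed

text \<open>One extraction per dyadic scale. If degrees are at most \<open>2 * 2 ^ s * d\<close>,
  extraction at threshold \<open>2 ^ s * d\<close> yields groups larger than the threshold while
  degrees stay within twice of it, which is the situation of \<open>bound\<close>; the remainder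
  continues at scale \<open>s\<close>.\<close>

lemma scale_decomposition:
  fixes F :: "'a set set" and d :: "nat \<Rightarrow> real"
  assumes fin: "finite F" and d: "\<And>z. d z \<ge> 0"
    and bound: "\<And>G \<kappa> a. G \<subseteq> F \<Longrightarrow> (\<And>Z. Z \<noteq> {} \<Longrightarrow> real (card {C \<in> G. Z \<subseteq> C}) \<le> 2 * 2 ^ a * d (card Z)) \<Longrightarrow>
      (\<And>C. C \<in> G \<Longrightarrow> \<kappa> C \<subseteq> C \<and> \<kappa> C \<noteq> {} \<and> 2 ^ a * d (card (\<kappa> C)) < real (card {C'\<in>G. \<kappa> C' = \<kappa> C})) \<Longrightarrow>
      real (card G) \<le> \<Lambda>"
    and deg: "\<And>Z. Z \<noteq> {} \<Longrightarrow> real (card {C \<in> F. Z \<subseteq> C}) \<le> 2 ^ s * d (card Z)"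
  shows "\<exists>R \<subseteq> F. (\<forall>Z. Z \<noteq> {} \<longrightarrow> real (card {C \<in> R. Z \<subseteq> C}) \<le> d (card Z)) \<and>
    real (card F) \<le> real s * \<Lambda> + real (card R)"
  using fin bound deg
proof (induction s arbitrary: F)
  case 0
  thus ?case by (intro exI[of _ F]) auto
next
  case (Suc s)
  have nn: "2 ^ s * d z \<ge> 0" for z using d[of z] by simp
  obtain G \<kappa> where G: "G \<subseteq> F"
    "\<And>C. C \<in> G \<Longrightarrow> \<kappa> C \<subseteq> C \<and> \<kappa> C \<noteq> {} \<and> 2 ^ s * d (card (\<kappa> C)) < real (card {C'\<in>G. \<kappa> C' = \<kappa> C})"
    "\<And>Z. Z \<noteq> {} \<Longrightarrow> real (card {C \<in> F - G. Z \<subseteq> C}) \<le> 2 ^ s * d (card Z)"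
    using extract_groups[OF Suc.prems(1), of "\<lambda>z. 2 ^ s * d z", OF nn] by (elim exE conjE) blast
  have "real (card {C \<in> G. Z \<subseteq> C}) \<le> 2 * 2 ^ s * d (card Z)" if "Z \<noteq> {}" for Z
  proof -
    have "card {C \<in> G. Z \<subseteq> C} \<le> card {C \<in> F. Z \<subseteq> C}" using G(1) Suc.prems(1) by (intro card_mono) auto
    thus ?thesis using Suc.prems(3)[OF that] by simp
  qed
  from Suc.prems(2)[OF G(1) this G(2)] have cG: "real (card G) \<le> \<Lambda>" by blast
  have "\<exists>R \<subseteq> F - G. (\<forall>Z. Z \<noteq> {} \<longrightarrow> real (card {C \<in> R. Z \<subseteq> C}) \<le> d (card Z)) \<and>
    real (card (F - G)) \<le> real s * \<Lambda> + real (card R)"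
  proof (rule Suc.IH)
    show "finite (F - G)" using Suc.prems(1) by simp
    show "real (card H) \<le> \<Lambda>" if "H \<subseteq> F - G" "\<And>Z. Z \<noteq> {} \<Longrightarrow> real (card {C \<in> H. Z \<subseteq> C}) \<le> 2 * 2 ^ a * d (card Z)"
      "\<And>C. C \<in> H \<Longrightarrow> \<eta> C \<subseteq> C \<and> \<eta> C \<noteq> {} \<and> 2 ^ a * d (card (\<eta> C)) < real (card {C'\<in>H. \<eta> C' = \<eta> C})" for H \<eta> a
      using that by (intro Suc.prems(2)[of H a \<eta>]) auto
  qed (rule G(3))
  then obtain R where R: "R \<subseteq> F - G" "\<forall>Z. Z \<noteq> {} \<longrightarrow> real (card {C \<in> R. Z \<subseteq> C}) \<le> d (card Z)"
    "real (card (F - G)) \<le> real s * \<Lambda> + real (card R)" by blast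
  have "card F = card G + card (F - G)"
    using G(1) Suc.prems(1) by (metis card_Diff_subset card_mono finite_subset le_add_diff_inverse)
  hence "real (card F) \<le> real (Suc s) * \<Lambda> + real (card R)" using R(3) cG by (simp add: algebra_simps)
  thus ?case using R(1,2) by blast
qed

section \<open>The Kikuchi graph\<close>

text \<open>By inclusion-exclusion \<open>X\<close> meets \<open>D \<union> D'\<close> in at least
  \<open>2 * p - y\<close> points. A union bound over the possible traces costs at most
  \<open>2 ^ r\<close>, and each trace lies in few \<open>X\<close> by
  \<open>card_layer_superset_le\<close>.\<close>

lemma card_layer_two_traces_le:
  assumes U: "finite U" "D \<subseteq> U" "D' \<subseteq> U" "l \<le> card U" and y: "card (D \<union> D') \<le> r"
  shows "real (card {X. X \<subseteq> U \<and> card X = l \<and> card (X \<inter> D) = p \<and> card (X \<inter> D') = p \<and> card (X \<inter> (D \<inter> D')) \<le> y}) \<le>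
    2 ^ r * (real l / real (card U)) ^ (2 * p - y) * real (card U choose l)"
proof -
  let ?b = "real l / real (card U)"
  let ?W = "{W \<in> Pow (D \<union> D'). 2 * p - y \<le> card W}"
  let ?V = "\<lambda>W. {X. X \<subseteq> U \<and> card X = l \<and> W \<subseteq> X}"
  have finDD: "finite (D \<union> D')" using U finite_subset by blast
  hence finW: "finite ?W" by simp
  have finV: "finite (?V W)" for W using U(1) by simp
  have b: "0 \<le> ?b" "?b \<le> 1" using U(4) by (auto simp: divide_le_eq_1)
  have "{X. X \<subseteq> U \<and> card X = l \<and> card (X \<inter> D) = p \<and> card (X \<inter> D') = p \<and> card (X \<inter> (D \<inter> D')) \<le> y} \<subseteq> (\<Union>W\<in>?W. ?V W)"
  proof
    fix X assume "X \<in> {X. X \<subseteq> U \<and> card X = l \<and> card (X \<inter> D) = p \<and> card (X \<inter> D') = p \<and> card (X \<inter> (D \<inter> D')) \<le> y}"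
    hence X: "X \<subseteq> U" "card X = l" "card (X \<inter> D) = p" "card (X \<inter> D') = p" "card (X \<inter> (D \<inter> D')) \<le> y" by auto
    have finX: "finite X" using X(1) U(1) finite_subset by blast
    have "card (X \<inter> D) + card (X \<inter> D') = card ((X \<inter> D) \<union> (X \<inter> D')) + card ((X \<inter> D) \<inter> (X \<inter> D'))"
      using finX by (intro card_Un_Int) auto
    moreover have "(X \<inter> D) \<union> (X \<inter> D') = X \<inter> (D \<union> D')" "(X \<inter> D) \<inter> (X \<inter> D') = X \<inter> (D \<inter> D')" by auto
    ultimately have "X \<inter> (D \<union> D') \<in> ?W" using X by auto
    moreover have "X \<in> ?V (X \<inter> (D \<union> D'))" using X by auto
    ultimately show "X \<in> (\<Union>W\<in>?W. ?V W)" by blast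
  qed
  hence "card {X. X \<subseteq> U \<and> card X = l \<and> card (X \<inter> D) = p \<and> card (X \<inter> D') = p \<and> card (X \<inter> (D \<inter> D')) \<le> y} \<le> card (\<Union>W\<in>?W. ?V W)"
    using finW finV by (intro card_mono) auto
  also have "\<dots> \<le> (\<Sum>W\<in>?W. card (?V W))" using finW by (rule card_UN_le)
  finally have "real (card {X. X \<subseteq> U \<and> card X = l \<and> card (X \<inter> D) = p \<and> card (X \<inter> D') = p \<and> card (X \<inter> (D \<inter> D')) \<le> y})
    \<le> (\<Sum>W\<in>?W. real (card (?V W)))" unfolding of_nat_sum[symmetric] by (simp only: of_nat_le_iff)
  also have "\<dots> \<le> (\<Sum>W\<in>?W. ?b ^ (2 * p - y) * real (card U choose l))"
  proof (intro sum_mono)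
    fix W assume W: "W \<in> ?W"
    hence "W \<subseteq> U" using U by auto
    hence "real (card (?V W)) \<le> ?b ^ card W * real (card U choose l)"
      using U by (intro card_layer_superset_le) auto
    also have "\<dots> \<le> ?b ^ (2 * p - y) * real (card U choose l)"
      using W b by (intro mult_right_mono power_decreasing) auto
    finally show "real (card (?V W)) \<le> ?b ^ (2 * p - y) * real (card U choose l)" .
  qed
  also have "\<dots> = real (card ?W) * (?b ^ (2 * p - y) * real (card U choose l))" by simp
  also have "\<dots> \<le> 2 ^ r * (?b ^ (2 * p - y) * real (card U choose l))"
  proof (rule mult_right_mono)
    have "card ?W \<le> card (Pow (D \<union> D'))" using finDD by (intro card_mono) auto
    also have "\<dots> = 2 ^ card (D \<union> D')" using finDD by (rule card_Pow)
    also have "\<dots> \<le> 2 ^ r" using y by (intro power_increasing) auto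
    finally show "real (card ?W) \<le> 2 ^ r" by (metis of_nat_le_iff of_nat_numeral of_nat_power)
  qed (use b in auto)
  finally show ?thesis by (simp only: mult.assoc)
qed

text \<open>Degree allowed to a set of \<open>z\<close> coordinates at scale 1: one factor
  \<open>\<beta>\<close> per coordinate. The floor 1 ensures that a group above the threshold has at
  least two members.\<close>

definition deg_bound :: "nat \<Rightarrow> real \<Rightarrow> nat \<Rightarrow> real" where
  "deg_bound m \<beta> z = max 1 (real m * \<beta> ^ z)"

lemma xor_sum_times_singleton: "xor_sum (S \<circ> fst) (A \<times> {b}) = xor_sum S A"
proof -
  have "card {v \<in> A \<times> {b}. j \<in> (S \<circ> fst) v} = card {v \<in> A. j \<in> S v}" for j
  proof -
    have "{v \<in> A \<times> {b}. j \<in> (S \<circ> fst) v} = (\<lambda>v. (v, b)) ` {v \<in> A. j \<in> S v}" by auto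
    thus ?thesis by (simp only:) (intro card_image, auto simp: inj_on_def)
  qed
  thus ?thesis by (simp add: xor_sum_def)
qed

lemma sym_diff_cancel:
  assumes "sym_diff A Q = I" "sym_diff B Q = J"
  shows "sym_diff A B = sym_diff I J"
  unfolding assms[symmetric] by (rule set_eqI) (simp only: Un_iff Diff_iff, argo)

text \<open>\<open>E\<close> consists of ordered pairs from one group whose first colour lies in the
  cut \<open>K\<close> and whose second does not. \<open>\<sigma>\<close> is the scale of the
  groups, \<open>t\<close> the core size, \<open>\<beta>\<close> the density of the layer. The last
  condition on \<open>c\<close> says that \<open>l\<close> is, up to constants, at least
  \<open>n * m powr (- 2 / q)\<close>.\<close>

locale kikuchi =
  fixes n l m q t :: nat and \<beta> \<sigma> c :: real and S :: "nat \<Rightarrow> nat set" and G :: "nat set set"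
    and \<kappa> :: "nat set \<Rightarrow> nat set" and col :: "nat set \<Rightarrow> nat"
    and E :: "(nat set \<times> nat set) set" and K :: "nat set"
  assumes finG: "finite G" and q_odd: "odd q" and t: "1 \<le> t" "t < q"
    and edge: "\<And>C. C \<in> G \<Longrightarrow> C \<subseteq> {..<n} \<and> card C = q \<and> xor_sum S C = {col C}"
    and matching: "\<And>C C'. C \<in> G \<Longrightarrow> C' \<in> G \<Longrightarrow> col C = col C' \<Longrightarrow> C \<noteq> C' \<Longrightarrow> C \<inter> C' = {}"
    and col_card: "\<And>i. card {C \<in> G. col C = i} \<le> m"
    and core: "\<And>C. C \<in> G \<Longrightarrow> \<kappa> C \<subseteq> C \<and> card (\<kappa> C) = t"
    and deg: "\<And>Z. Z \<noteq> {} \<Longrightarrow> real (card {C \<in> G. Z \<subseteq> C}) \<le> 2 * \<sigma> * deg_bound m \<beta> (card Z)"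
    and \<sigma>: "\<sigma> \<ge> 1"
    and l: "2 * q \<le> l" "l \<le> n" and \<beta>: "\<beta> = real l / real (2 * n)"
    and c: "0 < c" "c \<le> 1" "c\<^sup>2 \<le> (real m)\<^sup>2 * \<beta> ^ q"
    and E: "\<And>C C'. (C, C') \<in> E \<Longrightarrow> C \<in> G \<and> C' \<in> G \<and> \<kappa> C = \<kappa> C' \<and> col C \<in> K \<and> col C' \<notin> K"
    and finK: "finite K"
begin

definition p where "p = q - t"
text \<open>Upper bound for either half of a balanced trace, as \<open>p \<le> q - 1\<close> and
  \<open>q\<close> is odd.\<close>

definition h where "h = (q - 1) div 2"
text \<open>Two copies keep the halves of \<open>D e\<close> disjoint even when \<open>fst e\<close>
  and \<open>snd e\<close> meet outside the core.\<close>

definition U :: "(nat \<times> bool) set" where "U = {..<n} \<times> UNIV"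
definition V where "V = {X. X \<subseteq> U \<and> card X = l}"
definition D0 :: "nat set \<times> nat set \<Rightarrow> (nat \<times> bool) set" where "D0 e = (fst e - \<kappa> (fst e)) \<times> {False}"
definition D1 :: "nat set \<times> nat set \<Rightarrow> (nat \<times> bool) set" where "D1 e = (snd e - \<kappa> (snd e)) \<times> {True}"
definition D where "D e = D0 e \<union> D1 e"
definition valid where "valid e X \<longleftrightarrow>
  card (X \<inter> D0 e) + card (X \<inter> D1 e) = p \<and> 2 * card (X \<inter> D0 e) \<le> p + 1 \<and> p \<le> 2 * card (X \<inter> D0 e) + 1"
definition flip where "flip e X = sym_diff X (D e)"
definition \<Psi> where "\<Psi> X = xor_sum (S \<circ> fst) X \<inter> K"

lemma finU: "finite U" and cardU: "card U = 2 * n"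
  by (auto simp: U_def card_cartesian_product)

lemma finV: "finite V" using finU by (simp add: V_def)

lemma cardV: "card V = 2 * n choose l"
  unfolding V_def using n_subsets[OF finU] cardU by simp

lemma p_bounds: "1 \<le> p" "p < q" "p + t = q" using t by (auto simp: p_def)

lemma finE: "finite E"
proof (rule finite_subset)
  show "E \<subseteq> G \<times> G" using E by auto
qed (use finG in auto)

lemma \<beta>_bounds: "0 < \<beta>" "\<beta> \<le> 1" and n_pos: "0 < n"
  using l t unfolding \<beta> by (auto simp: divide_le_eq_1)

lemma m_pos: "0 < m" using c by (cases m) auto

lemma G_facts: assumes "C \<in> G"
  shows "finite C" "C \<subseteq> {..<n}" "card (C - \<kappa> C) = p" "\<kappa> C \<noteq> {}" "finite (\<kappa> C)" "\<kappa> C \<subseteq> C"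
proof -
  show C: "finite C" "C \<subseteq> {..<n}" using edge[OF assms] finite_subset by auto
  show k: "finite (\<kappa> C)" "\<kappa> C \<subseteq> C" using core[OF assms] C finite_subset by auto
  show "card (C - \<kappa> C) = p" using edge[OF assms] core[OF assms] k by (simp add: card_Diff_subset p_def)
  show "\<kappa> C \<noteq> {}" using core[OF assms] t by auto
qed

lemma core_col_unique:
  assumes "C \<in> G" "C' \<in> G" "\<kappa> C = \<kappa> C'" "col C = col C'" shows "C = C'"
proof (rule ccontr)
  assume "C \<noteq> C'"
  hence "C \<inter> C' = {}" using matching assms by blast
  thus False using G_facts(4,6)[OF assms(1)] G_facts(6)[OF assms(2)] assms(3) by blast
qed

lemma E_facts: assumes "e \<in> E"
  shows "fst e \<in> G" "snd e \<in> G" "\<kappa> (fst e) = \<kappa> (snd e)" "col (fst e) \<in> K" "col (snd e) \<notin> K"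
  using E[of "fst e" "snd e"] assms by auto

lemma D_facts: assumes "e \<in> E"
  shows "D0 e \<subseteq> U" "D1 e \<subseteq> U" "D e \<subseteq> U" "D0 e \<inter> D1 e = {}" "card (D0 e) = p" "card (D1 e) = p"
    "card (D e) = 2 * p" "finite (D0 e)" "finite (D1 e)" "finite (D e)"
proof -
  note f = G_facts[OF E_facts(1)[OF assms]] G_facts[OF E_facts(2)[OF assms]]
  show s: "D0 e \<subseteq> U" "D1 e \<subseteq> U" "D0 e \<inter> D1 e = {}" using f(2,8) by (auto simp: D0_def D1_def U_def)
  thus "D e \<subseteq> U" by (simp add: D_def)
  show c: "card (D0 e) = p" "card (D1 e) = p" using f(3,9) by (auto simp: D0_def D1_def card_cartesian_product)
  show fin: "finite (D0 e)" "finite (D1 e)" using f(1,7) by (auto simp: D0_def D1_def)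
  thus "finite (D e)" by (simp add: D_def)
  show "card (D e) = 2 * p" using s c fin by (simp add: D_def card_Un_disjoint)
qed

lemma V_fin: "X \<in> V \<Longrightarrow> finite X" using finU finite_subset by (auto simp: V_def)

lemma card_Int_D: assumes "e \<in> E" "finite X"
  shows "card (X \<inter> D e) = card (X \<inter> D0 e) + card (X \<inter> D1 e)"
  unfolding D_def Int_Un_distrib using D_facts[OF assms(1)] assms(2) by (intro card_Un_disjoint) auto

lemma flip_flip: "flip e (flip e X) = X" by (auto simp: flip_def)

text \<open>\<open>X\<close> contains exactly \<open>p\<close> of the \<open>2 * p\<close> points of
  \<open>D e\<close>, so exchanging them for the others keeps the size \<open>l\<close>; each of the
  two split numbers becomes \<open>p\<close> minus its old value.\<close>

lemma flip_valid:
  assumes e: "e \<in> E" and X: "X \<in> V" "valid e X"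
  shows "flip e X \<in> V" "valid e (flip e X)"
proof -
  have finX: "finite X" using V_fin X(1) .
  note Df = D_facts[OF e]
  have i0: "flip e X \<inter> D0 e = D0 e - X" and i1: "flip e X \<inter> D1 e = D1 e - X"
    using Df(4) by (auto simp: flip_def D_def)
  have c0: "card (X \<inter> D0 e) + card (flip e X \<inter> D0 e) = p"
    using card_Diff_subset_Int[of "D0 e" X] Df finX card_mono[OF Df(8), of "X \<inter> D0 e"] unfolding i0 by (auto simp: Int_commute)
  have c1: "card (X \<inter> D1 e) + card (flip e X \<inter> D1 e) = p"
    using card_Diff_subset_Int[of "D1 e" X] Df finX card_mono[OF Df(9), of "X \<inter> D1 e"] unfolding i1 by (auto simp: Int_commute)
  show v: "valid e (flip e X)" using c0 c1 X(2) unfolding valid_def by linarith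
  have XD: "card (X \<inter> D e) = p" using X(2) card_Int_D[OF e finX] by (simp add: valid_def)
  have "card (flip e X) = card (X - D e) + card (D e - X)"
    unfolding flip_def using finX Df by (intro card_Un_disjoint) auto
  also have "card (X - D e) = card X - card (X \<inter> D e)" using finX by (simp add: card_Diff_subset_Int)
  also have "card (D e - X) = card (D e) - card (X \<inter> D e)"
    using Df finX by (simp add: card_Diff_subset_Int Int_commute)
  also have "card X - card (X \<inter> D e) + (card (D e) - card (X \<inter> D e)) = card X"
    using XD Df(7) card_mono[OF finX, of "X \<inter> D e"] by auto
  finally have "card (flip e X) = l" using X(1) by (simp add: V_def)
  thus "flip e X \<in> V" using X(1) Df(3) by (auto simp: V_def flip_def)
qed

text \<open>The two sets share their core, so it cancels and \<open>D e\<close> sums to the two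
  colours; intersecting with \<open>K\<close> retains only the first.\<close>

lemma \<Psi>_flip:
  assumes e: "e \<in> E" and X: "X \<in> V"
  shows "sym_diff (\<Psi> X) (\<Psi> (flip e X)) = {col (fst e)}"
proof -
  note Ef = E_facts[OF e]
  let ?x = "xor_sum (S \<circ> fst)"
  have half: "sym_diff (xor_sum S (C - \<kappa> C)) (xor_sum S (\<kappa> C)) = {col C}" if "C \<in> G" for C
  proof -
    have "C = (C - \<kappa> C) \<union> \<kappa> C" using G_facts(6)[OF that] by auto
    hence "xor_sum S C = sym_diff (xor_sum S (C - \<kappa> C)) (xor_sum S (\<kappa> C))"
      using xor_sum_Un_disjoint[of "C - \<kappa> C" "\<kappa> C" S] G_facts(1,5)[OF that] by auto
    thus ?thesis using edge[OF that] by simp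
  qed
  have "?x (D e) = sym_diff (?x (D0 e)) (?x (D1 e))"
    unfolding D_def using D_facts[OF e] by (intro xor_sum_Un_disjoint) auto
  also have "\<dots> = sym_diff (xor_sum S (fst e - \<kappa> (fst e))) (xor_sum S (snd e - \<kappa> (snd e)))"
    unfolding D0_def D1_def xor_sum_times_singleton ..
  also have "\<dots> = sym_diff {col (fst e)} {col (snd e)}"
  proof (rule sym_diff_cancel[OF half[OF Ef(1)]])
    show "sym_diff (xor_sum S (snd e - \<kappa> (snd e))) (xor_sum S (\<kappa> (fst e))) = {col (snd e)}"
      using half[OF Ef(2)] unfolding Ef(3) .
  qed
  finally have "?x (D e) = sym_diff {col (fst e)} {col (snd e)}" .
  moreover have "?x (flip e X) = sym_diff (?x X) (?x (D e))"
    unfolding flip_def using V_fin[OF X] D_facts[OF e] by (intro xor_sum_sym_diff) auto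
  ultimately have "?x (flip e X) = sym_diff (?x X) (sym_diff {col (fst e)} {col (snd e)})" by (simp only:)
  hence mem: "v \<in> ?x (flip e X) \<longleftrightarrow> (v \<in> ?x X) \<noteq> ((v = col (fst e)) \<noteq> (v = col (snd e)))" for v
    by (simp only: Un_iff Diff_iff singleton_iff) argo
  have "v \<in> \<Psi> (flip e X) \<longleftrightarrow> (v \<in> \<Psi> X) \<noteq> (v = col (fst e))" for v
    using mem[of v] Ef(4,5) unfolding \<Psi>_def Int_iff by metis
  thus ?thesis by auto
qed

text \<open>A single prescribed balanced trace on \<open>D e\<close> already has this many
  extensions. Replacing \<open>p\<close> by \<open>q\<close> in the power of \<open>1/4\<close>
  makes the constant independent of the core size.\<close>

lemma card_valid_ge:
  assumes e: "e \<in> E"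
  shows "(1/4) ^ q * \<beta> ^ p * real (card V) \<le> real (card {X \<in> V. valid e X})"
proof -
  note Df = D_facts[OF e]
  have "p div 2 \<le> card (D0 e)" "p - p div 2 \<le> card (D1 e)" unfolding Df(5,6) by auto
  then obtain P0 P1 where P0: "P0 \<subseteq> D0 e" "card P0 = p div 2"
    and P1: "P1 \<subseteq> D1 e" "card P1 = p - p div 2"
    by (meson obtain_subset_with_card_n)
  have finP: "finite P0" "finite P1" using P0 P1 Df(8,9) finite_subset by auto
  have P01: "card (P0 \<union> P1) = p" using P0 P1 finP Df(4) by (subst card_Un_disjoint) auto
  have sub: "{X. X \<subseteq> U \<and> card X = l \<and> X \<inter> D e = P0 \<union> P1} \<subseteq> {X \<in> V. valid e X}"
  proof
    fix X assume "X \<in> {X. X \<subseteq> U \<and> card X = l \<and> X \<inter> D e = P0 \<union> P1}"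
    hence X: "X \<in> V" "X \<inter> D e = P0 \<union> P1" by (auto simp: V_def)
    have "X \<inter> D0 e = P0" "X \<inter> D1 e = P1" using X(2) P0(1) P1(1) Df(4) by (auto simp: D_def)
    thus "X \<in> {X \<in> V. valid e X}" using X(1) P0(2) P1(2) by (auto simp: valid_def)
  qed
  have "(1/4) ^ q * \<beta> ^ p \<le> (1/4) ^ p * \<beta> ^ p"
    using p_bounds \<beta>_bounds by (intro mult_right_mono power_decreasing) auto
  also have "\<dots> = (real l / (4 * real (2 * n))) ^ p" unfolding \<beta> power_mult_distrib[symmetric] by simp
  finally have "(1/4) ^ q * \<beta> ^ p * real (card V) \<le> (real l / (4 * real (2 * n))) ^ p * real (2 * n choose l)"
    unfolding cardV by (rule mult_right_mono) simp
  also have "\<dots> \<le> real ((2 * n - 2 * p) choose (l - p))"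
    using l p_bounds by (intro binomial_shift_double_ge) auto
  also have "\<dots> = real (card {X. X \<subseteq> U \<and> card X = l \<and> X \<inter> D e = P0 \<union> P1})"
  proof -
    have "card {X. X \<subseteq> U \<and> card X = l \<and> X \<inter> D e = P0 \<union> P1} = (card U - card (D e)) choose (l - card (P0 \<union> P1))"
      using finU Df(3) P0 P1 P01 l p_bounds by (intro card_layer_inter_eq) (auto simp: D_def)
    thus ?thesis using P01 Df(7) cardU by simp
  qed
  also have "\<dots> \<le> real (card {X \<in> V. valid e X})"
    using card_mono[OF _ sub] finV by simp
  finally show ?thesis .
qed

text \<open>\<open>y\<close> bounds the common part of the two traces: the smaller it is, the more
  points of \<open>X\<close> are prescribed. The constant comes from
  \<open>card (D e \<union> D e') \<le> 4 * q\<close>.\<close>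

lemma card_valid_valid_le:
  assumes e: "e \<in> E" "e' \<in> E" and y: "\<And>X. X \<in> V \<Longrightarrow> valid e X \<Longrightarrow> valid e' X \<Longrightarrow> card (X \<inter> (D e \<inter> D e')) \<le> y"
  shows "real (card {X \<in> V. valid e X \<and> valid e' X}) \<le> 2 ^ (4 * q) * \<beta> ^ (2 * p - y) * real (card V)"
proof -
  note Df = D_facts[OF e(1)] and Df' = D_facts[OF e(2)]
  have "card (D e \<union> D e') \<le> card (D e) + card (D e')" by (rule card_Un_le)
  hence r: "card (D e \<union> D e') \<le> 4 * q" using Df(7) Df'(7) p_bounds by simp
  have "{X \<in> V. valid e X \<and> valid e' X} \<subseteq>
      {X. X \<subseteq> U \<and> card X = l \<and> card (X \<inter> D e) = p \<and> card (X \<inter> D e') = p \<and> card (X \<inter> (D e \<inter> D e')) \<le> y}"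
  proof
    fix X assume "X \<in> {X \<in> V. valid e X \<and> valid e' X}"
    hence X: "X \<in> V" "valid e X" "valid e' X" by auto
    have "X \<subseteq> U" "card X = l" using X(1) by (auto simp: V_def)
    moreover have "card (X \<inter> D e) = p" using X(2) card_Int_D[OF e(1) V_fin[OF X(1)]] by (simp add: valid_def)
    moreover have "card (X \<inter> D e') = p" using X(3) card_Int_D[OF e(2) V_fin[OF X(1)]] by (simp add: valid_def)
    moreover have "card (X \<inter> (D e \<inter> D e')) \<le> y" using y X by blast
    ultimately show "X \<in> {X. X \<subseteq> U \<and> card X = l \<and> card (X \<inter> D e) = p \<and> card (X \<inter> D e') = p \<and> card (X \<inter> (D e \<inter> D e')) \<le> y}"
      by blast
  qed
  hence "card {X \<in> V. valid e X \<and> valid e' X} \<le>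
      card {X. X \<subseteq> U \<and> card X = l \<and> card (X \<inter> D e) = p \<and> card (X \<inter> D e') = p \<and> card (X \<inter> (D e \<inter> D e')) \<le> y}"
    using finU by (intro card_mono) auto
  thus ?thesis
    using card_layer_two_traces_le[OF finU Df(3) Df'(3) _ r, of l p y] l unfolding cardU cardV \<beta> by linarith
qed

lemma valid_halves_le:
  assumes "valid e X" shows "card (X \<inter> D0 e) \<le> h" "card (X \<inter> D1 e) \<le> h"
proof -
  obtain r where r: "q = 2 * r + 1" using q_odd by (elim oddE)
  have v: "card (X \<inter> D0 e) + card (X \<inter> D1 e) = p" "2 * card (X \<inter> D0 e) \<le> p + 1" "p \<le> 2 * card (X \<inter> D0 e) + 1"
    using assms by (auto simp: valid_def)
  have "(q - 1) div 2 = r" using r by simp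
  hence "h = r" by (simp only: h_def)
  thus "card (X \<inter> D0 e) \<le> h" "card (X \<inter> D1 e) \<le> h" using v p_bounds r by linarith+
qed

end

lemma sum_le_card_bound:
  fixes f :: "'a \<Rightarrow> real"
  assumes "\<And>a. a \<in> A \<Longrightarrow> f a \<le> M" "real (card A) \<le> L" "0 \<le> M"
  shows "sum f A \<le> L * M"
proof -
  have "sum f A \<le> real (card A) * M" using assms(1) by (rule sum_bounded_above)
  also have "\<dots> \<le> L * M" using assms(2,3) by (rule mult_right_mono)
  finally show ?thesis .
qed

section \<open>Second moment of the colour degrees\<close>

context kikuchi
begin

lemma c_le: "c \<le> real m * \<beta> ^ h"
proof -
  have "2 * h \<le> q" by (simp add: h_def)
  hence "(real m)\<^sup>2 * \<beta> ^ q \<le> (real m)\<^sup>2 * \<beta> ^ (2 * h)"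
    using \<beta>_bounds by (intro mult_left_mono power_decreasing) auto
  also have "\<dots> = (real m * \<beta> ^ h)\<^sup>2" by (simp add: power_mult_distrib power_even_eq)
  finally have "c\<^sup>2 \<le> (real m * \<beta> ^ h)\<^sup>2" using c(3) by linarith
  thus ?thesis using \<beta>_bounds by (intro power2_le_imp_le[of c "real m * \<beta> ^ h"]) auto
qed

lemma c2_le: "c\<^sup>2 \<le> real m * \<beta> ^ h" "c\<^sup>2 \<le> 1"
proof -
  have "c\<^sup>2 \<le> c" "c\<^sup>2 \<le> 1" using c by (auto simp: power2_eq_square mult_left_le mult_le_one)
  thus "c\<^sup>2 \<le> real m * \<beta> ^ h" "c\<^sup>2 \<le> 1" using c_le by auto
qed

lemma deg_bound_ge: "1 \<le> deg_bound m \<beta> z" "real m * \<beta> ^ z \<le> deg_bound m \<beta> z"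
  by (auto simp: deg_bound_def)

text \<open>Exponent count for pairs with the same first set: \<open>z\<close> is the size of the
  overlap of the second sets, \<open>y\<close> bounds the common trace. Where the maximum in
  \<open>deg_bound\<close> is 1, \<open>y \<le> p\<close> and the hypothesis on \<open>c\<close>
  suffice; otherwise \<open>y \<le> h + z\<close> and \<open>c\<^sup>2 \<le> m * \<beta> ^ h\<close>
  do.\<close>

lemma deg_bound_same_edge:
  assumes "y \<le> p" "y \<le> h + z"
  shows "deg_bound m \<beta> (t + z) * \<beta> ^ (2 * p - y) * c\<^sup>2 \<le> deg_bound m \<beta> t * real m * \<beta> ^ (2 * p)"
proof -
  have "1 * \<beta> ^ (2 * p - y) * c\<^sup>2 \<le> \<beta> ^ p * ((real m)\<^sup>2 * \<beta> ^ q)"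
    using assms(1) c \<beta>_bounds by (intro mult_mono) (auto intro: power_decreasing)
  also have "\<dots> = (real m * \<beta> ^ t) * real m * \<beta> ^ (2 * p)"
  proof -
    have "\<beta> ^ q = \<beta> ^ p * \<beta> ^ t" unfolding power_add[symmetric] p_bounds(3) ..
    thus ?thesis by (simp only: power2_eq_square mult_2 power_add mult_ac)
  qed
  finally have 1: "1 * \<beta> ^ (2 * p - y) * c\<^sup>2 \<le> (real m * \<beta> ^ t) * real m * \<beta> ^ (2 * p)" .
  have "(real m * \<beta> ^ (t + z)) * \<beta> ^ (2 * p - y) * c\<^sup>2 \<le> (real m * \<beta> ^ (t + z)) * \<beta> ^ (2 * p - y) * (real m * \<beta> ^ h)"
    using c2_le \<beta>_bounds by (intro mult_left_mono) auto
  also have "\<dots> = (real m)\<^sup>2 * \<beta> ^ (t + z + (2 * p - y) + h)"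
    by (simp add: power2_eq_square power_add mult_ac)
  also have "\<dots> \<le> (real m)\<^sup>2 * \<beta> ^ (t + 2 * p)"
    using assms \<beta>_bounds by (intro mult_left_mono power_decreasing) auto
  also have "\<dots> = (real m * \<beta> ^ t) * real m * \<beta> ^ (2 * p)" by (simp add: power2_eq_square power_add mult_ac)
  finally have 2: "(real m * \<beta> ^ (t + z)) * \<beta> ^ (2 * p - y) * c\<^sup>2 \<le> (real m * \<beta> ^ t) * real m * \<beta> ^ (2 * p)" .
  have "deg_bound m \<beta> (t + z) * \<beta> ^ (2 * p - y) * c\<^sup>2 \<le> (real m * \<beta> ^ t) * real m * \<beta> ^ (2 * p)"
    using 1 2 unfolding deg_bound_def max_def by (cases "1 \<le> real m * \<beta> ^ (t + z)") simp_all
  also have "\<dots> \<le> deg_bound m \<beta> t * real m * \<beta> ^ (2 * p)"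
    using deg_bound_ge \<beta>_bounds by (intro mult_right_mono) auto
  finally show ?thesis .
qed

text \<open>Exponent count for pairs with different first sets of one colour. The value 1 of
  \<open>deg_bound\<close> is handled by \<open>y \<le> h\<close>, the value
  \<open>m * \<beta> ^ z\<close> by \<open>y \<le> z\<close>.\<close>

lemma deg_bound_distinct_edge:
  assumes "y \<le> p" "y \<le> h" "y \<le> z"
  shows "deg_bound m \<beta> z * \<beta> ^ (2 * p - y) * c\<^sup>2 \<le> deg_bound m \<beta> t * real m * \<beta> ^ (2 * p)"
proof -
  have "1 * \<beta> ^ (2 * p - y) * c\<^sup>2 \<le> \<beta> ^ (2 * p - y) * (real m * \<beta> ^ h)"
    using c2_le \<beta>_bounds by simp
  also have "\<dots> = real m * \<beta> ^ (2 * p - y + h)" by (simp add: power_add mult_ac)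
  also have "\<dots> \<le> real m * \<beta> ^ (2 * p)"
    using assms \<beta>_bounds by (intro mult_left_mono power_decreasing) auto
  finally have 1: "1 * \<beta> ^ (2 * p - y) * c\<^sup>2 \<le> real m * \<beta> ^ (2 * p)" .
  have "(real m * \<beta> ^ z) * \<beta> ^ (2 * p - y) * c\<^sup>2 \<le> (real m * \<beta> ^ z) * \<beta> ^ (2 * p - y) * 1"
    using c2_le \<beta>_bounds by (intro mult_left_mono) auto
  also have "\<dots> = real m * \<beta> ^ (z + (2 * p - y))" by (simp add: power_add mult_ac)
  also have "\<dots> \<le> real m * \<beta> ^ (2 * p)"
    using assms \<beta>_bounds by (intro mult_left_mono power_decreasing) auto
  finally have 2: "(real m * \<beta> ^ z) * \<beta> ^ (2 * p - y) * c\<^sup>2 \<le> real m * \<beta> ^ (2 * p)" .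
  have "deg_bound m \<beta> z * \<beta> ^ (2 * p - y) * c\<^sup>2 \<le> real m * \<beta> ^ (2 * p)"
    using 1 2 unfolding deg_bound_def max_def by (cases "1 \<le> real m * \<beta> ^ z") simp_all
  also have "\<dots> \<le> deg_bound m \<beta> t * (real m * \<beta> ^ (2 * p))"
    using deg_bound_ge(1)[of t] \<beta>_bounds mult_right_mono[of 1 "deg_bound m \<beta> t" "real m * \<beta> ^ (2 * p)"] by simp
  finally show ?thesis by (simp only: mult.assoc)
qed

text \<open>The pairs of one colour are sorted by this set, since its size governs both their number
  and the common traces.\<close>

definition overlap where "overlap e e' = (snd e - \<kappa> (snd e)) \<inter> (snd e' - \<kappa> (snd e'))"

lemma overlap_facts: assumes "e \<in> E"
  shows "finite (overlap e e')" "card (overlap e e') \<le> p" "overlap e e' \<in> Pow (snd e - \<kappa> (snd e))"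
proof -
  note f = G_facts[OF E_facts(2)[OF assms]]
  show "finite (overlap e e')" using f(1) by (simp add: overlap_def)
  show "overlap e e' \<in> Pow (snd e - \<kappa> (snd e))" by (auto simp: overlap_def)
  hence "card (overlap e e') \<le> card (snd e - \<kappa> (snd e))" using f(1) by (intro card_mono) auto
  thus "card (overlap e e') \<le> p" using f(3) by simp
qed

text \<open>In the first copy balance allows at most \<open>h\<close> points; in the second only the
  overlap contributes. The bound \<open>p\<close> is the size of the whole trace.\<close>

lemma card_trace_same_edge:
  assumes e: "e \<in> E" and X: "X \<in> V" "valid e X"
  shows "card (X \<inter> (D e \<inter> D e')) \<le> min p (h + card (overlap e e'))"
proof -
  have finX: "finite X" using V_fin X(1) .
  have "card (X \<inter> (D e \<inter> D e')) \<le> card (X \<inter> D e)" using finX by (intro card_mono) auto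
  also have "\<dots> = p" using card_Int_D[OF e finX] X(2) by (simp add: valid_def)
  finally have 1: "card (X \<inter> (D e \<inter> D e')) \<le> p" .
  have "X \<inter> (D e \<inter> D e') \<subseteq> (X \<inter> D0 e) \<union> (overlap e e' \<times> {True})"
    by (auto simp: D_def D0_def D1_def overlap_def)
  hence "card (X \<inter> (D e \<inter> D e')) \<le> card ((X \<inter> D0 e) \<union> (overlap e e' \<times> {True}))"
    using finX overlap_facts(1)[OF e, of e'] by (intro card_mono) auto
  also have "\<dots> \<le> card (X \<inter> D0 e) + card (overlap e e' \<times> {True})" by (rule card_Un_le)
  also have "\<dots> \<le> h + card (overlap e e')"
    using valid_halves_le(1)[OF X(2)] by (simp add: card_cartesian_product)
  finally show ?thesis using 1 by simp
qed

text \<open>Distinct sets of one colour are disjoint, so common points lie in the second copy alone,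
  where balance again gives \<open>h\<close>.\<close>

lemma card_trace_distinct_edge:
  assumes e: "e \<in> E" "e' \<in> E" and X: "X \<in> V" "valid e X"
    and ne: "fst e' \<noteq> fst e" "col (fst e') = col (fst e)"
  shows "card (X \<inter> (D e \<inter> D e')) \<le> min (card (overlap e e')) h"
proof -
  have finX: "finite X" using V_fin X(1) .
  have dis: "fst e \<inter> fst e' = {}" using matching[OF E_facts(1)[OF e(1)] E_facts(1)[OF e(2)]] ne by metis
  have "X \<inter> (D e \<inter> D e') \<subseteq> overlap e e' \<times> {True}"
    using dis by (auto simp: D_def D0_def D1_def overlap_def)
  hence "card (X \<inter> (D e \<inter> D e')) \<le> card (overlap e e' \<times> {True})"
    using overlap_facts(1)[OF e(1), of e'] by (intro card_mono) auto
  hence 1: "card (X \<inter> (D e \<inter> D e')) \<le> card (overlap e e')" by (simp add: card_cartesian_product)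
  have "X \<inter> (D e \<inter> D e') \<subseteq> X \<inter> D1 e"
    using dis by (auto simp: D_def D0_def D1_def)
  hence "card (X \<inter> (D e \<inter> D e')) \<le> card (X \<inter> D1 e)" using finX by (intro card_mono) auto
  thus ?thesis using 1 valid_halves_le(2)[OF X(2)] by simp
qed

definition J where "J e e' = real (card {X \<in> V. valid e X \<and> valid e' X})"

text \<open>Up to constants, the value expected if validity of different pairs were independent:
  about \<open>m * \<sigma> * deg_bound m \<beta> t\<close> pairs of one colour, each valid together
  with \<open>e\<close> at density \<open>\<beta> ^ (2 * p)\<close>.\<close>

definition Tb where "Tb = 2 * (\<sigma> * deg_bound m \<beta> t) * 2 ^ (4 * q) * real m * \<beta> ^ (2 * p) * real (card V) / c\<^sup>2"

text \<open>The first set is determined by its colour and its core, and the core can be read off the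
  second set. Counting pairs of one colour thus reduces to degrees in \<open>G\<close>.\<close>

lemma snd_inj: "inj_on snd {e' \<in> E. col (fst e') = i}"
proof (rule inj_onI)
  fix e1 e2 assume a: "e1 \<in> {e' \<in> E. col (fst e') = i}" "e2 \<in> {e' \<in> E. col (fst e') = i}" "snd e1 = snd e2"
  hence e: "e1 \<in> E" "e2 \<in> E" and ci: "col (fst e1) = col (fst e2)" by auto
  have "\<kappa> (fst e1) = \<kappa> (fst e2)" using E_facts(3)[OF e(1)] E_facts(3)[OF e(2)] a(3) by simp
  hence "fst e1 = fst e2" by (rule core_col_unique[OF E_facts(1)[OF e(1)] E_facts(1)[OF e(2)] _ ci])
  thus "e1 = e2" using a(3) by (simp add: prod_eq_iff)
qed

lemma card_by_snd:
  assumes "A \<subseteq> {e' \<in> E. col (fst e') = i}" "Z \<noteq> {}" "\<And>e'. e' \<in> A \<Longrightarrow> Z \<subseteq> snd e'"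
  shows "real (card A) \<le> 2 * \<sigma> * deg_bound m \<beta> (card Z)"
proof -
  have "card A = card (snd ` A)" using inj_on_subset[OF snd_inj assms(1)] by (simp add: card_image)
  also have "\<dots> \<le> card {C \<in> G. Z \<subseteq> C}"
    using assms E_facts finG by (intro card_mono) auto
  finally show ?thesis using deg[OF assms(2)] by linarith
qed

lemma Tb_ge:
  assumes L: "real (card A) \<le> 2 * \<sigma> * dz" and J: "\<And>e'. e' \<in> A \<Longrightarrow> J e e' \<le> 2 ^ (4 * q) * \<beta> ^ (2 * p - y) * real (card V)"
    and d: "dz * \<beta> ^ (2 * p - y) * c\<^sup>2 \<le> deg_bound m \<beta> t * real m * \<beta> ^ (2 * p)"
  shows "(\<Sum>e'\<in>A. J e e') \<le> Tb"
proof -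
  have "(\<Sum>e'\<in>A. J e e') \<le> (2 * \<sigma> * dz) * (2 ^ (4 * q) * \<beta> ^ (2 * p - y) * real (card V))"
    using J L \<beta>_bounds by (intro sum_le_card_bound) auto
  also have "\<dots> = 2 * \<sigma> * 2 ^ (4 * q) * real (card V) * (dz * \<beta> ^ (2 * p - y) * c\<^sup>2) / c\<^sup>2"
    using c by (simp add: mult_ac)
  also have "\<dots> \<le> 2 * \<sigma> * 2 ^ (4 * q) * real (card V) * (deg_bound m \<beta> t * real m * \<beta> ^ (2 * p)) / c\<^sup>2"
    using d \<sigma> by (intro divide_right_mono mult_left_mono) auto
  also have "\<dots> = Tb" by (simp add: Tb_def mult_ac)
  finally show ?thesis .
qed

text \<open>Here \<open>snd e'\<close> contains the core together with \<open>Z\<close>, that is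
  \<open>t + card Z\<close> points, and the degree condition counts the choices.\<close>

lemma sum_same_edge_le:
  assumes e: "e \<in> E"
  shows "(\<Sum>e' | e' \<in> E \<and> fst e' = fst e \<and> overlap e e' = Z. J e e') \<le> Tb"
proof (cases "{e' \<in> E. fst e' = fst e \<and> overlap e e' = Z} = {}")
  case True
  thus ?thesis unfolding True using \<beta>_bounds \<sigma> deg_bound_ge(1)[of t] by (simp add: Tb_def)
next
  case False
  let ?A = "{e' \<in> E. fst e' = fst e \<and> overlap e e' = Z}"
  let ?Q = "\<kappa> (snd e)"
  note f = G_facts[OF E_facts(2)[OF e]]
  obtain e1 where "e1 \<in> ?A" using False by (meson ex_in_conv)
  hence "overlap e e1 = Z" by simp
  hence Z: "Z \<subseteq> snd e - ?Q" using overlap_facts(3)[OF e, of e1] by simp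
  have finZ: "finite Z" using Z f(1) finite_subset by blast
  have "card (Z \<union> ?Q) = card Z + card ?Q" using Z finZ f(5) by (intro card_Un_disjoint) auto
  hence cZ: "card (Z \<union> ?Q) = t + card Z" using core[OF E_facts(2)[OF e]] by simp
  show ?thesis
  proof (rule Tb_ge)
    show "real (card ?A) \<le> 2 * \<sigma> * deg_bound m \<beta> (t + card Z)"
      unfolding cZ[symmetric]
    proof (rule card_by_snd)
      show "?A \<subseteq> {e' \<in> E. col (fst e') = col (fst e)}" by auto
      show "Z \<union> ?Q \<noteq> {}" using f(4) by auto
      show "Z \<union> ?Q \<subseteq> snd e'" if "e' \<in> ?A" for e'
      proof -
        have e': "e' \<in> E" "fst e' = fst e" "overlap e e' = Z" using that by auto
        have "\<kappa> (snd e') = ?Q" using E_facts(3)[OF e] E_facts(3)[OF e'(1)] e'(2) by simp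
        moreover have "\<kappa> (snd e') \<subseteq> snd e'" using G_facts(6)[OF E_facts(2)[OF e'(1)]] .
        ultimately show ?thesis using e'(3) by (auto simp: overlap_def)
      qed
    qed
    show "J e e' \<le> 2 ^ (4 * q) * \<beta> ^ (2 * p - min p (h + card Z)) * real (card V)" if "e' \<in> ?A" for e'
      unfolding J_def using that card_trace_same_edge[OF e, of _ e'] by (intro card_valid_valid_le e) auto
  qed (rule deg_bound_same_edge, auto)
qed

text \<open>For nonempty \<open>Z\<close> the degree of \<open>Z\<close> counts the second sets. For
  empty \<open>Z\<close> there are at most \<open>m\<close> first sets, the degree of the core
  counts the partners of each, and the traces share nothing.\<close>

lemma sum_distinct_edge_le:
  assumes e: "e \<in> E"
  shows "(\<Sum>e' | e' \<in> E \<and> col (fst e') = col (fst e) \<and> fst e' \<noteq> fst e \<and> overlap e e' = Z. J e e') \<le> Tb"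
proof -
  let ?A = "{e' \<in> E. col (fst e') = col (fst e) \<and> fst e' \<noteq> fst e \<and> overlap e e' = Z}"
  have Jle: "J e e' \<le> 2 ^ (4 * q) * \<beta> ^ (2 * p - min (card Z) h) * real (card V)" if "e' \<in> ?A" for e'
    unfolding J_def using that card_trace_distinct_edge[OF e, of e'] by (intro card_valid_valid_le e) auto
  consider "?A = {}" | "Z = {}" | "?A \<noteq> {}" "Z \<noteq> {}" by blast
  thus ?thesis
  proof cases
    case 1
    thus ?thesis unfolding 1 using \<beta>_bounds \<sigma> deg_bound_ge(1)[of t] by (simp add: Tb_def)
  next
    case 2
    let ?B = "{C \<in> G. col C = col (fst e)}"
    have "?A \<subseteq> Sigma ?B (\<lambda>C. {C' \<in> G. \<kappa> C \<subseteq> C'})"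
    proof
      fix e' assume e': "e' \<in> ?A"
      obtain C C' where CC: "e' = (C, C')" by (cases e')
      have "(C, C') \<in> E" "col C = col (fst e)" using e' CC by auto
      thus "e' \<in> Sigma ?B (\<lambda>C. {C' \<in> G. \<kappa> C \<subseteq> C'})"
        unfolding CC using E[of C C'] G_facts(6)[of C'] by auto
    qed
    hence "card ?A \<le> card (Sigma ?B (\<lambda>C. {C' \<in> G. \<kappa> C \<subseteq> C'}))" using finG by (intro card_mono) auto
    also have "\<dots> = (\<Sum>C\<in>?B. card {C' \<in> G. \<kappa> C \<subseteq> C'})" using finG by simp
    finally have "real (card ?A) \<le> (\<Sum>C\<in>?B. real (card {C' \<in> G. \<kappa> C \<subseteq> C'}))"
      unfolding of_nat_sum[symmetric] by (simp only: of_nat_le_iff)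
    also have "\<dots> \<le> real m * (2 * \<sigma> * deg_bound m \<beta> t)"
    proof (rule sum_le_card_bound)
      show "real (card {C' \<in> G. \<kappa> C \<subseteq> C'}) \<le> 2 * \<sigma> * deg_bound m \<beta> t" if "C \<in> ?B" for C
        using deg[of "\<kappa> C"] G_facts(4)[of C] core[of C] that by auto
      show "real (card ?B) \<le> real m" using col_card by simp
    qed (use \<sigma> deg_bound_ge(1)[of t] in auto)
    also have "\<dots> = 2 * \<sigma> * (real m * deg_bound m \<beta> t)" by simp
    finally have L: "real (card ?A) \<le> 2 * \<sigma> * (real m * deg_bound m \<beta> t)" .
    show ?thesis
    proof (rule Tb_ge[OF L])
      show "J e e' \<le> 2 ^ (4 * q) * \<beta> ^ (2 * p - 0) * real (card V)" if "e' \<in> ?A" for e'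
        using Jle[OF that] 2 by simp
      have "real m * deg_bound m \<beta> t * \<beta> ^ (2 * p - 0) * c\<^sup>2 \<le> real m * deg_bound m \<beta> t * \<beta> ^ (2 * p - 0) * 1"
        using c2_le \<beta>_bounds deg_bound_ge(1)[of t] by (intro mult_left_mono) auto
      thus "real m * deg_bound m \<beta> t * \<beta> ^ (2 * p - 0) * c\<^sup>2 \<le> deg_bound m \<beta> t * real m * \<beta> ^ (2 * p)"
        by (simp add: mult_ac)
    qed
  next
    case 3
    then obtain e1 where "e1 \<in> ?A" by blast
    hence cz: "card Z \<le> p" using overlap_facts(2)[OF e, of e1] by auto
    show ?thesis
    proof (rule Tb_ge[OF _ Jle])
      show "real (card ?A) \<le> 2 * \<sigma> * deg_bound m \<beta> (card Z)"
        by (rule card_by_snd[of _ "col (fst e)"]) (use 3 in \<open>auto simp: overlap_def\<close>)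
      show "deg_bound m \<beta> (card Z) * \<beta> ^ (2 * p - min (card Z) h) * c\<^sup>2 \<le> deg_bound m \<beta> t * real m * \<beta> ^ (2 * p)"
        using cz by (intro deg_bound_distinct_edge) auto
    qed
  qed
qed

text \<open>Sum over the at most \<open>2 ^ q\<close> overlaps, each split into the cases of equal
  and of distinct first sets.\<close>

lemma second_moment:
  assumes e: "e \<in> E"
  shows "(\<Sum>e' | e' \<in> E \<and> col (fst e') = col (fst e). J e e') \<le> 2 ^ q * (2 * Tb)"
proof -
  let ?A = "{e' \<in> E. col (fst e') = col (fst e)}"
  let ?Z = "Pow (snd e - \<kappa> (snd e))"
  note f = G_facts[OF E_facts(2)[OF e]]
  have finA: "finite ?A" using finE by simp
  have finZ: "finite ?Z" using f(1) by simp
  have T0: "0 \<le> Tb" using \<beta>_bounds \<sigma> deg_bound_ge(1)[of t] by (simp add: Tb_def)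
  have "(\<Sum>e'\<in>?A. J e e') = (\<Sum>Z\<in>?Z. \<Sum>e' | e' \<in> ?A \<and> overlap e e' = Z. J e e')"
    by (intro sum.group[symmetric] finA finZ) (auto simp: overlap_def)
  also have "\<dots> \<le> 2 ^ q * (2 * Tb)"
  proof (rule sum_le_card_bound)
    fix Z
    have "{e' \<in> ?A. overlap e e' = Z} = {e' \<in> E. fst e' = fst e \<and> overlap e e' = Z} \<union>
        {e' \<in> E. col (fst e') = col (fst e) \<and> fst e' \<noteq> fst e \<and> overlap e e' = Z}" by auto
    hence "(\<Sum>e' | e' \<in> ?A \<and> overlap e e' = Z. J e e') =
        (\<Sum>e' | e' \<in> E \<and> fst e' = fst e \<and> overlap e e' = Z. J e e') +
        (\<Sum>e' | e' \<in> E \<and> col (fst e') = col (fst e) \<and> fst e' \<noteq> fst e \<and> overlap e e' = Z. J e e')"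
      using finE by (simp only:) (intro sum.union_disjoint, auto)
    thus "(\<Sum>e' | e' \<in> ?A \<and> overlap e e' = Z. J e e') \<le> 2 * Tb"
      using sum_same_edge_le[OF e, of Z] sum_distinct_edge_le[OF e, of Z] by linarith
  next
    have "card ?Z = 2 ^ p" using f(1,3) by (simp add: card_Pow)
    also have "\<dots> \<le> 2 ^ q" using p_bounds by (intro power_increasing) auto
    finally show "real (card ?Z) \<le> 2 ^ q" by (metis of_nat_le_iff of_nat_numeral of_nat_power)
  qed (use T0 in simp)
  finally show ?thesis .
qed

end

section \<open>Truncating the colour degrees and counting pairs\<close>

context kikuchi
begin

text \<open>
  By \<open>second_moment\<close>, \<open>M w m \<beta>\<^bsup>2p\<^esup> |V|\<close> bounds the number of coincidences at one edge; the cap \<open>B\<close> is chosen so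
  that discarding both endpoints with colour degree above \<open>B\<close> loses at most half of the edges.
\<close>

definition M where "M = 4 * 2 ^ (5 * q) / c\<^sup>2"
definition w where "w = \<sigma> * deg_bound m \<beta> t"
definition B where "B = 4 * M * w * real m * \<beta> ^ p * 4 ^ q"
definition \<Delta> where "\<Delta> i X = real (card {e \<in> E. col (fst e) = i \<and> valid e X})"
definition bad where "bad e = {X \<in> V. valid e X \<and> B < \<Delta> (col (fst e)) X}"
definition good where "good e = {X \<in> V. valid e X \<and> \<Delta> (col (fst e)) X \<le> B \<and> \<Delta> (col (fst e)) (flip e X) \<le> B}"

lemma w_pos: "0 < w" using \<sigma> deg_bound_ge(1)[of t] by (simp add: w_def)

lemma M_pos: "0 < M" using c by (simp add: M_def)

lemma B_pos: "0 < B" using w_pos M_pos m_pos \<beta>_bounds by (simp add: B_def)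

lemma V_pos: "0 < card V" using l by (simp add: cardV)

text \<open>Markov's inequality: \<open>\<Delta>\<close> summed over the vertices valid for
  \<open>e\<close> is the second moment. By the choice of \<open>B\<close> the result is a quarter
  of the lower bound in \<open>card_valid_ge\<close>.\<close>

lemma card_bad_le:
  assumes e: "e \<in> E"
  shows "real (card (bad e)) \<le> (1/4) ^ q * \<beta> ^ p * real (card V) / 4"
proof -
  let ?A = "{e' \<in> E. col (fst e') = col (fst e)}"
  have finA: "finite ?A" using finE by simp
  have "B * real (card (bad e)) = (\<Sum>X\<in>bad e. B)" by simp
  also have "\<dots> \<le> (\<Sum>X\<in>bad e. \<Delta> (col (fst e)) X)" by (intro sum_mono) (simp add: bad_def)
  also have "\<dots> \<le> (\<Sum>X | X \<in> V \<and> valid e X. \<Delta> (col (fst e)) X)"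
    using finV by (intro sum_mono2) (auto simp: bad_def \<Delta>_def)
  also have "\<dots> = (\<Sum>X | X \<in> V \<and> valid e X. \<Sum>e'\<in>?A. of_bool (valid e' X))"
  proof (intro sum.cong refl)
    fix X
    have "{e' \<in> E. col (fst e') = col (fst e) \<and> valid e' X} = ?A \<inter> {e'. valid e' X}" by auto
    thus "\<Delta> (col (fst e)) X = (\<Sum>e'\<in>?A. of_bool (valid e' X))"
      using finA by (simp add: \<Delta>_def sum_of_bool_eq)
  qed
  also have "\<dots> = (\<Sum>e'\<in>?A. \<Sum>X | X \<in> V \<and> valid e X. of_bool (valid e' X))" by (rule sum.swap)
  also have "\<dots> = (\<Sum>e'\<in>?A. J e e')"
  proof (intro sum.cong refl)
    fix e'
    have "{X \<in> V. valid e X \<and> valid e' X} = {X \<in> V. valid e X} \<inter> {X. valid e' X}" by auto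
    thus "(\<Sum>X | X \<in> V \<and> valid e X. of_bool (valid e' X)) = J e e'"
      using finV by (simp add: J_def sum_of_bool_eq)
  qed
  also have "\<dots> \<le> 2 ^ q * (2 * Tb)" by (rule second_moment[OF e])
  also have "\<dots> = M * w * real m * \<beta> ^ (2 * p) * real (card V)"
  proof -
    have "(2::real) ^ (5 * q) = 2 ^ q * 2 ^ (4 * q)" unfolding power_add[symmetric] by simp
    thus ?thesis by (simp add: Tb_def M_def w_def mult_ac)
  qed
  also have "\<dots> = B * ((1/4) ^ q * \<beta> ^ p * real (card V) / 4)"
    by (simp add: B_def mult_2 power_add power_one_over)
  finally show ?thesis using B_pos by simp
qed

text \<open>A valid vertex that is not good is bad itself or the flip of a bad one, which excludes
  at most twice the number of bad vertices.\<close>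

lemma card_good_ge:
  assumes e: "e \<in> E"
  shows "(1/4) ^ q * \<beta> ^ p * real (card V) / 2 \<le> real (card (good e))"
proof -
  have fin: "finite (good e)" "finite (bad e)" using finV by (auto simp: good_def bad_def)
  have "{X \<in> V. valid e X} \<subseteq> good e \<union> (bad e \<union> flip e ` bad e)"
  proof
    fix X assume "X \<in> {X \<in> V. valid e X}"
    hence X: "X \<in> V" "valid e X" by auto
    show "X \<in> good e \<union> (bad e \<union> flip e ` bad e)"
    proof (cases "\<Delta> (col (fst e)) (flip e X) \<le> B")
      case True
      thus ?thesis using X by (auto simp: good_def bad_def)
    next
      case False
      hence "flip e X \<in> bad e" using flip_valid[OF e X] by (simp add: bad_def)
      hence "flip e (flip e X) \<in> flip e ` bad e" by (rule imageI)
      thus ?thesis by (simp add: flip_flip)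
    qed
  qed
  hence "card {X \<in> V. valid e X} \<le> card (good e \<union> (bad e \<union> flip e ` bad e))"
    using fin by (intro card_mono) auto
  also have "\<dots> \<le> card (good e) + card (bad e \<union> flip e ` bad e)" by (rule card_Un_le)
  also have "card (bad e \<union> flip e ` bad e) \<le> card (bad e) + card (flip e ` bad e)" by (rule card_Un_le)
  also have "card (flip e ` bad e) \<le> card (bad e)" using fin by (intro card_image_le)
  finally have "real (card {X \<in> V. valid e X}) \<le> real (card (good e)) + 2 * real (card (bad e))" by simp
  thus ?thesis using card_valid_ge[OF e] card_bad_le[OF e] by linarith
qed

lemma good_flip: assumes "e \<in> E" "X \<in> good e"
  shows "flip e X \<in> good e" "flip e X \<in> V" "X \<in> V"
  using assms flip_valid[OF assms(1), of X] by (auto simp: good_def flip_flip)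

text \<open>\<open>toggle_density\<close> is applied to the multigraph in which \<open>e\<close>
  joins each \<open>X \<in> good e\<close> to \<open>flip e X\<close>. Every pair contributes weight
  of order \<open>\<beta> ^ p * card V\<close>; \<open>B\<close> carries the same power of
  \<open>\<beta>\<close>, so it cancels.\<close>

lemma card_E_le:
  assumes R: "R = 2 ^ s" "real (card V) \<le> exp (real R)"
  shows "real (card E) \<le> 768 * 16 ^ q * M * w * real m * real R"
proof -
  define A where "A X Y = real (card {e \<in> E. X \<in> good e \<and> Y = flip e X})" for X Y
  have "(\<Sum>X\<in>V. \<Sum>Y\<in>V. A X Y) \<le> 96 * real R * B * real (card V)"
  proof (rule toggle_density[where \<Psi> = \<Psi> and s = s])
    show "A X Y = A Y X" if "X \<in> V" "Y \<in> V" for X Y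
    proof -
      have "{e \<in> E. X \<in> good e \<and> Y = flip e X} = {e \<in> E. Y \<in> good e \<and> X = flip e Y}"
        using good_flip flip_flip by (intro Collect_cong) metis
      thus ?thesis by (simp add: A_def)
    qed
    show "A X Y \<ge> 0" for X Y by (simp add: A_def)
    show "finite (\<Psi> X)" for X using finK by (simp add: \<Psi>_def)
    show "\<exists>i. sym_diff (\<Psi> X) (\<Psi> Y) = {i}" if "X \<in> V" "Y \<in> V" "A X Y \<noteq> 0" for X Y
    proof -
      have "{e \<in> E. X \<in> good e \<and> Y = flip e X} \<noteq> {}"
      proof
        assume z: "{e \<in> E. X \<in> good e \<and> Y = flip e X} = {}"
        have "A X Y = 0" unfolding A_def z by simp
        with that(3) show False ..
      qed
      then obtain e where "e \<in> E" "Y = flip e X" by (smt (verit) Collect_empty_eq)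
      thus ?thesis using \<Psi>_flip[of e X] that(1) by metis
    qed
    \<comment> \<open>The toggled element \<open>i\<close> determines \<open>col (fst e)\<close>, so
      the row counts pairs of colour \<open>i\<close> that are good at \<open>X\<close>, and
      goodness caps their number by \<open>B\<close>.\<close>
    show "(\<Sum>Y | Y \<in> V \<and> sym_diff (\<Psi> X) (\<Psi> Y) = {i}. A X Y) \<le> B" if X: "X \<in> V" for X i
    proof -
      let ?Y = "{Y. Y \<in> V \<and> sym_diff (\<Psi> X) (\<Psi> Y) = {i}}"
      let ?T = "{e \<in> E. col (fst e) = i \<and> X \<in> good e}"
      have finT: "finite ?T" using finE by simp
      have "(\<Sum>Y\<in>?Y. A X Y) = (\<Sum>Y\<in>?Y. real (card {e \<in> ?T. flip e X = Y}))"
      proof (intro sum.cong refl)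
        fix Y assume Y: "Y \<in> ?Y"
        have "{e \<in> E. X \<in> good e \<and> Y = flip e X} = {e \<in> ?T. flip e X = Y}"
        proof (intro equalityI subsetI)
          fix e assume "e \<in> {e \<in> E. X \<in> good e \<and> Y = flip e X}"
          hence e: "e \<in> E" "X \<in> good e" "Y = flip e X" by auto
          have "sym_diff (\<Psi> X) (\<Psi> Y) = {col (fst e)}" using \<Psi>_flip[OF e(1) X] e(3) by simp
          hence "col (fst e) = i" using Y by (metis (mono_tags, lifting) mem_Collect_eq singleton_inject)
          thus "e \<in> {e \<in> ?T. flip e X = Y}" using e by blast
        qed blast
        thus "A X Y = real (card {e \<in> ?T. flip e X = Y})" by (simp only: A_def)
      qed
      also have "\<dots> = real (card (\<Union>Y\<in>?Y. {e \<in> ?T. flip e X = Y}))"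
        using finV finE by (subst card_UN_disjoint) auto
      also have "\<dots> \<le> real (card ?T)" using finT by (intro of_nat_mono card_mono) auto
      also have "\<dots> \<le> B"
      proof (cases "?T = {}")
        case True
        thus ?thesis using B_pos by (simp only: card.empty)
      next
        case False
        then obtain e where "e \<in> ?T" by (meson ex_in_conv)
        hence "\<Delta> i X \<le> B" by (auto simp: good_def)
        moreover have "card ?T \<le> card {e \<in> E. col (fst e) = i \<and> valid e X}"
          using finE by (intro card_mono) (auto simp: good_def)
        ultimately show ?thesis by (simp add: \<Delta>_def)
      qed
      finally show ?thesis .
    qed
  qed (use finV R in auto)
  moreover have "(\<Sum>X\<in>V. \<Sum>Y\<in>V. A X Y) = (\<Sum>e\<in>E. real (card (good e)))"
  proof -
    have "(\<Sum>X\<in>V. \<Sum>Y\<in>V. A X Y) = (\<Sum>X\<in>V. \<Sum>e\<in>E. of_bool (X \<in> good e))"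
    proof (intro sum.cong refl)
      fix X assume X: "X \<in> V"
      let ?T = "{e \<in> E. X \<in> good e}"
      have finT: "finite ?T" using finE by simp
      have "(\<Sum>Y\<in>V. A X Y) = (\<Sum>Y\<in>V. real (card {e \<in> ?T. flip e X = Y}))"
        unfolding A_def by (intro sum.cong refl arg_cong[of _ _ real] arg_cong[of _ _ card]) auto
      also have "\<dots> = real (card (\<Union>Y\<in>V. {e \<in> ?T. flip e X = Y}))"
        using finV finE by (subst card_UN_disjoint) auto
      also have "(\<Union>Y\<in>V. {e \<in> ?T. flip e X = Y}) = ?T" using good_flip(2) by auto
      also have "real (card ?T) = (\<Sum>e\<in>E. of_bool (X \<in> good e))"
        using finE by (simp add: sum_of_bool_eq Int_def)
      finally show "(\<Sum>Y\<in>V. A X Y) = (\<Sum>e\<in>E. of_bool (X \<in> good e))" .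
    qed
    also have "\<dots> = (\<Sum>e\<in>E. \<Sum>X\<in>V. of_bool (X \<in> good e))" by (rule sum.swap)
    also have "\<dots> = (\<Sum>e\<in>E. real (card (good e)))"
    proof (intro sum.cong refl)
      fix e
      have "V \<inter> good e = good e" by (auto simp: good_def)
      thus "(\<Sum>X\<in>V. of_bool (X \<in> good e)) = real (card (good e))"
        using finV by (simp add: sum_of_bool_eq)
    qed
    finally show ?thesis .
  qed
  moreover have "(\<Sum>e\<in>E. (1/4) ^ q * \<beta> ^ p * real (card V) / 2) \<le> (\<Sum>e\<in>E. real (card (good e)))"
    by (intro sum_mono card_good_ge)
  ultimately have "real (card E) * ((1/4) ^ q * \<beta> ^ p * real (card V) / 2) \<le> 96 * real R * B * real (card V)"
    by simp
  also have "\<dots> = (768 * 16 ^ q * M * w * real m * real R) * ((1/4) ^ q * \<beta> ^ p * real (card V) / 2)"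
  proof -
    have e: "(4::real) ^ q = 16 ^ q * (1/4) ^ q" unfolding power_mult_distrib[symmetric] by simp
    show ?thesis unfolding B_def e by simp
  qed
  finally show ?thesis by (rule mult_right_le_imp_le) (use \<beta>_bounds V_pos in simp)
qed

end

text \<open>Each group has more than \<open>w \<ge> 1\<close> members, hence at least two, so every
  set has at least \<open>w / 2\<close> partners. A cut keeps a quarter of these pairs, and
  \<open>card_E_le\<close> bounds them by a multiple of \<open>w\<close>, which cancels.\<close>

lemma grouped_family_card_le_fixed:
  fixes n l m q t :: nat and \<beta> \<sigma> c :: real and S :: "nat \<Rightarrow> nat set" and G :: "nat set set"
    and \<kappa> :: "nat set \<Rightarrow> nat set" and col :: "nat set \<Rightarrow> nat"
  assumes finG: "finite G" and q_odd: "odd q" and t: "1 \<le> t" "t < q"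
    and edge: "\<And>C. C \<in> G \<Longrightarrow> C \<subseteq> {..<n} \<and> card C = q \<and> xor_sum S C = {col C}"
    and matching: "\<And>C C'. C \<in> G \<Longrightarrow> C' \<in> G \<Longrightarrow> col C = col C' \<Longrightarrow> C \<noteq> C' \<Longrightarrow> C \<inter> C' = {}"
    and col_card: "\<And>i. card {C \<in> G. col C = i} \<le> m"
    and core: "\<And>C. C \<in> G \<Longrightarrow> \<kappa> C \<subseteq> C \<and> card (\<kappa> C) = t"
    and deg: "\<And>Z. Z \<noteq> {} \<Longrightarrow> real (card {C \<in> G. Z \<subseteq> C}) \<le> 2 * \<sigma> * deg_bound m \<beta> (card Z)"
    and grp: "\<And>C. C \<in> G \<Longrightarrow> \<sigma> * deg_bound m \<beta> t < real (card {C' \<in> G. \<kappa> C' = \<kappa> C})"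
    and \<sigma>: "\<sigma> \<ge> 1"
    and l: "2 * q \<le> l" "l \<le> n" and \<beta>: "\<beta> = real l / real (2 * n)"
    and c: "0 < c" "c \<le> 1" "c\<^sup>2 \<le> (real m)\<^sup>2 * \<beta> ^ q"
    and R: "R = 2 ^ s" "real (2 * n choose l) \<le> exp (real R)"
  shows "real (card G) \<le> 24576 * 2 ^ (9 * q) / c\<^sup>2 * real m * real R"
proof -
  define w where "w = \<sigma> * deg_bound m \<beta> t"
  have w1: "1 \<le> w" using \<sigma> mult_mono[of 1 \<sigma> 1 "deg_bound m \<beta> t"] by (simp add: w_def deg_bound_def)
  define E0 where "E0 = (SIGMA C:G. {C' \<in> G. \<kappa> C' = \<kappa> C} - {C})"
  have finE0: "finite E0" using finG by (auto simp: E0_def)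
  \<comment> \<open>Partners share a nonempty core, so they meet and cannot belong to the same
    matching.\<close>
  have ne: "col (fst e) \<noteq> col (snd e)" if "e \<in> E0" for e
  proof
    assume eq: "col (fst e) = col (snd e)"
    have e: "fst e \<in> G" "snd e \<in> G" "\<kappa> (snd e) = \<kappa> (fst e)" "snd e \<noteq> fst e" using that by (auto simp: E0_def)
    hence "fst e \<inter> snd e = {}" using matching[OF e(1,2) eq] by metis
    moreover have "\<kappa> (fst e) \<subseteq> fst e \<inter> snd e" using core[OF e(1)] core[OF e(2)] e(3) by auto
    moreover have "\<kappa> (fst e) \<noteq> {}" using core[OF e(1)] t by auto
    ultimately show False by auto
  qed
  from exists_cut[OF finE0, of "\<lambda>e. col (fst e)" "\<lambda>e. col (snd e)"] ne
  obtain K where K: "finite K" "card E0 \<le> 4 * card {e \<in> E0. col (fst e) \<in> K \<and> col (snd e) \<notin> K}" by blast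
  define E where "E = {e \<in> E0. col (fst e) \<in> K \<and> col (snd e) \<notin> K}"
  interpret ki: kikuchi n l m q t \<beta> \<sigma> c S G \<kappa> col E K
    using finG q_odd t edge matching col_card core deg \<sigma> l \<beta> c K(1)
    by unfold_locales (auto simp: E_def E0_def)
  have "real (card G) * (w / 2) = (\<Sum>C\<in>G. w / 2)" by simp
  also have "\<dots> \<le> (\<Sum>C\<in>G. real (card ({C' \<in> G. \<kappa> C' = \<kappa> C} - {C})))"
  proof (intro sum_mono)
    fix C assume C: "C \<in> G"
    have g: "w < real (card {C' \<in> G. \<kappa> C' = \<kappa> C})" using grp[OF C] by (simp add: w_def)
    have "card ({C' \<in> G. \<kappa> C' = \<kappa> C} - {C}) = card {C' \<in> G. \<kappa> C' = \<kappa> C} - 1"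
      using C finG by (subst card_Diff_singleton) auto
    moreover have "card {C' \<in> G. \<kappa> C' = \<kappa> C} \<ge> 2" using g w1 by linarith
    ultimately show "w / 2 \<le> real (card ({C' \<in> G. \<kappa> C' = \<kappa> C} - {C}))" using g by linarith
  qed
  also have "\<dots> = real (card E0)" using finG by (simp add: E0_def)
  also have "\<dots> \<le> 4 * real (card E)" using K(2) by (simp add: E_def)
  also have "\<dots> \<le> 4 * (768 * 16 ^ q * ki.M * ki.w * real m * real R)"
    using R by (intro mult_left_mono ki.card_E_le[of R s]) (auto simp: ki.cardV)
  also have "ki.w = w" by (simp add: ki.w_def w_def)
  also have "4 * (768 * 16 ^ q * ki.M * w * real m * real R) = (24576 * 2 ^ (9 * q) / c\<^sup>2 * real m * real R) * (w / 2)"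
  proof -
    have "(2::real) ^ (9 * q) = 2 ^ (4 * q) * 2 ^ (5 * q)" unfolding power_add[symmetric] by simp
    also have "(2::real) ^ (4 * q) = 16 ^ q" by (simp add: power_mult)
    finally have "(2::real) ^ (9 * q) = 16 ^ q * 2 ^ (5 * q)" .
    thus ?thesis by (simp add: ki.M_def mult_ac)
  qed
  finally show ?thesis by (rule mult_right_le_imp_le) (use w1 in simp)
qed

text \<open>Sorting by core size reduces to \<open>grouped_family_card_le_fixed\<close>. Size
  \<open>q\<close> does not occur: such a core is the whole set, its group would be a single set,
  and the threshold is at least 1.\<close>

lemma grouped_family_card_le:
  fixes n l m q :: nat and \<beta> \<sigma> c :: real and S :: "nat \<Rightarrow> nat set" and G :: "nat set set"
    and \<kappa> :: "nat set \<Rightarrow> nat set" and col :: "nat set \<Rightarrow> nat"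
  assumes finG: "finite G" and q_odd: "odd q"
    and edge: "\<And>C. C \<in> G \<Longrightarrow> C \<subseteq> {..<n} \<and> card C = q \<and> xor_sum S C = {col C}"
    and matching: "\<And>C C'. C \<in> G \<Longrightarrow> C' \<in> G \<Longrightarrow> col C = col C' \<Longrightarrow> C \<noteq> C' \<Longrightarrow> C \<inter> C' = {}"
    and col_card: "\<And>i. card {C \<in> G. col C = i} \<le> m"
    and deg: "\<And>Z. Z \<noteq> {} \<Longrightarrow> real (card {C \<in> G. Z \<subseteq> C}) \<le> 2 * \<sigma> * deg_bound m \<beta> (card Z)"
    and grp: "\<And>C. C \<in> G \<Longrightarrow> \<kappa> C \<subseteq> C \<and> \<kappa> C \<noteq> {} \<and>
      \<sigma> * deg_bound m \<beta> (card (\<kappa> C)) < real (card {C' \<in> G. \<kappa> C' = \<kappa> C})"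
    and \<sigma>: "\<sigma> \<ge> 1"
    and l: "2 * q \<le> l" "l \<le> n" and \<beta>: "\<beta> = real l / real (2 * n)"
    and c: "0 < c" "c \<le> 1" "c\<^sup>2 \<le> (real m)\<^sup>2 * \<beta> ^ q"
    and R: "R = 2 ^ s" "real (2 * n choose l) \<le> exp (real R)"
  shows "real (card G) \<le> real q * (24576 * 2 ^ (9 * q) / c\<^sup>2 * real m * real R)"
proof -
  let ?\<Lambda> = "24576 * 2 ^ (9 * q) / c\<^sup>2 * real m * real R"
  let ?G = "\<lambda>t. {C \<in> G. card (\<kappa> C) = t}"
  have t: "card (\<kappa> C) \<in> {1..<q}" if C: "C \<in> G" for C
  proof -
    have finC: "finite C" using edge[OF C] finite_subset by auto
    have k: "\<kappa> C \<subseteq> C" "\<kappa> C \<noteq> {}" using grp[OF C] by auto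
    have "card (\<kappa> C) \<noteq> 0" using k(2) card_0_eq[OF finite_subset[OF k(1) finC]] by simp
    moreover have "card (\<kappa> C) \<le> q" using card_mono[OF finC k(1)] edge[OF C] by simp
    moreover have "card (\<kappa> C) \<noteq> q"
    proof
      assume eq: "card (\<kappa> C) = q"
      have kC: "\<kappa> C = C" using card_subset_eq[OF finC k(1)] eq edge[OF C] by simp
      have "{C' \<in> G. \<kappa> C' = \<kappa> C} \<subseteq> {C}"
      proof
        fix C' assume "C' \<in> {C' \<in> G. \<kappa> C' = \<kappa> C}"
        hence C': "C' \<in> G" "C \<subseteq> C'" using grp kC by auto
        have "finite C'" using edge[OF C'(1)] finite_subset by auto
        thus "C' \<in> {C}" using card_subset_eq[of C' C] C' edge[OF C] edge[OF C'(1)] by simp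
      qed
      hence "card {C' \<in> G. \<kappa> C' = \<kappa> C} \<le> card {C}" by (intro card_mono) auto
      hence "real (card {C' \<in> G. \<kappa> C' = \<kappa> C}) \<le> 1" by simp
      moreover have "1 \<le> \<sigma> * deg_bound m \<beta> (card (\<kappa> C))"
        using \<sigma> mult_mono[of 1 \<sigma> 1 "deg_bound m \<beta> (card (\<kappa> C))"] by (simp add: deg_bound_def)
      ultimately show False using grp[OF C] by linarith
    qed
    ultimately show ?thesis by simp
  qed
  have "real (card (?G t)) \<le> ?\<Lambda>" if "t \<in> {1..<q}" for t
  proof (rule grouped_family_card_le_fixed[where \<kappa> = \<kappa> and t = t and col = col and S = S and \<beta> = \<beta> and \<sigma> = \<sigma> and s = s])
    show "card {C \<in> ?G t. col C = i} \<le> m" for i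
    proof -
      have "card {C \<in> ?G t. col C = i} \<le> card {C \<in> G. col C = i}" using finG by (intro card_mono) auto
      thus ?thesis using col_card[of i] by linarith
    qed
    show "real (card {C \<in> ?G t. Z \<subseteq> C}) \<le> 2 * \<sigma> * deg_bound m \<beta> (card Z)" if "Z \<noteq> {}" for Z
    proof -
      have "card {C \<in> ?G t. Z \<subseteq> C} \<le> card {C \<in> G. Z \<subseteq> C}" using finG by (intro card_mono) auto
      thus ?thesis using deg[OF that] by linarith
    qed
    show "\<sigma> * deg_bound m \<beta> t < real (card {C' \<in> ?G t. \<kappa> C' = \<kappa> C})" if C: "C \<in> ?G t" for C
    proof -
      have "{C' \<in> ?G t. \<kappa> C' = \<kappa> C} = {C' \<in> G. \<kappa> C' = \<kappa> C}" using C by auto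
      thus ?thesis using grp[of C] C by auto
    qed
  qed (use that assms in auto)
  hence "(\<Sum>t\<in>{1..<q}. real (card (?G t))) \<le> real q * ?\<Lambda>"
    by (intro sum_le_card_bound) (use c in auto)
  moreover have "card G = (\<Sum>t\<in>{1..<q}. card (?G t))"
  proof -
    have "G = (\<Union>t\<in>{1..<q}. ?G t)" using t by auto
    hence "card G = card (\<Union>t\<in>{1..<q}. ?G t)" by simp
    also have "\<dots> = (\<Sum>t\<in>{1..<q}. card (?G t))" using finG by (intro card_UN_disjoint) auto
    finally show ?thesis .
  qed
  ultimately show ?thesis by simp
qed

section \<open>Combining all scales\<close>

lemma sum_card_eq_sum_degree:
  assumes "finite A" "finite R" "\<And>C. C \<in> R \<Longrightarrow> C \<subseteq> A"
  shows "(\<Sum>C\<in>R. card C) = (\<Sum>u\<in>A. card {C \<in> R. u \<in> C})"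
proof -
  have "(\<Sum>C\<in>R. card C) = (\<Sum>C\<in>R. \<Sum>u\<in>A. of_bool (u \<in> C))"
  proof (intro sum.cong refl)
    fix C assume "C \<in> R"
    hence "A \<inter> C = C" using assms(3) by auto
    thus "card C = (\<Sum>u\<in>A. of_bool (u \<in> C))" using assms(1) by (simp add: sum_of_bool_eq)
  qed
  also have "\<dots> = (\<Sum>u\<in>A. \<Sum>C\<in>R. of_bool (u \<in> C))" by (rule sum.swap)
  also have "\<dots> = (\<Sum>u\<in>A. card {C \<in> R. u \<in> C})"
    using assms(2) by (simp add: sum_of_bool_eq Int_def)
  finally show ?thesis .
qed

text \<open>At each of the \<open>s\<close> scales \<open>grouped_family_card_le\<close> bounds the
  extracted sets. In the remainder every vertex has degree at most \<open>m * \<beta>\<close>, so at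
  most \<open>m * l\<close> sets are left. The union of the matchings has \<open>k * m\<close> sets;
  dividing by \<open>m\<close> finishes.\<close>

lemma uniform_matchings_bound:
  fixes n k m q l :: nat and \<beta> c :: real and S :: "nat \<Rightarrow> nat set" and H :: "nat \<Rightarrow> nat set set"
  assumes q_odd: "odd q"
    and disj: "\<And>i. i < k \<Longrightarrow> pairwise disjnt (H i)"
    and cardH: "\<And>i. i < k \<Longrightarrow> card (H i) = m"
    and H: "\<And>i C. i < k \<Longrightarrow> C \<in> H i \<Longrightarrow> C \<subseteq> {..<n} \<and> card C = q \<and> xor_sum S C = {i}"
    and l: "2 * q \<le> l" "l \<le> n" and \<beta>: "\<beta> = real l / real (2 * n)"
    and c: "0 < c" "c \<le> 1" "c\<^sup>2 \<le> (real m)\<^sup>2 * \<beta> ^ q" and m\<beta>: "1 \<le> real m * \<beta>"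
    and R: "R = 2 ^ r" "real (2 * n choose l) \<le> exp (real R)"
    and s: "real (k * m) \<le> 2 ^ s"
  shows "real k \<le> real s * (real q * (24576 * 2 ^ (9 * q) / c\<^sup>2 * real R)) + real l"
proof -
  let ?\<Lambda> = "real q * (24576 * 2 ^ (9 * q) / c\<^sup>2 * real m * real R)"
  define F where "F = (\<Union>i<k. H i)"
  define col where "col C = the_elem (xor_sum S C)" for C
  have mpos: "m > 0" using m\<beta> by (cases m) auto
  have q0: "q \<ge> 1" using q_odd by (cases q) auto
  have npos: "n > 0" using l q0 by linarith
  have finH: "finite (H i)" if "i < k" for i using cardH[OF that] mpos card_ge_0_finite by metis
  have finF: "finite F" using finH by (auto simp: F_def)
  have colH: "col C = i" if "i < k" "C \<in> H i" for i C using H[OF that] by (simp add: col_def)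
  have edge: "C \<subseteq> {..<n} \<and> card C = q \<and> xor_sum S C = {col C}" if "C \<in> F" for C
    using that H colH unfolding F_def by fastforce
  have FH: "C \<in> H (col C)" "col C < k" if "C \<in> F" for C
    using that colH unfolding F_def by auto
  have matching: "C \<inter> C' = {}" if "C \<in> F" "C' \<in> F" "col C = col C'" "C \<noteq> C'" for C C'
    using disj[OF FH(2)[OF that(1)]] FH(1)[OF that(1)] FH(1)[OF that(2)] that(3,4)
    by (auto simp: pairwise_def disjnt_def)
  have colm: "card {C \<in> F. col C = i} \<le> m" for i
  proof (cases "i < k")
    case True
    have "{C \<in> F. col C = i} \<subseteq> H i" using FH by auto
    hence "card {C \<in> F. col C = i} \<le> card (H i)" using finH[OF True] by (intro card_mono)
    thus ?thesis using cardH[OF True] by simp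
  next
    case False
    hence "{C \<in> F. col C = i} = {}" using FH by auto
    thus ?thesis by (simp only: card.empty)
  qed
  have "card F = (\<Sum>i<k. card (H i))" unfolding F_def
  proof (rule card_UN_disjoint)
    show "\<forall>i\<in>{..<k}. \<forall>j\<in>{..<k}. i \<noteq> j \<longrightarrow> H i \<inter> H j = {}"
      using colH by (metis Int_emptyI lessThan_iff)
  qed (use finH in auto)
  hence cardF: "card F = k * m" using cardH by simp
  have "\<exists>R' \<subseteq> F. (\<forall>Z. Z \<noteq> {} \<longrightarrow> real (card {C \<in> R'. Z \<subseteq> C}) \<le> deg_bound m \<beta> (card Z)) \<and>
    real (card F) \<le> real s * ?\<Lambda> + real (card R')"
  proof (rule scale_decomposition[OF finF])
    show "0 \<le> deg_bound m \<beta> z" for z by (simp add: deg_bound_def)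
    \<comment> \<open>The coarsest scale is free: no degree exceeds \<open>card F\<close>, and
      \<open>deg_bound\<close> is at least 1.\<close>
    show "real (card {C \<in> F. Z \<subseteq> C}) \<le> 2 ^ s * deg_bound m \<beta> (card Z)" for Z
    proof -
      have "card {C \<in> F. Z \<subseteq> C} \<le> card F" using finF by (intro card_mono) auto
      hence "real (card {C \<in> F. Z \<subseteq> C}) \<le> real (k * m)" unfolding cardF by (simp only: of_nat_le_iff)
      also have "\<dots> \<le> 2 ^ s * 1" using s by simp
      also have "\<dots> \<le> 2 ^ s * deg_bound m \<beta> (card Z)" by (intro mult_left_mono) (auto simp: deg_bound_def)
      finally show ?thesis .
    qed
    show "real (card G) \<le> ?\<Lambda>" if G: "G \<subseteq> F"
      and dg: "\<And>Z. Z \<noteq> {} \<Longrightarrow> real (card {C \<in> G. Z \<subseteq> C}) \<le> 2 * 2 ^ a * deg_bound m \<beta> (card Z)"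
      and gr: "\<And>C. C \<in> G \<Longrightarrow> \<kappa> C \<subseteq> C \<and> \<kappa> C \<noteq> {} \<and> 2 ^ a * deg_bound m \<beta> (card (\<kappa> C)) < real (card {C'\<in>G. \<kappa> C' = \<kappa> C})"
      for G \<kappa> a
    proof (rule grouped_family_card_le[where \<sigma> = "2 ^ a", OF _ q_odd _ _ _ dg gr _ l \<beta> c R])
      show "finite G" using G finF finite_subset by blast
      show "C \<subseteq> {..<n} \<and> card C = q \<and> xor_sum S C = {col C}" if "C \<in> G" for C using edge G that by blast
      show "C \<inter> C' = {}" if "C \<in> G" "C' \<in> G" "col C = col C'" "C \<noteq> C'" for C C'
        using matching[of C C'] G that by blast
      show "card {C \<in> G. col C = i} \<le> m" for i
      proof -
        have "card {C \<in> G. col C = i} \<le> card {C \<in> F. col C = i}" using finF G by (intro card_mono) auto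
        thus ?thesis using colm[of i] by linarith
      qed
    qed auto
  qed
  then obtain R' where R': "R' \<subseteq> F" "\<And>Z. Z \<noteq> {} \<Longrightarrow> real (card {C \<in> R'. Z \<subseteq> C}) \<le> deg_bound m \<beta> (card Z)"
    "real (card F) \<le> real s * ?\<Lambda> + real (card R')" by blast
  have finR: "finite R'" using R'(1) finF finite_subset by blast
  \<comment> \<open>Double counting of incidences. By \<open>m\<beta>\<close> the maximum in
    \<open>deg_bound\<close> at singletons is \<open>m * \<beta>\<close>.\<close>
  have "q * card R' = (\<Sum>C\<in>R'. card C)" using R'(1) edge by (subst sum.cong[OF refl, of R' card "\<lambda>_. q"]) auto
  also have "\<dots> = (\<Sum>u<n. card {C \<in> R'. u \<in> C})"
    using R'(1) edge finR by (intro sum_card_eq_sum_degree) blast+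
  finally have "real (q * card R') = (\<Sum>u<n. real (card {C \<in> R'. u \<in> C}))" by simp
  also have "\<dots> \<le> real n * (real m * \<beta>)"
  proof (rule sum_le_card_bound)
    show "real (card {C \<in> R'. u \<in> C}) \<le> real m * \<beta>" for u
      using R'(2)[of "{u}"] m\<beta> by (simp add: deg_bound_def)
  qed (use m\<beta> in auto)
  also have "\<dots> \<le> real m * real l" using npos by (simp add: \<beta>)
  finally have "real (q * card R') \<le> real m * real l" .
  moreover have "real (card R') \<le> real (q * card R')" using q0 mult_right_mono[of 1 "real q" "real (card R')"] by simp
  ultimately have "real (card R') \<le> real m * real l" by linarith
  with R'(3) cardF have "real k * real m \<le> real s * ?\<Lambda> + real m * real l" by simp
  also have "\<dots> = (real s * (real q * (24576 * 2 ^ (9 * q) / c\<^sup>2 * real R)) + real l) * real m"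
    by (simp add: algebra_simps)
  finally show ?thesis using mpos by simp
qed

section \<open>From matchings to the bound on the message length\<close>

text \<open>The added coordinates come from a block of length \<open>q\<close> reserved for
  \<open>Min C\<close>. Disjoint sets have different minima, so a padded matching is still a
  matching; the new coordinates receive empty support and leave the F_2-sum alone.\<close>

definition pad :: "nat \<Rightarrow> nat \<Rightarrow> nat set \<Rightarrow> nat set" where
  "pad n q C = C \<union> (\<lambda>j. n + (q * Min C + j)) ` {..<q - card C}"

lemma pad_props:
  assumes "C \<subseteq> {..<n}" "C \<noteq> {}" "card C \<le> q"
  shows "pad n q C \<subseteq> {..<(q + 1) * n}" "card (pad n q C) = q" "pad n q C \<inter> {..<n} = C"
    "xor_sum (\<lambda>v. if v < n then S v else {}) (pad n q C) = xor_sum S C"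
proof -
  have finC: "finite C" using assms(1) finite_subset by blast
  have Min: "Min C < n" using assms Min_in[OF finC] by auto
  have "n + (q * Min C + j) < (q + 1) * n" if "j < q - card C" for j
  proof -
    have "q * Min C + j < q * Suc (Min C)" using that by simp
    also have "\<dots> \<le> q * n" using Min by (intro mult_le_mono2) simp
    finally show ?thesis by simp
  qed
  moreover have "C \<subseteq> {..<(q + 1) * n}" using assms(1) by fastforce
  ultimately show "pad n q C \<subseteq> {..<(q + 1) * n}" by (auto simp: pad_def)
  have "card (pad n q C) = card C + card ((\<lambda>j. n + (q * Min C + j)) ` {..<q - card C})"
    unfolding pad_def using finC assms(1) by (intro card_Un_disjoint) auto
  also have "card ((\<lambda>j. n + (q * Min C + j)) ` {..<q - card C}) = q - card C"
    by (subst card_image) (auto simp: inj_on_def)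
  finally show "card (pad n q C) = q" using assms(3) by simp
  show i: "pad n q C \<inter> {..<n} = C" using assms(1) by (auto simp: pad_def)
  have "{v \<in> pad n q C. j \<in> (if v < n then S v else {})} = {v \<in> C. j \<in> S v}" for j
    using i by (auto split: if_splits)
  thus "xor_sum (\<lambda>v. if v < n then S v else {}) (pad n q C) = xor_sum S C" by (simp add: xor_sum_def)
qed

lemma pad_disjoint:
  assumes "C \<subseteq> {..<n}" "C \<noteq> {}" "C' \<subseteq> {..<n}" "C' \<noteq> {}" "C \<inter> C' = {}"
  shows "pad n q C \<inter> pad n q C' = {}"
proof -
  have "finite C" "finite C'" using finite_subset[OF assms(1)] finite_subset[OF assms(3)] by auto
  hence "Min C \<in> C" "Min C' \<in> C'" using assms(2,4) by auto
  hence ne: "Min C \<noteq> Min C'" using assms(5) by auto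
  have "q * Min C + j \<noteq> q * Min C' + j'" if "j < q - card C" "j' < q - card C'" for j j'
  proof
    assume "q * Min C + j = q * Min C' + j'"
    hence "(q * Min C + j) div q = (q * Min C' + j') div q" by simp
    thus False using ne that by simp
  qed
  thus ?thesis using assms(1,3,5) by (fastforce simp: pad_def)
qed

text \<open>Minima of disjoint nonempty sets are distinct.\<close>

lemma matching_card_le:
  fixes H :: "nat set set"
  assumes "pairwise disjnt H" "\<And>C. C \<in> H \<Longrightarrow> C \<subseteq> {..<n} \<and> C \<noteq> {}"
  shows "card H \<le> n"
proof -
  have Min: "Min C \<in> C" if "C \<in> H" for C
    using assms(2)[OF that] finite_subset[of C "{..<n}"] by (intro Min_in) auto
  have inj: "inj_on Min H"
  proof (rule inj_onI, rule ccontr)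
    fix C C' assume C: "C \<in> H" "C' \<in> H" "Min C = Min C'" "C \<noteq> C'"
    hence "disjnt C C'" using assms(1) by (simp add: pairwise_def)
    thus False using Min[OF C(1)] Min[OF C(2)] C(3) by (auto simp: disjnt_def)
  qed
  have "Min ` H \<subseteq> {..<n}" using Min assms(2) by blast
  thus ?thesis using card_inj_on_le[OF inj, of "{..<n}"] by simp
qed

section \<open>Choice of the parameters\<close>

lemma ex_power_of_two_between:
  assumes "1 \<le> (x::real)"
  shows "\<exists>s. x \<le> 2 ^ s \<and> 2 ^ s \<le> 2 * x"
proof -
  define s where "s = nat \<lceil>log 2 x\<rceil>"
  have "0 \<le> log 2 x" using assms by simp
  hence s: "log 2 x \<le> real s" "real s \<le> log 2 x + 1" by (auto simp: s_def)
  have "x = 2 powr (log 2 x)" using assms by simp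
  also have "\<dots> \<le> 2 powr real s" using s by simp
  finally have 1: "x \<le> 2 ^ s" by (simp add: powr_realpow)
  have "2 powr real s \<le> 2 powr (log 2 x + 1)" using s by simp
  also have "\<dots> = 2 * x" using assms by (simp add: powr_add)
  finally show ?thesis using 1 by (auto simp: powr_realpow)
qed

text \<open>With \<open>\<mu> = m powr (2 / q)\<close> and \<open>l\<close> about
  \<open>2 * N / \<mu>\<close>, the density \<open>\<beta>\<close> is about \<open>1 / \<mu>\<close>
  and \<open>m\<^sup>2 * \<beta> ^ q\<close> is of constant order. One logarithm is the number
  \<open>s\<close> of scales, the other sits in \<open>R\<close>, which is about
  \<open>l * ln (2 * N)\<close>. Finally \<open>l\<close> is at most a multiple of
  \<open>(n / m) * m powr (1 - 2 / q)\<close>, and \<open>m \<le> n\<close>.\<close>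

lemma uniform_matchings_bound_asymptotic:
  fixes q :: nat
  assumes q: "odd q" "q \<ge> 3"
  defines "\<Lambda> \<equiv> 24576 * 2 ^ (9 * q) * 4 ^ q :: real"
  defines "K \<equiv> (12 * real q * (4 * real q + 5) * \<Lambda> + 4) * (2 * (real q + 1))"
  assumes n: "n \<ge> 2" and m: "2 ^ q \<le> m" "m \<le> n" and k: "k \<le> n"
    and disj: "\<And>i. i < k \<Longrightarrow> pairwise disjnt (H i)"
    and cardH: "\<And>i. i < k \<Longrightarrow> card (H i) = m"
    and H: "\<And>i C. i < k \<Longrightarrow> C \<in> H i \<Longrightarrow> C \<subseteq> {..<(q + 1) * n} \<and> card C = q \<and> xor_sum S C = {i}"
  shows "real k \<le> K * (real n / real m) * real n powr (1 - 2 / real q) * (ln (real n))\<^sup>2"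
proof -
  define \<mu> where "\<mu> = real m powr (2 / real q)"
  define L where "L = ln (real n)"
  define N where "N = (q + 1) * n"
  define x where "x = real (2 * N) / \<mu>"
  define l where "l = nat \<lfloor>x\<rfloor>"
  define \<beta> where "\<beta> = real l / real (2 * N)"
  \<comment> \<open>Rounding \<open>l\<close> down at most halves it, which loses at most a factor
    \<open>2 ^ q\<close> in \<open>m\<^sup>2 * \<beta> ^ q\<close>.\<close>
  define c :: real where "c = (1/2) ^ q"
  have mpos: "m > 0" using m(1) by (cases m) auto
  have \<mu>pos: "\<mu> > 0" using mpos by (simp add: \<mu>_def)
  have L: "1/2 \<le> L" 
  proof -
    have "ln 2 \<le> L" using n by (simp add: L_def)
    thus ?thesis using ln2_ge_two_thirds by linarith
  qed
  have \<mu>q: "\<mu> ^ q = (real m)\<^sup>2"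
  proof -
    have "\<mu> ^ q = \<mu> powr real q" using \<mu>pos by (simp add: powr_realpow)
    also have "\<dots> = real m powr 2" using q by (simp add: \<mu>_def powr_powr)
    also have "\<dots> = (real m)\<^sup>2" using mpos by (simp add: powr_realpow[of _ 2, simplified])
    finally show ?thesis .
  qed
  have m2: "2 ^ q \<le> real m" using m(1) by (metis of_nat_le_iff of_nat_numeral of_nat_power)
  obtain j where j: "q = Suc j" using q(2) by (cases q) auto
  \<comment> \<open>Compared in \<open>q\<close>-th powers:
    \<open>2 ^ q * m\<^sup>2 \<le> m ^ 3 \<le> m ^ q\<close>. It yields
    \<open>1 \<le> m * \<beta>\<close> below.\<close>
  have "2 * \<mu> \<le> real m"
  proof (rule power_le_imp_le_base)
    have "(2 * \<mu>) ^ q = 2 ^ q * (real m)\<^sup>2" using \<mu>q by (simp add: power_mult_distrib)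
    also have "\<dots> \<le> real m * (real m)\<^sup>2" using m2 by (intro mult_right_mono) auto
    also have "\<dots> = real m ^ 3" by (simp add: power2_eq_square power3_eq_cube)
    also have "\<dots> \<le> real m ^ q" using q mpos by (intro power_increasing) auto
    finally show "(2 * \<mu>) ^ Suc j \<le> real m ^ Suc j" using j by simp
  qed simp
  hence \<mu>m: "2 * \<mu> \<le> real m" .
  have \<mu>2: "2 \<le> \<mu>"
  proof -
    have "2 ^ q * 1 \<le> real m * real m" using m2 mpos by (intro mult_mono) auto
    hence "2 ^ q \<le> (real m)\<^sup>2" by (simp add: power2_eq_square)
    hence "2 ^ q \<le> \<mu> ^ q" using \<mu>q by simp
    thus ?thesis using \<mu>pos q by (simp add: power_mono_iff)
  qed
  have \<mu>n: "\<mu> \<le> real n powr (2 / real q)" unfolding \<mu>_def using m by (intro powr_mono2) auto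
  have np1: "1 \<le> real n powr (1 - 2 / real q)" using n q by (intro ge_one_powr_ge_zero) (auto simp: field_simps)
  have Nr: "real N = (real q + 1) * real n" by (simp add: N_def algebra_simps)
  have xge: "2 * (real q + 1) \<le> x"
  proof -
    have "2 * (real q + 1) \<le> 2 * (real q + 1) * real n powr (1 - 2 / real q)" using np1 by simp
    also have "\<dots> = real (2 * N) / real n powr (2 / real q)" using n by (simp add: powr_diff Nr)
    also have "\<dots> \<le> x" unfolding x_def using \<mu>n \<mu>pos n by (intro divide_left_mono) auto
    finally show ?thesis .
  qed
  have lx: "real l \<le> x" "x - 1 < real l" using xge unfolding l_def by (auto simp: of_nat_nat)
  have "real (2 * q) \<le> real l" using lx(2) xge by simp
  hence lq: "2 * q \<le> l" by (simp only: of_nat_le_iff)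
  have lN: "l \<le> N"
  proof -
    have "x \<le> real (2 * N) / 2" unfolding x_def using \<mu>2 by (intro divide_left_mono) auto
    thus ?thesis using lx(1) by simp
  qed
  have Npos: "N > 0" using n by (simp add: N_def)
  have \<beta>ge: "1 / (2 * \<mu>) \<le> \<beta>"
  proof -
    have "2 \<le> 2 * (real q + 1)" by simp
    hence "x / 2 \<le> real l" using lx(2) xge by linarith
    hence "x / 2 / real (2 * N) \<le> \<beta>" unfolding \<beta>_def by (rule divide_right_mono) simp
    moreover have "x / 2 / real (2 * N) = 1 / (2 * \<mu>)" using Npos by (simp add: x_def)
    ultimately show ?thesis by simp
  qed
  have c: "0 < c" "c \<le> 1" by (auto simp: c_def power_le_one)
  have c2: "c\<^sup>2 \<le> (real m)\<^sup>2 * \<beta> ^ q"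
  proof -
    have "c\<^sup>2 \<le> c" using c by (simp add: power2_eq_square mult_left_le)
    also have "c = (real m)\<^sup>2 * (1 / (2 * \<mu>)) ^ q"
      using mpos by (simp add: c_def power_divide power_mult_distrib \<mu>q)
    also have "\<dots> \<le> (real m)\<^sup>2 * \<beta> ^ q" using \<beta>ge \<mu>pos by (intro mult_left_mono power_mono) auto
    finally show ?thesis .
  qed
  have m\<beta>: "1 \<le> real m * \<beta>"
  proof -
    have "1 \<le> real m * (1 / (2 * \<mu>))" using \<mu>m \<mu>pos by simp
    also have "\<dots> \<le> real m * \<beta>" using \<beta>ge by (intro mult_left_mono) auto
    finally show ?thesis .
  qed
  have ln\<nu>: "ln (real (2 * N)) \<le> (4 * real q + 5) * L" "1/2 \<le> ln (real (2 * N))"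
  proof -
    have "real (2 * N) = 2 * (real q + 1) * real n" by (simp add: Nr)
    hence "ln (real (2 * N)) = ln (2 * (real q + 1) * real n)" by (simp only:)
    also have "\<dots> = ln (2 * (real q + 1)) + L" using n unfolding L_def by (intro ln_mult_pos) auto
    finally have eq: "ln (real (2 * N)) = ln (2 * (real q + 1)) + L" .
    have "ln (2 * (real q + 1)) \<le> 2 * (real q + 1)" by (intro ln_bound) auto
    moreover have "(4 * real q + 4) * (1/2) \<le> (4 * real q + 4) * L" using L by (intro mult_left_mono) auto
    ultimately show "ln (real (2 * N)) \<le> (4 * real q + 5) * L" unfolding eq by argo
    have "0 \<le> ln (2 * (real q + 1))" by simp
    thus "1/2 \<le> ln (real (2 * N))" using eq L by linarith
  qed
  have "1 \<le> real l * ln (real (2 * N))"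
  proof -
    have "2 * (1/2) \<le> real l * ln (real (2 * N))" using ln\<nu> lq q by (intro mult_mono) auto
    thus ?thesis by simp
  qed
  \<comment> \<open>Rounding up to a power of two, as the doubling argument for walks requires, at
    most doubles the exponent.\<close>
  from ex_power_of_two_between[OF this] obtain r where r: "real l * ln (real (2 * N)) \<le> 2 ^ r"
    "2 ^ r \<le> 2 * (real l * ln (real (2 * N)))" by blast
  define R :: nat where "R = 2 ^ r"
  have Rr: "real R = 2 ^ r" by (simp add: R_def)
  have binom: "real (2 * N choose l) \<le> exp (real R)"
  proof -
    have "2 * N choose l \<le> (2 * N) ^ l" using lN by (intro binomial_le_pow) auto
    hence "real (2 * N choose l) \<le> real (2 * N) ^ l" by (metis of_nat_le_iff of_nat_power)
    also have "\<dots> = exp (real l * ln (real (2 * N)))" using Npos by (simp add: exp_of_nat_mult)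
    also have "\<dots> \<le> exp (real R)" using r(1) Rr by simp
    finally show ?thesis .
  qed
  have "1 \<le> (real n)\<^sup>2" using n by simp
  from ex_power_of_two_between[OF this] obtain s where s: "(real n)\<^sup>2 \<le> 2 ^ s" "2 ^ s \<le> 2 * (real n)\<^sup>2" by blast
  have km: "real (k * m) \<le> 2 ^ s"
  proof -
    have "real (k * m) \<le> real n * real n" using k m by (simp add: mult_mono)
    thus ?thesis using s(1) by (simp add: power2_eq_square)
  qed
  have s6: "real s \<le> 6 * L"
  proof -
    have "ln (2 ^ s) \<le> ln (2 * (real n)\<^sup>2)" using s(2) n by simp
    hence "real s * ln 2 \<le> ln 2 + 2 * L" using n by (simp add: ln_realpow ln_mult L_def)
    moreover have "ln 2 \<le> L" using n by (simp add: L_def)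
    moreover have "real s * (1/2) \<le> real s * ln 2" using ln2_ge_two_thirds by (intro mult_left_mono) auto
    ultimately show ?thesis by linarith
  qed
  have "real k \<le> real s * (real q * (24576 * 2 ^ (9 * q) / c\<^sup>2 * real R)) + real l"
    by (rule uniform_matchings_bound[where n = N and H = H and S = S and \<beta> = \<beta> and r = r, OF q(1) disj cardH _ lq lN _ c c2 m\<beta> _ binom km])
      (use H in \<open>auto simp: N_def \<beta>_def R_def\<close>)
  also have "24576 * 2 ^ (9 * q) / c\<^sup>2 = \<Lambda>"
    by (simp add: \<Lambda>_def c_def power_one_over power2_eq_square power_mult_distrib[symmetric])
  \<comment> \<open>The lone \<open>real l\<close> is absorbed through
    \<open>1 \<le> 4 * L\<^sup>2\<close>; this is the summand 4 in \<open>K\<close>.\<close>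
  also have "real s * (real q * (\<Lambda> * real R)) + real l \<le> 6 * L * (real q * (\<Lambda> * (2 * (real l * ((4 * real q + 5) * L))))) + real l * (4 * L\<^sup>2)"
  proof (intro add_mono mult_mono)
    show "real R \<le> 2 * (real l * ((4 * real q + 5) * L))"
      using r(2) mult_left_mono[OF ln\<nu>(1), of "2 * real l"] by (simp add: Rr)
    have "1/2 * (1/2) \<le> L * L" using L by (intro mult_mono) auto
    hence "1 \<le> 4 * L\<^sup>2" by (simp add: power2_eq_square)
    thus "real l \<le> real l * (4 * L\<^sup>2)" using mult_left_mono[of 1 "4 * L\<^sup>2" "real l"] by simp
  qed (use s6 L in \<open>auto simp: \<Lambda>_def\<close>)
  also have "\<dots> = (12 * real q * (4 * real q + 5) * \<Lambda> + 4) * real l * L\<^sup>2"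
    by (simp add: power2_eq_square algebra_simps)
  also have "\<dots> \<le> (12 * real q * (4 * real q + 5) * \<Lambda> + 4) * (2 * (real q + 1) * (real n / real m) * real n powr (1 - 2 / real q)) * L\<^sup>2"
  proof (intro mult_right_mono mult_left_mono)
    have "x = 2 * (real q + 1) * (real n / real m) * real m powr (1 - 2 / real q)"
      using mpos by (simp add: x_def Nr powr_diff \<mu>_def)
    also have "\<dots> \<le> 2 * (real q + 1) * (real n / real m) * real n powr (1 - 2 / real q)"
      using m q by (intro mult_left_mono powr_mono2) (auto simp: field_simps)
    finally show "real l \<le> 2 * (real q + 1) * (real n / real m) * real n powr (1 - 2 / real q)" using lx(1) by linarith
  qed (auto simp: \<Lambda>_def)
  also have "\<dots> = K * (real n / real m) * real n powr (1 - 2 / real q) * (ln (real n))\<^sup>2"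
    by (simp only: K_def L_def mult.assoc)
  finally show ?thesis .
qed

text \<open>For \<open>m \<ge> 2 ^ q\<close> the sets are padded and the preceding estimate applies.
  For smaller \<open>m\<close> the bound \<open>k \<le> n\<close> is enough:
  \<open>n \<le> 2 ^ q * (n / m)\<close>, and \<open>ln n \<ge> 1/2\<close> explains the 4 in the
  extra summand \<open>4 * 2 ^ q\<close>.\<close>

lemma matchings_bound:
  fixes q :: nat
  assumes q: "odd q" "q \<ge> 3"
  shows "\<exists>K>0. \<forall>n k m S H. n \<ge> 2 \<longrightarrow> 1 \<le> m \<longrightarrow> m \<le> n \<longrightarrow> k \<le> n \<longrightarrow>
    (\<forall>i<k. pairwise disjnt (H i) \<and> card (H i) = m \<and>
      (\<forall>C\<in>H i. C \<subseteq> {..<n} \<and> card C \<le> q \<and> xor_sum S C = {i})) \<longrightarrow>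
    real k \<le> K * (real n / real m) * real n powr (1 - 2 / real q) * (ln (real n))\<^sup>2"
proof -
  define \<Lambda> :: real where "\<Lambda> = 24576 * 2 ^ (9 * q) * 4 ^ q"
  define K where "K = (12 * real q * (4 * real q + 5) * \<Lambda> + 4) * (2 * (real q + 1))"
  have \<Lambda>0: "\<Lambda> > 0" by (simp add: \<Lambda>_def)
  have "0 < 12 * real q * (4 * real q + 5) * \<Lambda> + 4" using \<Lambda>0 by (intro add_nonneg_pos mult_nonneg_nonneg) auto
  hence K0: "K > 0" unfolding K_def by simp
  show ?thesis
  proof (intro exI[of _ "K + 4 * 2 ^ q"] conjI allI impI)
    show "0 < K + 4 * 2 ^ q" using K0 by (simp add: add_pos_pos)
    fix n k m :: nat and S :: "nat \<Rightarrow> nat set" and H :: "nat \<Rightarrow> nat set set"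
    assume n: "2 \<le> n" and m: "1 \<le> m" "m \<le> n" and k: "k \<le> n"
      and H: "\<forall>i<k. pairwise disjnt (H i) \<and> card (H i) = m \<and> (\<forall>C\<in>H i. C \<subseteq> {..<n} \<and> card C \<le> q \<and> xor_sum S C = {i})"
    have np1: "1 \<le> real n powr (1 - 2 / real q)" using n q by (intro ge_one_powr_ge_zero) (auto simp: field_simps)
    let ?t = "(real n / real m) * real n powr (1 - 2 / real q) * (ln (real n))\<^sup>2"
    have t0: "0 \<le> ?t" by simp
    have "real k \<le> (K + 4 * 2 ^ q) * ?t"
    proof (cases "2 ^ q \<le> m")
      case True
      define H' where "H' i = pad n q ` H i" for i
      define S' where "S' v = (if v < n then S v else {})" for v
      have ne: "C \<subseteq> {..<n}" "C \<noteq> {}" "card C \<le> q" "xor_sum S C = {i}" if "i < k" "C \<in> H i" for i C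
        using H that xor_sum_empty[of S] by (auto simp del: xor_sum_empty)
      have dis: "C \<inter> C' = {}" if "i < k" "C \<in> H i" "C' \<in> H i" "C \<noteq> C'" for i C C'
        using H that unfolding pairwise_def disjnt_def by blast
      have "real k \<le> K * (real n / real m) * real n powr (1 - 2 / real q) * (ln (real n))\<^sup>2"
        unfolding K_def \<Lambda>_def
      proof (rule uniform_matchings_bound_asymptotic[where H = H' and S = S', OF q n True m(2) k])
        fix i assume i: "i < k"
        show "pairwise disjnt (H' i)"
          unfolding H'_def pairwise_image
        proof (intro pairwiseI impI)
          fix C C' assume "C \<in> H i" "C' \<in> H i" "C \<noteq> C'"
          thus "disjnt (pad n q C) (pad n q C')"
            unfolding disjnt_def using ne[OF i] dis[OF i] by (intro pad_disjoint) auto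
        qed
        have "inj_on (pad n q) (H i)"
          using pad_props(3)[OF ne(1-3)[OF i]] by (metis inj_onI)
        thus "card (H' i) = m" using H i by (simp add: H'_def card_image)
        fix C' assume "C' \<in> H' i"
        then obtain C where C: "C \<in> H i" "C' = pad n q C" by (auto simp: H'_def)
        show "C' \<subseteq> {..<(q + 1) * n} \<and> card C' = q \<and> xor_sum S' C' = {i}"
        proof (intro conjI)
          have "S' = (\<lambda>v. if v < n then S v else {})" by (simp add: S'_def fun_eq_iff)
          thus "xor_sum S' C' = {i}" using pad_props(4)[OF ne(1-3)[OF i C(1)], of S] ne(4)[OF i C(1)] C(2) by simp
        qed (use pad_props(1,2)[OF ne(1-3)[OF i C(1)]] C(2) in auto)
      qed
      also have "\<dots> = K * ?t" by (simp only: mult.assoc)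
      also have "\<dots> \<le> (K + 4 * 2 ^ q) * ?t" using t0 by (intro mult_right_mono) auto
      finally show ?thesis .
    next
      case False
      have m2: "real m \<le> 2 ^ q" using False by (metis less_imp_le not_le of_nat_le_iff of_nat_numeral of_nat_power)
      have "ln 2 \<le> ln (real n)" using n by simp
      hence L: "1/2 \<le> ln (real n)" using ln2_ge_two_thirds by linarith
      have L4: "1 \<le> 4 * (ln (real n))\<^sup>2" using mult_mono[OF L L] L by (simp add: power2_eq_square)
      have "real k \<le> real n" using k by simp
      also have "\<dots> \<le> 2 ^ q * (real n / real m)" using m m2 by (simp add: field_simps mult_right_mono)
      also have "\<dots> = 2 ^ q * (real n / real m) * 1 * 1" by simp
      also have "\<dots> \<le> 2 ^ q * (real n / real m) * real n powr (1 - 2 / real q) * (4 * (ln (real n))\<^sup>2)"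
        using np1 L4 by (intro mult_mono) auto
      also have "\<dots> = 4 * 2 ^ q * ?t" by simp
      also have "\<dots> \<le> (K + 4 * 2 ^ q) * ?t" using t0 K0 by (intro mult_right_mono) auto
      finally show ?thesis .
    qed
    thus "real k \<le> (K + 4 * 2 ^ q) * (real n / real m) * real n powr (1 - 2 / real q) * (ln (real n))\<^sup>2"
      by (simp only: mult.assoc)
  qed
qed

theorem theorem2p1:
  fixes q :: nat and \<epsilon> :: real
  assumes "odd q" and "q \<ge> 3" and "\<epsilon> > 0"
  shows "\<exists>C>0. \<forall>(n::nat) (k::nat) (\<delta>::real) (E :: (nat \<Rightarrow> int) \<Rightarrow> nat \<Rightarrow> int).
    n \<ge> 2 \<longrightarrow> \<delta> > 0 \<longrightarrow>
    E \<in> sign_strings k \<rightarrow> sign_strings n \<longrightarrow>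
    linear_code k n E \<longrightarrow>
    locally_decodable q \<delta> \<epsilon> k n E \<longrightarrow>
    real k \<le> C / \<delta> * real n powr (1 - 2 / real q) * (ln (real n))\<^sup>2"
proof -
  obtain K where K: "K > 0" "\<And>n k m S H. n \<ge> 2 \<Longrightarrow> 1 \<le> m \<Longrightarrow> m \<le> n \<Longrightarrow> k \<le> n \<Longrightarrow>
    (\<forall>i<k. pairwise disjnt (H i) \<and> card (H i) = m \<and>
      (\<forall>C\<in>H i. C \<subseteq> {..<n} \<and> card C \<le> q \<and> xor_sum S C = {i})) \<Longrightarrow>
    real k \<le> K * (real n / real m) * real n powr (1 - 2 / real q) * (ln (real n))\<^sup>2"
    using matchings_bound[OF assms(1,2)] by blast
  show ?thesis
  proof (intro exI[of _ "K * real q"] conjI allI impI)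
    show "0 < K * real q" using K(1) assms(2) by simp
    fix n k :: nat and \<delta> :: real and E :: "(nat \<Rightarrow> int) \<Rightarrow> nat \<Rightarrow> int"
    assume n: "2 \<le> n" and \<delta>: "0 < \<delta>" and E: "E \<in> sign_strings k \<rightarrow> sign_strings n"
      and lin: "linear_code k n E" and ldc: "locally_decodable q \<delta> \<epsilon> k n E"
    show "real k \<le> K * real q / \<delta> * real n powr (1 - 2 / real q) * (ln (real n))\<^sup>2"
    \<comment> \<open>The case \<open>k = 0\<close> is separate because \<open>m \<le> n\<close> is
      read off the matching of index 0.\<close>
    proof (cases "k = 0")
      case True
      thus ?thesis using K(1) \<delta> by simp
    next
      case False
      obtain Dec where dec: "local_decoder q \<delta> \<epsilon> k n E Dec" using ldc by (auto simp: locally_decodable_def)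
      obtain S where S: "\<And>v. v < n \<Longrightarrow> S v \<subseteq> {..<k}"
        "\<And>v b. v < n \<Longrightarrow> b \<in> sign_strings k \<Longrightarrow> E b v = (\<Prod>j\<in>S v. b j)"
        using lin unfolding linear_code_def by metis
      have "\<exists>H. pairwise disjnt H \<and> (\<forall>C\<in>H. C \<subseteq> {..<n} \<and> card C \<le> q \<and> xor_sum S C = {i}) \<and>
          \<delta> * real n < real (q * card H)" if "i < k" for i
        using ldc_matching[OF dec assms(3) S E that] .
      then obtain H where H: "\<And>i. i < k \<Longrightarrow> pairwise disjnt (H i)"
        "\<And>i C. i < k \<Longrightarrow> C \<in> H i \<Longrightarrow> C \<subseteq> {..<n} \<and> card C \<le> q \<and> xor_sum S C = {i}"
        "\<And>i. i < k \<Longrightarrow> \<delta> * real n < real (q * card (H i))" by metis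
      \<comment> \<open>All matchings are trimmed to one common size. Rounding up is safe since
        \<open>card (H i)\<close> is an integer above \<open>\<delta> * n / q\<close>, and it makes
        \<open>m\<close> positive.\<close>
      define m where "m = nat \<lceil>\<delta> * real n / real q\<rceil>"
      have q0: "real q > 0" using assms(2) by simp
      have pos: "0 < \<delta> * real n / real q" using \<delta> n q0 by simp
      have mge: "\<delta> * real n / real q \<le> real m" unfolding m_def by linarith
      have m1: "1 \<le> m" using mge pos by (cases m) auto
      have mH: "m \<le> card (H i)" if "i < k" for i
      proof -
        have "\<delta> * real n / real q \<le> real (card (H i))" using H(3)[OF that] q0 by (simp add: field_simps)
        thus ?thesis unfolding m_def by linarith
      qed
      have mn: "m \<le> n"
      proof -
        have "card (H 0) \<le> n" by (rule matching_card_le) (use H(1,2)[of 0] False xor_sum_empty[of S] in \<open>auto simp del: xor_sum_empty\<close>)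
        thus ?thesis using mH[of 0] False by simp
      qed
      have "\<exists>H'. H' \<subseteq> H i \<and> card H' = m" if "i < k" for i
        using obtain_subset_with_card_n[OF mH[OF that]] by metis
      then obtain H' where H': "\<And>i. i < k \<Longrightarrow> H' i \<subseteq> H i \<and> card (H' i) = m" by metis
      have "real k \<le> K * (real n / real m) * real n powr (1 - 2 / real q) * (ln (real n))\<^sup>2"
      proof (rule K(2)[OF n m1 mn ldc_message_length_le[OF dec assms(3) \<delta> E]], intro allI impI conjI)
        fix i assume i: "i < k"
        show "pairwise disjnt (H' i)" using H(1)[OF i] H'[OF i] pairwise_subset by blast
        show "card (H' i) = m" using H'[OF i] by simp
        show "\<forall>C\<in>H' i. C \<subseteq> {..<n} \<and> card C \<le> q \<and> xor_sum S C = {i}" using H(2)[OF i] H'[OF i] by blast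
      qed
      also have "\<dots> \<le> K * (real q / \<delta>) * real n powr (1 - 2 / real q) * (ln (real n))\<^sup>2"
      proof (intro mult_right_mono mult_left_mono)
        \<comment> \<open>Here the size of the matchings becomes the dependence on
          \<open>\<delta>\<close>, with constant \<open>K * q\<close>.\<close>
        show "real n / real m \<le> real q / \<delta>" using mge m1 \<delta> q0 by (simp add: field_simps)
      qed (use K(1) in auto)
      finally show ?thesis by simp
    qed
  qed
qed

end
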